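(* Let $\Omega$ be a domain in $\mathbb{R}^N$. If $2\le k\le N-1$, let $K$ be a piecewise smooth surface of codimension $k$ with $K\cap\Omega\ne\emptyset$; if $k=N$, let $K=\{0\}\subset\Omega$. Let $d(x)=\mathrm{dist}(x,K)$, assume $\sup_{x\in\Omega}d(x)<\infty$ and let $D\ge\sup_{x\in\Omega}d(x)$. Suppose that $p=k$ and that for some constants $B\ge 0$ and $\gamma>0$ the following inequality holds for all $u\in C^\infty_c(\Omega\setminus K)$: $$\int_\Omega|\nabla u|^p\,dx\ \ge\ B\int_\Omega\frac{|u|^p}{d^p}X^\gamma(d/D)\,dx .$$ Then: (i) if $B>0$, then $\gamma\ge p$; (ii) if $\gamma=p$, then $B\le\left(\frac{p-1}{p}\right)^p$.
   Context: $X(t)=-1/\log t$ for $t\in(0,1)$. For $2\le k\le N-1$ the surface $K$ is also assumed closed and connected. *)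

theory Defs
  imports "HOL-Analysis.Analysis"
begin

text \<open>
  Intended for open sets \<open>S\<close>. All iterated directional derivatives up to order \<open>n\<close> exist,
  the derivatives up to order \<open>n - 1\<close> are totally differentiable, and those of order \<open>n\<close> are
  continuous. In finite dimension this is the usual class \<open>C\<close>-\<open>n\<close>.
\<close>

fun times_diff_on ::
  "nat \<Rightarrow> 'a::euclidean_space set \<Rightarrow> ('a \<Rightarrow> 'b::real_normed_vector) \<Rightarrow> bool" where
  "times_diff_on 0 S f \<longleftrightarrow> continuous_on S f"
| "times_diff_on (Suc n) S f \<longleftrightarrow>
     (\<forall>x\<in>S. f differentiable (at x)) \<and>
     (\<forall>v. times_diff_on n S (\<lambda>x. frechet_derivative f (at x) v))"

definition smooth_on ::
  "'a::euclidean_space set \<Rightarrow> ('a \<Rightarrow> 'b::real_normed_vector) \<Rightarrow> bool" where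
  "smooth_on S f \<longleftrightarrow> (\<forall>n. times_diff_on n S f)"

text \<open>
  Elements of the space of test functions on \<open>W\<close> are represented by their extension by zero.
\<close>

definition test_functions :: "'a::euclidean_space set \<Rightarrow> ('a \<Rightarrow> real) set" where
  "test_functions W =
     {u. smooth_on UNIV u \<and> compact (closure {x. u x \<noteq> 0}) \<and> closure {x. u x \<noteq> 0} \<subseteq> W}"

definition gradient :: "('a::euclidean_space \<Rightarrow> real) \<Rightarrow> 'a \<Rightarrow> 'a" where
  "gradient u x = (\<Sum>b\<in>Basis. frechet_derivative u (at x) b *\<^sub>R b)"

text \<open>
  Embedded smooth submanifolds of dimension \<open>m\<close> (without boundary, not necessarily closed),
  given by slice charts.
\<close>

definition smooth_submanifold :: "nat \<Rightarrow> 'a::euclidean_space set \<Rightarrow> bool" where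
  "smooth_submanifold m M \<longleftrightarrow>
     (\<forall>x\<in>M. \<exists>U V \<phi> \<psi> (L :: 'a set).
        open U \<and> x \<in> U \<and> open V \<and> homeomorphism U V \<phi> \<psi> \<and>
        smooth_on U \<phi> \<and> smooth_on V \<psi> \<and>
        subspace L \<and> dim L = m \<and> \<phi> ` (U \<inter> M) = V \<inter> L)"

text \<open>
  A piecewise smooth surface of dimension \<open>m\<close> is a set with a locally finite decomposition into
  connected smooth strata of dimension at most \<open>m\<close>. The strata of dimension \<open>m\<close> are the smooth
  pieces: they are relatively open and together dense. The strata of lower dimension are the
  edges, corners, conical points, and so on along which the pieces meet or end. A smooth
  surface is the case without lower-dimensional strata; polyhedral surfaces and surfaces with
  piecewise smooth boundary are covered as well.
\<close>

definition piecewise_smooth_surface :: "nat \<Rightarrow> 'a::euclidean_space set \<Rightarrow> bool" where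
  "piecewise_smooth_surface m K \<longleftrightarrow>
     (\<exists>\<S>. partition_on K \<S> \<and> locally_finite_in euclidean \<S> \<and>
        (\<forall>S\<in>\<S>. connected S \<and> (\<exists>j\<le>m. smooth_submanifold j S)) \<and>
        (\<forall>S\<in>\<S>. smooth_submanifold m S \<longrightarrow> openin (top_of_set K) S) \<and>
        K \<subseteq> closure (\<Union>{S \<in> \<S>. smooth_submanifold m S}))"

text \<open>
  Only the values on \<open>{0<..<1}\<close> are meaningful. In the Hardy inequality the argument is
  \<open>d / D\<close> with \<open>0 \<le> d \<le> D\<close>. The value \<open>0\<close> of \<open>d\<close> is taken only on \<open>K\<close>, where test functions
  vanish. The value \<open>D\<close> can be taken on \<open>\<Omega>\<close> only at interior maxima of the distance \<open>d\<close>, where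
  \<open>d\<close> is not differentiable, hence on a null set.
\<close>

definition log_weight :: "real \<Rightarrow> real" where
  "log_weight t = - 1 / ln t"

end

theory Submission
  imports Defs
begin

text \<open>
  Near a smooth point of \<open>K\<close> choose a chart \<open>\<Phi>\<close> straightening \<open>K\<close> to a coordinate subspace whose
  derivative at that point is an isometry. On a small ball the norm \<open>\<rho>\<close> of the normal part of \<open>\<Phi>\<close> is
  smooth off \<open>K\<close>, has gradient at most \<open>1 + \<eta>\<close>, and satisfies \<open>d \<le> (1 + \<eta>) \<rho>\<close>; this replaces a
  tubular neighbourhood. With \<open>s = - ln \<rho>\<close> and \<open>\<theta> = (k - 1) / k\<close> the inequality is tested on
  \<open>u = \<zeta> s powr \<theta> H (ln s / M)\<close>, with fixed bumps \<open>\<zeta>\<close> and \<open>H\<close>. Both sides become integrals against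
  \<open>dx / (s \<rho> ^ k)\<close>. Covering and packing by balls shows that the sets \<open>{\<rho> \<le> t}\<close> have volume comparable
  to \<open>t ^ k\<close>, so by summation over logarithmic shells the mass of the window \<open>M \<le> ln s \<le> 2 M\<close> is
  comparable to \<open>M\<close>. Hence differentiating \<open>H\<close> or \<open>\<zeta>\<close> only costs \<open>O(M powr - k)\<close> relative to the main
  term, and
  \<open>B exp (M (k - \<gamma>)) \<le> (1 + \<eta>) ^ (4 k) \<theta> ^ k + O(M powr - k)\<close> for \<open>\<gamma> \<le> k\<close>.
  Let \<open>M \<rightarrow> \<infinity>\<close> and then \<open>\<eta> \<rightarrow> 0\<close>.
\<close>

subsection \<open>Calculus of smooth functions\<close>

text \<open>The window is logarithmic in \<open>s\<close> because volume growth like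
  \<open>t ^ k\<close> turns \<open>dx / (s \<rho> ^ k)\<close> into \<open>ds / s\<close>, the
  differential of \<open>ln s\<close>. The exponent \<theta> is the borderline one: both
  \<open>(s powr \<theta>) ^ k / (\<rho> ^ k * s ^ k)\<close> and the k-th power of
  \<open>s powr (\<theta> - 1) / \<rho>\<close> equal this density, and differentiating
  \<open>s powr \<theta>\<close> only adds the factor \<theta>. So the same mass stands on both
  sides and cancels. The sharp constant therefore needs no sharp volume constant, only that the
  whole window carries at most a fixed multiple of the mass of the part where the cutoffs are
  bounded below. On the weighted side \<open>X powr \<gamma>\<close> behaves like
  \<open>s powr (- k)\<close> times \<open>s powr (k - \<gamma>)\<close>, and
  \<open>ln s \<ge> M\<close> makes the last factor at least \<open>exp (M (k - \<gamma>))\<close>.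
  This one exponential gives both claims: it is unbounded for \<open>\<gamma> < k\<close> and equal
  to 1 for \<open>\<gamma> = k\<close>. The distance \<open>d\<close> is compared with \<rho> in one
  direction only. That suffices because \<open>d ^ k * ln (D / d) powr \<gamma>\<close> increases
  with \<open>d\<close> near \<open>K\<close> when \<open>\<gamma> \<le> k\<close>.\<close>

lemma times_diff_on_cong:
  fixes f g :: "'a::euclidean_space \<Rightarrow> 'b::real_normed_vector"
  assumes "open S" "\<And>x. x \<in> S \<Longrightarrow> f x = g x" "times_diff_on n S f"
  shows "times_diff_on n S g"
  using assms(2,3)
proof (induction n arbitrary: f g)
  case 0
  from 0(2) have "continuous_on S f" by simp
  then have "continuous_on S g" by (rule continuous_on_eq) (use 0 in simp)
  then show ?case by simp
next
  case (Suc n)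
  have hd: "(g has_derivative frechet_derivative f (at x)) (at x)" if "x \<in> S" for x
    using has_derivative_transform_within_open[OF _ assms(1) that, of f _ UNIV g] Suc.prems that
    by (simp add: frechet_derivative_works[symmetric])
  then have eq: "frechet_derivative f (at x) = frechet_derivative g (at x)" if "x \<in> S" for x
    using frechet_derivative_at that by blast
  show ?case
  proof (simp, intro conjI ballI allI)
    show "g differentiable at x" if "x \<in> S" for x
      using hd[OF that] differentiable_def by blast
    show "times_diff_on n S (\<lambda>x. frechet_derivative g (at x) v)" for v
      using Suc.IH[of "\<lambda>x. frechet_derivative f (at x) v" "\<lambda>x. frechet_derivative g (at x) v"]
        eq Suc.prems(2) by simp
  qed
qed

text \<open>The definition speaks of \<open>frechet_derivative\<close>, while derivative rules
  produce explicit formulas; by uniqueness of the derivative on an open set one may replace the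
  other at every order.\<close>

lemma times_diff_on_SucI:
  fixes f :: "'a::euclidean_space \<Rightarrow> 'b::real_normed_vector"
  assumes "open S" "\<And>x. x \<in> S \<Longrightarrow> (f has_derivative f' x) (at x)"
    "\<And>v. times_diff_on n S (\<lambda>x. f' x v)"
  shows "times_diff_on (Suc n) S f"
proof -
  have eq: "f' x v = frechet_derivative f (at x) v" if "x \<in> S" for x v
    using frechet_derivative_at[OF assms(2)[OF that]] by simp
  have "f differentiable at x" if "x \<in> S" for x
    using assms(2)[OF that] differentiable_def by blast
  then show ?thesis
    using times_diff_on_cong[OF assms(1) eq assms(3)] by auto
qed

lemma times_diff_on_SucD:
  assumes "times_diff_on (Suc n) S f"
  shows "\<And>x. x \<in> S \<Longrightarrow> (f has_derivative frechet_derivative f (at x)) (at x)"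
    and "times_diff_on n S (\<lambda>x. frechet_derivative f (at x) v)"
  using assms by (auto simp: frechet_derivative_works[symmetric])

lemma times_diff_on_Suc_imp: "times_diff_on (Suc n) S f \<Longrightarrow> times_diff_on n S f"
proof (induction n arbitrary: f)
  case 0
  then have "f differentiable at x" if "x \<in> S" for x
    using that by simp
  then show ?case
    by (simp add: continuous_at_imp_continuous_on differentiable_imp_continuous_within)
next
  case (Suc n)
  have "times_diff_on n S (\<lambda>x. frechet_derivative f (at x) v)" for v
    by (rule Suc.IH, rule times_diff_on_SucD(2)[OF Suc.prems])
  moreover have "\<forall>x\<in>S. f differentiable at x"
    using Suc.prems unfolding times_diff_on.simps(2) by (rule conjunct1)
  ultimately show ?case unfolding times_diff_on.simps(2) by (intro conjI allI)
qed

lemma times_diff_on_subset: "times_diff_on n S f \<Longrightarrow> T \<subseteq> S \<Longrightarrow> times_diff_on n T f"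
  by (induction n arbitrary: f) (auto intro: continuous_on_subset)

lemma times_diff_on_Un:
  "open S \<Longrightarrow> open T \<Longrightarrow> times_diff_on n S f \<Longrightarrow> times_diff_on n T f \<Longrightarrow> times_diff_on n (S \<union> T) f"
  by (induction n arbitrary: f) (auto intro: continuous_on_open_Un)

lemma times_diff_on_const: "open S \<Longrightarrow> times_diff_on n S (\<lambda>x. c)"
  by (induction n arbitrary: c) auto

lemma times_diff_on_add:
  assumes "open S"
  shows "times_diff_on n S f \<Longrightarrow> times_diff_on n S g \<Longrightarrow> times_diff_on n S (\<lambda>x. f x + g x)"
proof (induction n arbitrary: f g)
  case 0
  then show ?case by (auto intro: continuous_on_add)
next
  case (Suc n)
  show ?case
    by (rule times_diff_on_SucI[OF assms has_derivative_add[OF times_diff_on_SucD(1)[OF Suc.prems(1)]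
          times_diff_on_SucD(1)[OF Suc.prems(2)]]], assumption+,
        rule Suc.IH[OF times_diff_on_SucD(2)[OF Suc.prems(1)] times_diff_on_SucD(2)[OF Suc.prems(2)]])
qed

lemma times_diff_on_bounded_linear:
  assumes "open S" "bounded_linear l"
  shows "times_diff_on n S f \<Longrightarrow> times_diff_on n S (\<lambda>x. l (f x))"
proof (induction n arbitrary: f)
  case 0
  then show ?case using bounded_linear.continuous_on[OF assms(2)] by auto
next
  case (Suc n)
  show ?case
    by (rule times_diff_on_SucI[OF assms(1) bounded_linear.has_derivative[OF assms(2)
          times_diff_on_SucD(1)[OF Suc.prems]]], assumption,
        rule Suc.IH[OF times_diff_on_SucD(2)[OF Suc.prems]])
qed

lemma times_diff_on_mult:
  fixes f g :: "'a::euclidean_space \<Rightarrow> real"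
  assumes "open S"
  shows "times_diff_on n S f \<Longrightarrow> times_diff_on n S g \<Longrightarrow> times_diff_on n S (\<lambda>x. f x * g x)"
proof (induction n arbitrary: f g)
  case 0
  then show ?case by (auto intro: continuous_on_mult)
next
  case (Suc n)
  note f = Suc.prems(1) and g = Suc.prems(2)
  show ?case
  proof (rule times_diff_on_SucI[OF assms])
    show "((\<lambda>x. f x * g x) has_derivative
        (\<lambda>v. f x * frechet_derivative g (at x) v + frechet_derivative f (at x) v * g x)) (at x)"
      if "x \<in> S" for x
      by (rule has_derivative_mult[OF times_diff_on_SucD(1)[OF f that] times_diff_on_SucD(1)[OF g that]])
    show "times_diff_on n S (\<lambda>x. f x * frechet_derivative g (at x) v + frechet_derivative f (at x) v * g x)" for v
      by (rule times_diff_on_add[OF assms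
          Suc.IH[OF times_diff_on_Suc_imp[OF f] times_diff_on_SucD(2)[OF g]]
          Suc.IH[OF times_diff_on_SucD(2)[OF f] times_diff_on_Suc_imp[OF g]]])
  qed
qed

text \<open>For a real outer function the chain rule yields a product of two real factors,
  \<open>frechet_derivative f (at x) v\<close> and the derivative of \<open>g\<close> at
  \<open>f x\<close>. The product rule and the induction hypothesis for the derivative of
  \<open>g\<close> then apply, so the induction varies \<open>g\<close> only.\<close>

lemma times_diff_on_compose:
  fixes g :: "real \<Rightarrow> real" and f :: "'a::euclidean_space \<Rightarrow> real"
  assumes "open S"
  shows "times_diff_on n T g \<Longrightarrow> times_diff_on n S f \<Longrightarrow> f ` S \<subseteq> T \<Longrightarrow> times_diff_on n S (\<lambda>x. g (f x))"
proof (induction n arbitrary: g)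
  case 0
  then show ?case using continuous_on_compose2[of T g S f] by simp
next
  case (Suc n)
  note g = Suc.prems(1) and f = Suc.prems(2)
  show ?case
  proof (rule times_diff_on_SucI[OF assms])
    show "((\<lambda>x. g (f x)) has_derivative
      (\<lambda>v. frechet_derivative f (at x) v * frechet_derivative g (at (f x)) 1)) (at x)" if "x \<in> S" for x
    proof -
      have hg: "(g has_derivative frechet_derivative g (at (f x))) (at (f x))"
        by (rule times_diff_on_SucD(1)[OF g]) (use Suc.prems(3) that in blast)
      have "frechet_derivative g (at (f x)) w = w * frechet_derivative g (at (f x)) 1" for w
        using linear_scale[OF has_derivative_linear[OF hg], of w 1] by simp
      then have "frechet_derivative g (at (f x)) = (\<lambda>w. w * frechet_derivative g (at (f x)) 1)"
        by (rule ext)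
      with hg have "(g has_derivative (\<lambda>w. w * frechet_derivative g (at (f x)) 1)) (at (f x))"
        by (rule back_subst[where P="\<lambda>h. (g has_derivative h) (at (f x))"])
      from has_derivative_compose[OF times_diff_on_SucD(1)[OF f that] this] show ?thesis .
    qed
    show "times_diff_on n S (\<lambda>x. frechet_derivative f (at x) v * frechet_derivative g (at (f x)) 1)" for v
      by (rule times_diff_on_mult[OF assms times_diff_on_SucD(2)[OF f]
          Suc.IH[OF times_diff_on_SucD(2)[OF g] times_diff_on_Suc_imp[OF f] Suc.prems(3)]])
  qed
qed

lemma smooth_on_const: "open S \<Longrightarrow> smooth_on S (\<lambda>x. c)"
  by (simp add: smooth_on_def times_diff_on_const)

lemma smooth_on_subset: "smooth_on S f \<Longrightarrow> T \<subseteq> S \<Longrightarrow> smooth_on T f"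
  by (meson smooth_on_def times_diff_on_subset)

lemma smooth_on_add: "open S \<Longrightarrow> smooth_on S f \<Longrightarrow> smooth_on S g \<Longrightarrow> smooth_on S (\<lambda>x. f x + g x)"
  by (simp add: smooth_on_def times_diff_on_add)

lemma smooth_on_mult:
  fixes f g :: "'a::euclidean_space \<Rightarrow> real"
  shows "open S \<Longrightarrow> smooth_on S f \<Longrightarrow> smooth_on S g \<Longrightarrow> smooth_on S (\<lambda>x. f x * g x)"
  by (simp add: smooth_on_def times_diff_on_mult)

lemma smooth_on_bounded_linear:
  "open S \<Longrightarrow> bounded_linear l \<Longrightarrow> smooth_on S f \<Longrightarrow> smooth_on S (\<lambda>x. l (f x))"
  by (simp add: smooth_on_def times_diff_on_bounded_linear)

lemma smooth_on_compose:
  fixes g :: "real \<Rightarrow> real" and f :: "'a::euclidean_space \<Rightarrow> real"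
  shows "open S \<Longrightarrow> smooth_on T g \<Longrightarrow> smooth_on S f \<Longrightarrow> f ` S \<subseteq> T \<Longrightarrow> smooth_on S (\<lambda>x. g (f x))"
  unfolding smooth_on_def by (intro allI, rule times_diff_on_compose) auto

lemma smooth_on_Un: "open S \<Longrightarrow> open T \<Longrightarrow> smooth_on S f \<Longrightarrow> smooth_on T f \<Longrightarrow> smooth_on (S \<union> T) f"
  by (simp add: smooth_on_def times_diff_on_Un)

lemma smooth_on_cong:
  fixes f g :: "'a::euclidean_space \<Rightarrow> 'b::real_normed_vector"
  shows "open S \<Longrightarrow> (\<And>x. x \<in> S \<Longrightarrow> f x = g x) \<Longrightarrow> smooth_on S f \<Longrightarrow> smooth_on S g"
  unfolding smooth_on_def by (intro allI, rule times_diff_on_cong[where f=f]) auto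

lemma smooth_on_sum:
  assumes "open S" "\<And>i. i \<in> I \<Longrightarrow> smooth_on S (f i)"
  shows "smooth_on S (\<lambda>x. \<Sum>i\<in>I. f i x)"
  using assms(2)
  by (induction I rule: infinite_finite_induct) (auto simp: smooth_on_const smooth_on_add assms(1))

lemma smooth_on_ident:
  fixes S :: "'a::euclidean_space set"
  assumes "open S" shows "smooth_on S (\<lambda>x. x)"
proof -
  have "times_diff_on n S (\<lambda>x. x)" for n
  proof (cases n)
    case (Suc m)
    have "times_diff_on (Suc m) S (\<lambda>x. x)"
      by (rule times_diff_on_SucI[OF assms has_derivative_ident times_diff_on_const[OF assms]])
    then show ?thesis using Suc by simp
  qed auto
  then show ?thesis by (simp add: smooth_on_def)
qed

lemma smooth_on_has_derivative:
  assumes "smooth_on S f" "x \<in> S"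
  shows "(f has_derivative frechet_derivative f (at x)) (at x)"
proof -
  have "times_diff_on (Suc 0) S f" using assms(1) unfolding smooth_on_def by (rule spec)
  then show ?thesis using assms(2) by (rule times_diff_on_SucD(1))
qed

lemma smooth_on_frechet_derivative:
  "smooth_on S f \<Longrightarrow> smooth_on S (\<lambda>x. frechet_derivative f (at x) v)"
  unfolding smooth_on_def by (rule allI, rule times_diff_on_SucD(2)) (rule spec)

lemma smooth_on_imp_continuous_on: "smooth_on S f \<Longrightarrow> continuous_on S f"
  unfolding smooth_on_def by (drule spec[of _ 0]) simp

text \<open>Induction on the order runs over the whole family at once, since the derivative of a
  member is a multiple of a member. It is made for families such as \<open>exp\<close>, the integer
  powers, or polynomials in \<open>1 / x\<close> times \<open>exp (- (1 / x))\<close>.\<close>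

lemma smooth_on_derivative_closed:
  fixes F :: "(real \<Rightarrow> real) set"
  assumes "open S" "f \<in> F"
    "\<And>g. g \<in> F \<Longrightarrow> \<exists>g'\<in>F. \<exists>c. \<forall>x\<in>S. (g has_field_derivative c * g' x) (at x)"
  shows "smooth_on S f"
proof -
  have "times_diff_on n S g" if "g \<in> F" for n g
    using that
  proof (induction n arbitrary: g)
    case 0
    then obtain g' c where "\<And>x. x \<in> S \<Longrightarrow> (g has_field_derivative c * g' x) (at x)"
      using assms(3) by meson
    then show ?case
      by (auto intro!: continuous_at_imp_continuous_on DERIV_isCont)
  next
    case (Suc n)
    obtain g' c where g': "g' \<in> F" "\<And>x. x \<in> S \<Longrightarrow> (g has_field_derivative c * g' x) (at x)"
      using assms(3)[OF Suc.prems] by blast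
    show ?case
    proof (rule times_diff_on_SucI[OF assms(1)])
      show "(g has_derivative (*) (c * g' x)) (at x)" if "x \<in> S" for x
        using g'(2)[OF that] has_field_derivative_def by blast
      show "times_diff_on n S (\<lambda>x. c * g' x * v)" for v
        by (intro times_diff_on_mult times_diff_on_const Suc.IH assms(1) g')
    qed
  qed
  then show ?thesis using assms(2) by (auto simp: smooth_on_def)
qed

section \<open>Exponential, integer powers and logarithm\<close>

lemma smooth_on_exp: "smooth_on UNIV (exp :: real \<Rightarrow> real)"
  by (rule smooth_on_derivative_closed[where F="{exp}"])
     (auto intro!: exI[of _ 1] derivative_eq_intros)

lemma smooth_on_power_int: "smooth_on (- {0}) (\<lambda>x::real. x powi m)"
proof (rule smooth_on_derivative_closed[where F="{f. \<exists>m. f = (\<lambda>x. x powi m)}"])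
  show "\<exists>g'\<in>{f. \<exists>m. f = (\<lambda>x. x powi m)}. \<exists>c. \<forall>x\<in>- {0::real}. (g has_real_derivative c * g' x) (at x)"
    if g: "g \<in> {f. \<exists>m. f = (\<lambda>x::real. x powi m)}" for g
  proof -
    obtain m where m: "g = (\<lambda>x. x powi m)" using g by auto
    have "(g has_real_derivative of_int m * x powi (m - 1)) (at x)" if "x \<noteq> 0" for x
      unfolding m using that by (auto intro!: derivative_eq_intros)
    then show ?thesis
      by (intro bexI[of _ "\<lambda>x. x powi (m - 1)"] exI[of _ "of_int m"]) auto
  qed
qed auto

lemma smooth_on_inverse: "smooth_on (- {0}) (inverse :: real \<Rightarrow> real)"
  using smooth_on_power_int[of "-1"] by (simp add: power_int_minus)

lemma smooth_on_ln: "smooth_on {0<..} (ln :: real \<Rightarrow> real)"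
proof -
  have "times_diff_on n {0<..} (ln :: real \<Rightarrow> real)" for n
  proof (cases n)
    case 0
    then show ?thesis by (auto intro!: continuous_intros)
  next
    case (Suc m)
    have "times_diff_on (Suc m) {0<..} (ln :: real \<Rightarrow> real)"
    proof (rule times_diff_on_SucI)
      show "(ln has_derivative (*) (inverse x)) (at x)" if "x \<in> {0<..}" for x :: real
        using that DERIV_ln[of x] by (simp add: has_field_derivative_def)
      have "smooth_on {0<..} (inverse :: real \<Rightarrow> real)"
        by (rule smooth_on_subset[OF smooth_on_inverse]) auto
      then show "times_diff_on m {0<..} (\<lambda>x::real. inverse x * v)" for v
        by (intro times_diff_on_mult times_diff_on_const) (auto simp: smooth_on_def)
    qed auto
    then show ?thesis using Suc by simp
  qed
  then show ?thesis by (simp add: smooth_on_def)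
qed

subsection \<open>Bump functions\<close>

lemma tendsto_poly_mult_exp_minus:
  fixes p :: "real poly"
  shows "((\<lambda>y. poly p y * exp (- y)) \<longlongrightarrow> 0) at_top"
proof -
  have "((\<lambda>y. \<Sum>i\<le>degree p. coeff p i * (y ^ i / exp y)) \<longlongrightarrow> (\<Sum>i\<le>degree p. coeff p i * 0)) at_top"
    by (intro tendsto_sum tendsto_mult tendsto_const tendsto_power_div_exp_0)
  then show ?thesis
    by (simp add: poly_altdef sum_distrib_right exp_minus field_simps sum_divide_distrib)
qed

definition exp_bump :: "real \<Rightarrow> real" where
  "exp_bump x = (if x > 0 then exp (- (1 / x)) else 0)"

text \<open>Consider all polynomials \<open>p\<close> in \<open>y = 1 / x\<close> times
  \<open>exp (- y)\<close>, extended by zero. Differentiation replaces \<open>p\<close> by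
  \<open>y ^ 2 * (p - pderiv p)\<close>, which is the factor \<open>[:0, 0, 1:]\<close>, and at 0
  the exponential beats every polynomial.\<close>

lemma smooth_on_exp_bump: "smooth_on UNIV exp_bump"
proof -
  define f where "f p x = (if x > 0 then poly p (1 / x) * exp (- (1 / x)) else 0)" for p and x :: real
  have deriv: "(f p has_field_derivative f ([:0, 0, 1:] * (p - pderiv p)) x) (at x)" for p x
  proof -
    consider "x > 0" | "x < 0" | "x = 0" by linarith
    then show ?thesis
    proof cases
      case 1
      have "((\<lambda>x. poly p (1 / x) * exp (- (1 / x))) has_field_derivative
          f ([:0, 0, 1:] * (p - pderiv p)) x) (at x)"
        using 1 by (auto intro!: derivative_eq_intros simp: f_def field_simps power2_eq_square)
      then show ?thesis
        by (rule has_field_derivative_transform_within_open[where S="{0<..}"])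
          (use 1 in \<open>auto simp: f_def\<close>)
    next
      case 2
      have "((\<lambda>x. 0) has_field_derivative f ([:0, 0, 1:] * (p - pderiv p)) x) (at x)"
        using 2 by (auto simp: f_def)
      then show ?thesis
        by (rule has_field_derivative_transform_within_open[where S="{..<0}"])
          (use 2 in \<open>auto simp: f_def\<close>)
    next
      case 3
      \<comment> \<open>The difference quotient at 0 has the same shape: dividing by
        \<open>h\<close> multiplies the polynomial in \<open>1 / h\<close> by its variable, which is
        \<open>pCons 0 p\<close>.\<close>
      have "((\<lambda>h. poly (pCons 0 p) (inverse h) * exp (- inverse h)) \<longlongrightarrow> 0) (at_right (0::real))"
        using tendsto_poly_mult_exp_minus[of "pCons 0 p"] filterlim_inverse_at_top_right
        by (rule filterlim_compose)
      then have "((\<lambda>h. f p h / h) \<longlongrightarrow> 0) (at_right 0)"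
        by (rule filterlim_cong[THEN iffD1, rotated -1, OF _ refl refl])
          (auto simp: f_def field_simps eventually_at_right_field intro!: exI[of _ 1])
      moreover have "((\<lambda>h. f p h / h) \<longlongrightarrow> 0) (at_left 0)"
        by (rule tendsto_eventually) (auto simp: f_def eventually_at_left_field intro!: exI[of _ "-1"])
      ultimately have "((\<lambda>h. f p h / h) \<longlongrightarrow> 0) (at 0)"
        by (simp add: filterlim_at_split)
      then show ?thesis
        using 3 by (simp add: DERIV_def f_def)
    qed
  qed
  have "smooth_on UNIV (f 1)"
  proof (rule smooth_on_derivative_closed[where F="range f"])
    fix g assume "g \<in> range f"
    then obtain p where "g = f p" by auto
    then show "\<exists>g'\<in>range f. \<exists>c. \<forall>x\<in>UNIV. (g has_real_derivative c * g' x) (at x)"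
      using deriv[of p] by (intro bexI[of _ "f ([:0, 0, 1:] * (p - pderiv p))"] exI[of _ 1]) auto
  qed auto
  moreover have "f 1 = exp_bump" by (auto simp: f_def exp_bump_def)
  ultimately show ?thesis by simp
qed

lemma exp_bump_nonneg: "0 \<le> exp_bump x" and exp_bump_le_1: "exp_bump x \<le> 1"
  and exp_bump_pos_iff: "0 < exp_bump x \<longleftrightarrow> 0 < x"
  by (auto simp: exp_bump_def)

lemma exp_bump_mono: "x \<le> y \<Longrightarrow> exp_bump x \<le> exp_bump y"
  by (auto simp: exp_bump_def frac_le)

text \<open>The profile in the variable \<open>ln (- ln d) / M\<close>.\<close>

lemma bump_profile_exists:
  obtains H :: "real \<Rightarrow> real" and c C where "smooth_on UNIV H" "0 < c" "0 < C"
    "\<And>t. 0 \<le> H t" "\<And>t. H t \<le> 1" "\<And>t. t \<notin> {1<..<2} \<Longrightarrow> H t = 0"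
    "\<And>t. t \<in> {5/4..7/4} \<Longrightarrow> c \<le> H t" "\<And>t. (H has_real_derivative deriv H t) (at t)"
    "\<And>t. \<bar>deriv H t\<bar> \<le> C" "\<And>t. t \<notin> {1..2} \<Longrightarrow> deriv H t = 0"
proof -
  define H where "H t = exp_bump (t - 1) * exp_bump (2 - t)" for t
  have lin: "smooth_on UNIV (\<lambda>t::real. t - 1)" "smooth_on UNIV (\<lambda>t::real. 2 - t)"
    using smooth_on_add[OF open_UNIV smooth_on_ident smooth_on_const[of UNIV "-1"]]
      smooth_on_add[OF open_UNIV smooth_on_const[of UNIV 2]
        smooth_on_bounded_linear[OF open_UNIV bounded_linear_minus[OF bounded_linear_ident] smooth_on_ident]]
    by simp_all
  have smooth: "smooth_on UNIV H"
    unfolding H_def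
    by (intro smooth_on_mult smooth_on_compose[OF _ smooth_on_exp_bump] lin) auto
  have D: "(H has_field_derivative frechet_derivative H (at t) 1) (at t)" for t
  proof -
    have d: "(H has_derivative frechet_derivative H (at t)) (at t)"
      using smooth_on_has_derivative[OF smooth] by blast
    have "frechet_derivative H (at t) h = h * frechet_derivative H (at t) 1" for h
      using linear_scale[OF has_derivative_linear[OF d], of h 1] by simp
    then have "frechet_derivative H (at t) = (*) (frechet_derivative H (at t) 1)"
      by (intro ext) (metis mult.commute)
    with d show ?thesis
      unfolding has_field_derivative_def by (rule back_subst)
  qed
  then have deriv: "deriv H t = frechet_derivative H (at t) 1" for t
    by (rule DERIV_imp_deriv)
  have D': "(H has_field_derivative deriv H t) (at t)" for t
    using D[of t] by (simp add: deriv)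
  have zero: "H t = 0" if "t \<notin> {1<..<2}" for t
    using that by (auto simp: H_def exp_bump_def)
  have dzero: "deriv H t = 0" if "t \<notin> {1..2}" for t
  proof -
    have "((\<lambda>_. 0) has_field_derivative deriv H t) (at t)"
      by (rule has_field_derivative_transform_within_open[OF D', where S="- {1..2}"])
        (use that zero in auto)
    then show ?thesis using DERIV_unique DERIV_const by blast
  qed
  have "continuous_on {1..2} (deriv H)"
    using smooth_on_imp_continuous_on[OF smooth_on_frechet_derivative[OF smooth, of 1]]
    by (auto simp: deriv[abs_def] intro: continuous_on_subset)
  then have "bounded (deriv H ` {1..2})"
    by (intro compact_imp_bounded compact_continuous_image) auto
  then obtain C where C: "C > 0" "\<And>t. t \<in> {1..2} \<Longrightarrow> \<bar>deriv H t\<bar> \<le> C"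
    by (auto simp: bounded_pos)
  show ?thesis
  proof (rule that[of H "exp_bump (1/4) * exp_bump (1/4)" C])
    show "exp_bump (1/4) * exp_bump (1/4) \<le> H t" if "t \<in> {5/4..7/4}" for t
      unfolding H_def using that by (intro mult_mono exp_bump_mono exp_bump_nonneg) auto
    show "H t \<le> 1" "0 \<le> H t" for t
      unfolding H_def by (auto intro!: mult_le_one mult_nonneg_nonneg simp: exp_bump_nonneg exp_bump_le_1)
    show "\<bar>deriv H t\<bar> \<le> C" for t
      using C dzero[of t] by (cases "t \<in> {1..2}") auto
  qed (use smooth C zero dzero D' in \<open>auto simp: exp_bump_pos_iff\<close>)
qed

lemma norm_frechet_derivative_bounded_of_support:
  fixes f :: "'a::euclidean_space \<Rightarrow> real"
  assumes "smooth_on UNIV f" "compact S" "\<And>x. x \<notin> S \<Longrightarrow> f x = 0"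
  obtains C where "C > 0" "\<And>x v. \<bar>frechet_derivative f (at x) v\<bar> \<le> C * norm v"
proof -
  let ?D = "\<lambda>x v. frechet_derivative f (at x) v"
  have lin: "linear (?D x)" for x
    using has_derivative_linear[OF smooth_on_has_derivative[OF assms(1)]] by blast
  have zero: "?D x v = 0" if "x \<notin> S" for x v
  proof -
    have "((\<lambda>_. 0) has_derivative ?D x) (at x)"
      by (rule has_derivative_transform_within_open[OF smooth_on_has_derivative[OF assms(1)], of _ "- S"])
        (use that assms compact_imp_closed in auto)
    then show ?thesis
      using has_derivative_unique[OF _ has_derivative_const] by metis
  qed
  have "\<exists>C>0. \<forall>x\<in>S. \<bar>?D x b\<bar> \<le> C" for b
  proof -
    have "continuous_on S (\<lambda>x. ?D x b)"
      using smooth_on_imp_continuous_on[OF smooth_on_frechet_derivative[OF assms(1)]] continuous_on_subset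
      by blast
    then have "bounded ((\<lambda>x. ?D x b) ` S)"
      using assms(2) by (intro compact_imp_bounded compact_continuous_image) auto
    then show ?thesis by (auto simp: bounded_pos)
  qed
  then obtain c where c: "\<And>b. c b > 0" "\<And>b x. x \<in> S \<Longrightarrow> \<bar>?D x b\<bar> \<le> c b" by metis
  have "\<bar>?D x v\<bar> \<le> (\<Sum>b\<in>Basis. c b) * norm v" for x v
  proof -
    have "?D x v = ?D x (\<Sum>b\<in>Basis. (v \<bullet> b) *\<^sub>R b)" by (simp add: euclidean_representation)
    also have "\<dots> = (\<Sum>b\<in>Basis. (v \<bullet> b) * ?D x b)"
      by (simp add: linear_sum[OF lin] linear_scale[OF lin])
    finally have "\<bar>?D x v\<bar> \<le> (\<Sum>b\<in>Basis. \<bar>v \<bullet> b\<bar> * \<bar>?D x b\<bar>)"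
      by (simp add: abs_mult[symmetric] sum_abs)
    also have "\<dots> \<le> (\<Sum>b\<in>Basis. norm v * c b)"
    proof (intro sum_mono mult_mono)
      show "\<bar>?D x b\<bar> \<le> c b" for b
        using c zero[of x b] by (cases "x \<in> S") (auto simp: less_imp_le)
    qed (auto simp: Basis_le_norm)
    finally show ?thesis by (simp add: sum_distrib_left mult.commute)
  qed
  moreover have "(\<Sum>b\<in>Basis. c b) > 0" using c by (simp add: sum_pos)
  ultimately show ?thesis using that by blast
qed

lemma smooth_on_norm_sq: "smooth_on UNIV (\<lambda>x. (norm (x - a))\<^sup>2 :: real)" for a :: "'a::euclidean_space"
proof -
  have "smooth_on UNIV (\<lambda>x. x \<bullet> b + - (a \<bullet> b))" for b :: 'a
    by (intro smooth_on_add smooth_on_const smooth_on_bounded_linear[OF open_UNIV bounded_linear_inner_left]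
        smooth_on_ident open_UNIV)
  then have "smooth_on UNIV (\<lambda>x. \<Sum>b\<in>Basis. (x \<bullet> b + - (a \<bullet> b)) * (x \<bullet> b + - (a \<bullet> b)))"
    by (intro smooth_on_sum smooth_on_mult open_UNIV)
  moreover have "(\<Sum>b\<in>Basis. (x \<bullet> b + - (a \<bullet> b)) * (x \<bullet> b + - (a \<bullet> b))) = (norm (x - a))\<^sup>2" for x
    unfolding power2_norm_eq_inner euclidean_inner[of "x - a" "x - a"]
    by (simp add: inner_diff_left)
  ultimately show ?thesis by simp
qed

lemma bump_cutoff_exists:
  fixes a :: "'a::euclidean_space"
  assumes "0 < r" "r < s"
  obtains \<zeta> :: "'a \<Rightarrow> real" and c C where "smooth_on UNIV \<zeta>" "0 < c" "0 < C"
    "\<And>x. 0 \<le> \<zeta> x" "\<And>x. \<zeta> x \<le> 1" "\<And>x. x \<notin> cball a s \<Longrightarrow> \<zeta> x = 0"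
    "\<And>x. x \<in> ball a r \<Longrightarrow> c \<le> \<zeta> x" "\<And>x v. \<bar>frechet_derivative \<zeta> (at x) v\<bar> \<le> C * norm v"
proof -
  \<comment> \<open>The squared norm keeps the function smooth at the centre
    \<open>a\<close>.\<close>
  define \<zeta> where "\<zeta> x = exp_bump (s\<^sup>2 + - ((norm (x - a))\<^sup>2))" for x
  have smooth: "smooth_on UNIV \<zeta>"
    unfolding \<zeta>_def
    by (intro smooth_on_compose[OF _ smooth_on_exp_bump] smooth_on_add smooth_on_const
       smooth_on_bounded_linear[OF open_UNIV bounded_linear_minus[OF bounded_linear_ident] smooth_on_norm_sq]) auto
  have zero: "\<zeta> x = 0" if "x \<notin> cball a s" for x
    using that assms power_strict_mono[of s "norm (x - a)" 2]
    by (auto simp: \<zeta>_def exp_bump_def dist_norm norm_minus_commute)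
  obtain C where C: "C > 0" "\<And>x v. \<bar>frechet_derivative \<zeta> (at x) v\<bar> \<le> C * norm v"
    using norm_frechet_derivative_bounded_of_support[OF smooth compact_cball zero] by blast
  have rs: "r\<^sup>2 < s\<^sup>2" using assms by (intro power_strict_mono) auto
  show ?thesis
  proof (rule that[of \<zeta> "exp_bump (s\<^sup>2 - r\<^sup>2)" C])
    show "exp_bump (s\<^sup>2 - r\<^sup>2) \<le> \<zeta> x" if "x \<in> ball a r" for x
      unfolding \<zeta>_def using that power_mono[of "norm (x - a)" r 2]
      by (intro exp_bump_mono) (auto simp: dist_norm norm_minus_commute)
  qed (use smooth C zero rs in \<open>auto simp: exp_bump_pos_iff \<zeta>_def exp_bump_nonneg exp_bump_le_1\<close>)
qed

subsection \<open>Straightening charts\<close>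

lemma subspace_projection_exists:
  fixes S :: "'a::euclidean_space set"
  assumes "subspace S"
  obtains \<pi> where "linear \<pi>" "\<And>x. \<pi> x \<in> S" "\<And>x y. y \<in> S \<Longrightarrow> (x - \<pi> x) \<bullet> y = 0" "\<And>x. x \<in> S \<Longrightarrow> \<pi> x = x"
proof -
  obtain B where B: "B \<subseteq> S" "pairwise orthogonal B" "\<And>x. x \<in> B \<Longrightarrow> norm x = 1"
     "independent B" "card B = dim S" "span B = S"
    using orthonormal_basis_subspace[OF assms] by metis
  have fin: "finite B" using B(4) independent_imp_finite by blast
  define \<pi> where "\<pi> x = (\<Sum>b\<in>B. (x \<bullet> b) *\<^sub>R b)" for x
  have lin: "linear \<pi>"
    unfolding \<pi>_def
    by (intro linearI) (simp_all add: inner_add_left scaleR_add_left sum.distrib scaleR_sum_right)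
  have inS: "\<pi> x \<in> S" for x
    unfolding \<pi>_def using B(1) assms by (intro subspace_sum subspace_scale) auto
  have orthB: "(x - \<pi> x) \<bullet> c = 0" if "c \<in> B" for x c
  proof -
    have "\<pi> x \<bullet> c = (\<Sum>b\<in>B. if b = c then x \<bullet> c else 0)"
      unfolding \<pi>_def inner_sum_left
    proof (rule sum.cong)
      show "(x \<bullet> b) *\<^sub>R b \<bullet> c = (if b = c then x \<bullet> c else 0)" if "b \<in> B" for b
        using B(2) B(3)[of c] that \<open>c \<in> B\<close>
        by (auto simp: pairwise_def orthogonal_def norm_eq_1)
    qed auto
    then show ?thesis using fin that by (simp add: inner_diff_left)
  qed
  have orth: "(x - \<pi> x) \<bullet> y = 0" if "y \<in> S" for x y
    using that unfolding B(6)[symmetric]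
  proof (induction rule: span_induct_alt)
    case (step c b z)
    then show ?case using orthB[of b x] by (simp add: inner_add_right)
  qed auto
  moreover have "\<pi> x = x" if "x \<in> S" for x
  proof -
    have "x - \<pi> x \<in> S" using that inS assms subspace_diff by blast
    then show ?thesis using orth[of "x - \<pi> x" x] by simp
  qed
  ultimately show ?thesis using that lin inS by blast
qed

text \<open>An isometry of \<open>S\<close> onto \<open>T\<close> and one between the orthogonal
  complements, whose dimensions agree as well, glue to an isometry of the whole space by Pythagoras.
  It serves to rotate a tangent space onto a coordinate subspace without distorting lengths.\<close>

lemma orthogonal_transformation_subspace_exists:
  fixes S T :: "'a::euclidean_space set"
  assumes "subspace S" "subspace T" "dim S = dim T"
  obtains R where "orthogonal_transformation R" "R ` S = T"
proof -
  define C where "C U = {y. \<forall>x\<in>U. orthogonal x y}" for U :: "'a set"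
  have subC: "subspace (C U)" for U
    unfolding C_def by (rule subspace_orthogonal_to_vectors)
  have dimC: "dim (C U) + dim U = DIM('a)" if "subspace U" for U
    using dim_subspace_orthogonal_to_vectors[OF that subspace_UNIV] by (simp add: C_def)
  obtain f where f: "linear f" "f ` S = T" "\<And>x. x \<in> S \<Longrightarrow> norm (f x) = norm x"
    using isometries_subspaces[OF assms] by metis
  have "dim (C S) = dim (C T)"
    using dimC[OF assms(1)] dimC[OF assms(2)] assms(3) by simp
  then obtain g where g: "linear g" "g ` C S = C T" "\<And>x. x \<in> C S \<Longrightarrow> norm (g x) = norm x"
    using isometries_subspaces[OF subC subC] by metis
  obtain \<pi> where p: "linear \<pi>" "\<And>x. \<pi> x \<in> S" "\<And>x y. y \<in> S \<Longrightarrow> (x - \<pi> x) \<bullet> y = 0"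
      "\<And>x. x \<in> S \<Longrightarrow> \<pi> x = x"
    using subspace_projection_exists[OF assms(1)] by metis
  define R where "R x = f (\<pi> x) + g (x - \<pi> x)" for x
  have pC: "x - \<pi> x \<in> C S" for x
    using p(3) by (auto simp: C_def orthogonal_def inner_commute)
  have linR: "linear R"
    unfolding R_def using f(1) g(1) p(1)
    by (intro linearI) (simp_all add: linear_add linear_diff linear_scale algebra_simps)
  have "norm (R x) = norm x" for x
  proof -
    have "f (\<pi> x) \<in> T" "g (x - \<pi> x) \<in> C T" using f(2) g(2) p(2) pC by blast+
    then have "orthogonal (f (\<pi> x)) (g (x - \<pi> x))" by (auto simp: C_def)
    then have "(norm (R x))\<^sup>2 = (norm (f (\<pi> x)))\<^sup>2 + (norm (g (x - \<pi> x)))\<^sup>2"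
      unfolding R_def by (rule norm_add_Pythagorean)
    also have "\<dots> = (norm (\<pi> x))\<^sup>2 + (norm (x - \<pi> x))\<^sup>2"
      using f(3) g(3) p(2) pC by simp
    also have "\<dots> = (norm (\<pi> x + (x - \<pi> x)))\<^sup>2"
      using p(2,3) by (intro norm_add_Pythagorean[symmetric]) (simp add: orthogonal_def inner_commute)
    finally show ?thesis by simp
  qed
  then have "orthogonal_transformation R"
    using linR by (simp add: orthogonal_transformation)
  moreover have "R ` S = T"
  proof -
    have "R x = f x" if "x \<in> S" for x
      using p(4)[OF that] linear_0[OF g(1)] by (simp add: R_def)
    then show ?thesis using f(2) by force
  qed
  ultimately show ?thesis using that by blast
qed

section \<open>Charts with nearly isometric derivative\<close>

lemma dim_vanishing_components:
  "dim {y :: real^'n. \<forall>j\<in>J. y $ j = 0} = CARD('n) - card J"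
proof -
  have "{y :: real^'n. \<forall>j\<in>J. y $ j = 0} =
      {y. \<forall>i\<in>Basis. i \<notin> (\<lambda>j. axis j 1) ` (- J) \<longrightarrow> y \<bullet> i = 0}"
    by (auto simp: Basis_vec_def inner_axis axis_eq_axis)
  moreover have "card ((\<lambda>j. axis j 1 :: real^'n) ` (- J)) = card (- J)"
    by (intro card_image inj_onI) (simp add: axis_eq_axis)
  ultimately show ?thesis
    using dim_substandard[of "(\<lambda>j. axis j 1 :: real^'n) ` (- J)"]
    by (simp add: Basis_vec_def Compl_eq_Diff_UNIV card_Diff_subset image_subset_iff) blast
qed

lemma subspace_vanishing_components: "subspace {y :: real^'n. \<forall>j\<in>J. y $ j = 0}"
  by (auto simp: subspace_def)

text \<open>Smoothness gives continuity of each directional derivative separately. Summing the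
  deviations over the basis, each at most \<open>\<epsilon> / DIM('a)\<close>, yields closeness
  uniformly in the direction \<open>v\<close>.\<close>

lemma smooth_on_derivative_near:
  fixes f :: "'a::euclidean_space \<Rightarrow> 'b::real_normed_vector"
  assumes "open U" "smooth_on U f" "x0 \<in> U" "0 < \<epsilon>"
  obtains \<delta> where "0 < \<delta>" "ball x0 \<delta> \<subseteq> U"
    "\<And>x v. x \<in> ball x0 \<delta> \<Longrightarrow>
      norm (frechet_derivative f (at x) v - frechet_derivative f (at x0) v) \<le> \<epsilon> * norm v"
proof -
  let ?D = "\<lambda>x. frechet_derivative f (at x)"
  define e where "e = \<epsilon> / DIM('a)"
  have "e > 0" using assms by (simp add: e_def)
  have "\<forall>\<^sub>F x in at x0. \<forall>b\<in>Basis. norm (?D x b - ?D x0 b) < e"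
  proof (rule eventually_ball_finite)
    show "\<forall>b\<in>Basis. \<forall>\<^sub>F x in at x0. norm (?D x b - ?D x0 b) < e"
    proof
      fix b :: 'a
      have "continuous (at x0) (\<lambda>x. ?D x b)"
        using smooth_on_imp_continuous_on[OF smooth_on_frechet_derivative[OF assms(2)]] assms
          continuous_on_eq_continuous_at by blast
      then show "\<forall>\<^sub>F x in at x0. norm (?D x b - ?D x0 b) < e"
        unfolding isCont_def dist_norm[symmetric] using \<open>e > 0\<close> by (rule tendstoD)
    qed
  qed simp
  moreover have "\<forall>\<^sub>F x in at x0. x \<in> U"
    using assms(1,3) by (rule eventually_at_in_open')
  ultimately have "\<forall>\<^sub>F x in at x0. x \<in> U \<and> (\<forall>b\<in>Basis. norm (?D x b - ?D x0 b) < e)"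
    by eventually_elim blast
  then obtain \<delta> where d: "\<delta> > 0" "\<And>x. x \<noteq> x0 \<Longrightarrow> dist x x0 < \<delta> \<Longrightarrow>
      x \<in> U \<and> (\<forall>b\<in>Basis. norm (?D x b - ?D x0 b) < e)"
    unfolding eventually_at by auto
  have near: "x \<in> U" "\<And>b. b \<in> Basis \<Longrightarrow> norm (?D x b - ?D x0 b) \<le> e" if "x \<in> ball x0 \<delta>" for x
    using d(2)[of x] that assms(3) \<open>e > 0\<close> by (cases "x = x0"; auto simp: dist_commute less_imp_le)+
  show ?thesis
  proof (rule that[OF d(1)])
    show "ball x0 \<delta> \<subseteq> U" using near by blast
    fix x v assume x: "x \<in> ball x0 \<delta>"
    have lin: "linear (?D x)" "linear (?D x0)"
      using smooth_on_has_derivative[OF assms(2)] near(1)[OF x] assms(3) has_derivative_linear by blast+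
    have "?D x v - ?D x0 v = ?D x (\<Sum>b\<in>Basis. (v \<bullet> b) *\<^sub>R b) - ?D x0 (\<Sum>b\<in>Basis. (v \<bullet> b) *\<^sub>R b)"
      by (simp add: euclidean_representation)
    also have "\<dots> = (\<Sum>b\<in>Basis. (v \<bullet> b) *\<^sub>R (?D x b - ?D x0 b))"
      using lin by (simp add: linear_sum linear_scale scaleR_diff_right sum_subtractf)
    finally have "norm (?D x v - ?D x0 v) \<le> (\<Sum>b\<in>Basis. norm ((v \<bullet> b) *\<^sub>R (?D x b - ?D x0 b)))"
      by (simp only: norm_sum)
    also have "\<dots> \<le> (\<Sum>b\<in>(Basis::'a set). norm v * e)"
      using near(2)[OF x] by (intro sum_mono) (auto intro!: mult_mono simp: Basis_le_norm)
    also have "\<dots> = \<epsilon> * norm v" by (simp add: e_def)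
    finally show "norm (?D x v - ?D x0 v) \<le> \<epsilon> * norm v" .
  qed
qed

text \<open>Let \<phi> be a slice chart and \<open>b\<close> the derivative of its inverse at
  \<open>\<phi> x0\<close>. Then \<open>b (\<phi> x - \<phi> x0)\<close> has the identity as
  derivative at \<open>x0\<close> and maps \<open>S\<close> locally into the tangent space, the
  image of \<open>L\<close> under \<open>b\<close>. A rotation \<open>R\<close> takes that space to
  the one where the coordinates in \<open>J\<close> vanish, so \<open>J\<close> indexes the normal
  directions. The derivative at \<open>x0\<close> is now orthogonal, and by continuity
  \<open>\<Phi>\<close> and its inverse distort lengths by at most \<open>1 + \<eta>\<close> nearby.
  The bound for \<open>\<Phi>\<close> controls the gradient of \<rho>, that for
  \<open>\<Psi>\<close> the distance to \<open>S\<close>.\<close>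

lemma submanifold_straightening:
  fixes S :: "(real^'n) set" and J :: "'n set"
  assumes S: "smooth_submanifold m S" "x0 \<in> S" and J: "card J + m = CARD('n)" and \<eta>: "0 < \<eta>"
  obtains \<Phi> \<Psi> :: "real^'n \<Rightarrow> real^'n" and r \<delta> where "0 < r" "0 < \<delta>" "smooth_on (ball x0 r) \<Phi>" "\<Phi> x0 = 0"
    "\<Phi> ` ball x0 r \<subseteq> ball 0 \<delta>"
    "\<And>x v. x \<in> ball x0 r \<Longrightarrow> norm (frechet_derivative \<Phi> (at x) v) \<le> (1 + \<eta>) * norm v"
    "\<And>y y'. y \<in> ball 0 \<delta> \<Longrightarrow> y' \<in> ball 0 \<delta> \<Longrightarrow> norm (\<Psi> y - \<Psi> y') \<le> (1 + \<eta>) * norm (y - y')"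
    "\<And>x. x \<in> ball x0 r \<Longrightarrow> \<Psi> (\<Phi> x) = x"
    "\<And>y. y \<in> ball 0 \<delta> \<Longrightarrow> \<Phi> (\<Psi> y) = y"
    "\<And>x. x \<in> ball x0 r \<Longrightarrow> x \<in> S \<longleftrightarrow> (\<forall>j\<in>J. \<Phi> x $ j = 0)"
    "\<And>y. y \<in> ball 0 \<delta> \<Longrightarrow> (\<forall>j\<in>J. y $ j = 0) \<Longrightarrow> \<Psi> y \<in> S"
proof -
  obtain U V \<phi> \<psi> and L :: "(real^'n) set" where
    U: "open U" "x0 \<in> U" and V: "open V" and hom: "homeomorphism U V \<phi> \<psi>"
    and smooth: "smooth_on U \<phi>" "smooth_on V \<psi>" and L: "subspace L" "dim L = m"
    and img: "\<phi> ` (U \<inter> S) = V \<inter> L"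
    using S unfolding smooth_submanifold_def by metis
  have inv1: "\<psi> (\<phi> x) = x" "\<phi> x \<in> V" if "x \<in> U" for x
    using hom that by (auto simp: homeomorphism_def)
  have inv2: "\<phi> (\<psi> y) = y" "\<psi> y \<in> U" if "y \<in> V" for y
    using hom that by (auto simp: homeomorphism_def)
  have inS: "x \<in> S \<longleftrightarrow> \<phi> x \<in> L" if "x \<in> U" for x
  proof
    assume "\<phi> x \<in> L"
    then have "\<phi> x \<in> \<phi> ` (U \<inter> S)" using that inv1 img by blast
    then show "x \<in> S" using inv1 that by (metis IntE imageE)
  qed (use that img in blast)
  define z0 where "z0 = \<phi> x0"
  have z0: "z0 \<in> V" "\<psi> z0 = x0" "z0 \<in> L" using inv1 U inS S(2) by (auto simp: z0_def)
  define a where "a = frechet_derivative \<phi> (at x0)"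
  define b where "b = frechet_derivative \<psi> (at z0)"
  have da: "(\<phi> has_derivative a) (at x0)" and db: "(\<psi> has_derivative b) (at z0)"
    unfolding a_def b_def using smooth_on_has_derivative smooth U(2) z0(1) by blast+
  have lin: "linear a" "linear b" using da db has_derivative_linear by blast+
  have ba: "b (a v) = v" for v
  proof -
    have "((\<lambda>x. \<psi> (\<phi> x)) has_derivative (\<lambda>v. b (a v))) (at x0)"
      using has_derivative_compose[OF da] db unfolding z0_def by blast
    then have "((\<lambda>x. x) has_derivative (\<lambda>v. b (a v))) (at x0)"
      by (rule has_derivative_transform_within_open[OF _ U]) (use inv1 in auto)
    then have "(\<lambda>v. b (a v)) = (\<lambda>v. v)" using has_derivative_unique has_derivative_ident by blast
    then show ?thesis by metis
  qed
  have ab: "a (b v) = v" for v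
  proof -
    have "inj a" using ba by (metis injI)
    then have "surj a" using lin linear_injective_imp_surjective by blast
    then show ?thesis using ba by (metis surjD)
  qed
  define E where "E = {y :: real^'n. \<forall>j\<in>J. y $ j = 0}"
  have "inj b" using ab by (metis injI)
  have "dim (b ` L) = dim E"
    using dim_image_eq[OF lin(2), of L] \<open>inj b\<close> L dim_vanishing_components[of J] J
    by (simp add: E_def inj_on_subset)
  moreover have "subspace (b ` L)" using lin(2) L(1) by (rule linear_subspace_image)
  moreover have "subspace E" unfolding E_def by (rule subspace_vanishing_components)
  ultimately obtain R where R: "orthogonal_transformation R" "R ` (b ` L) = E"
    using orthogonal_transformation_subspace_exists[of "b ` L" E] by blast
  define Q where "Q = inv R"
  have linR: "linear R" using R(1) by (rule orthogonal_transformation_linear)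
  have oQ: "orthogonal_transformation Q" unfolding Q_def using R(1) by (rule orthogonal_transformation_inv)
  have linQ: "linear Q" using oQ by (rule orthogonal_transformation_linear)
  have RQ: "R (Q v) = v" and QR: "Q (R v) = v" for v
    unfolding Q_def using orthogonal_transformation_bij[OF R(1)]
    by (simp_all add: bij_is_surj surj_f_inv_f bij_is_inj inv_f_f)
  have nR: "norm (R v) = norm v" and nQ: "norm (Q v) = norm v" for v
    using orthogonal_transformation_norm[OF R(1)] orthogonal_transformation_norm[OF oQ] by simp_all
  define \<Phi> where "\<Phi> x = R (b (\<phi> x - z0))" for x
  define G where "G y = z0 + a (Q y)" for y
  define \<Psi> where "\<Psi> y = \<psi> (G y)" for y
  have blRb: "bounded_linear (\<lambda>v. R (b v))"
    using linear_compose[OF lin(2) linR] linear_conv_bounded_linear by (auto simp: o_def)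
  have blaQ: "bounded_linear (\<lambda>v. a (Q v))"
    using linear_compose[OF linQ lin(1)] linear_conv_bounded_linear by (auto simp: o_def)
  \<comment> \<open>\<open>CA\<close> and \<open>CQ\<close> bound the fixed linear maps, so that the
    tolerances \<open>\<eta> / CA\<close> and \<open>\<eta> / CQ\<close> below leave an error of at
    most \<open>\<eta> * norm v\<close> after composition with them.\<close>
  obtain CA where CA: "CA > 0" "\<And>v. norm (R (b v)) \<le> norm v * CA"
    using bounded_linear.pos_bounded[OF blRb] by auto
  obtain CQ where CQ: "CQ > 0" "\<And>v. norm (a (Q v)) \<le> norm v * CQ"
    using bounded_linear.pos_bounded[OF blaQ] by auto
  obtain d1 where d1: "0 < d1" "ball x0 d1 \<subseteq> U"
    "\<And>x v. x \<in> ball x0 d1 \<Longrightarrow> norm (frechet_derivative \<phi> (at x) v - a v) \<le> \<eta> / CA * norm v"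
    using smooth_on_derivative_near[OF U(1) smooth(1) U(2), of "\<eta> / CA"] \<eta> CA unfolding a_def by auto
  obtain d2 where d2: "0 < d2" "ball z0 d2 \<subseteq> V"
    "\<And>z v. z \<in> ball z0 d2 \<Longrightarrow> norm (frechet_derivative \<psi> (at z) v - b v) \<le> \<eta> / CQ * norm v"
    using smooth_on_derivative_near[OF V smooth(2) z0(1), of "\<eta> / CQ"] \<eta> CQ unfolding b_def by auto
  define \<delta> where "\<delta> = d2 / CQ"
  have \<delta>: "\<delta> > 0" using d2 CQ by (simp add: \<delta>_def)
  have Gball: "G y \<in> ball z0 d2" if "y \<in> ball 0 \<delta>" for y
  proof -
    have "norm (a (Q y)) \<le> norm y * CQ" by (rule CQ)
    also have "\<dots> < \<delta> * CQ" using that CQ by (simp add: mult_strict_right_mono)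
    finally show ?thesis using CQ by (simp add: G_def \<delta>_def dist_norm)
  qed
  have DPhi: "(\<Phi> has_derivative (\<lambda>v. R (b (frechet_derivative \<phi> (at x) v)))) (at x)" if "x \<in> U" for x
  proof -
    have "((\<lambda>x. \<phi> x - z0) has_derivative frechet_derivative \<phi> (at x)) (at x)"
      using has_derivative_diff[OF smooth_on_has_derivative[OF smooth(1) that] has_derivative_const[of z0]] by simp
    then show ?thesis unfolding \<Phi>_def by (rule bounded_linear.has_derivative[OF blRb])
  qed
  have DPsi: "(\<Psi> has_derivative (\<lambda>v. frechet_derivative \<psi> (at (G y)) (a (Q v)))) (at y)"
    if "y \<in> ball 0 \<delta>" for y
  proof -
    have "(G has_derivative (\<lambda>v. a (Q v))) (at y)"
      unfolding G_def using has_derivative_add[OF has_derivative_const[of z0]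
          bounded_linear_imp_has_derivative[OF blaQ]] by simp
    moreover have "(\<psi> has_derivative frechet_derivative \<psi> (at (G y))) (at (G y))"
      using Gball[OF that] d2(2) by (intro smooth_on_has_derivative[OF smooth(2)]) blast
    ultimately show ?thesis unfolding \<Psi>_def by (rule has_derivative_compose)
  qed
  have PhiPsi: "\<Phi> (\<Psi> y) = y" if "y \<in> ball 0 \<delta>" for y
    using inv2 Gball[OF that] d2(2) by (simp add: \<Phi>_def \<Psi>_def subset_iff) (simp add: G_def ba RQ)
  have PsiPhi: "\<Psi> (\<Phi> x) = x" if "x \<in> U" for x
    using inv1[OF that] by (simp add: \<Phi>_def \<Psi>_def G_def QR ab)
  have "continuous (at x0) \<Phi>" using DPhi[OF U(2)] by (rule has_derivative_continuous)
  moreover have Phi0: "\<Phi> x0 = 0"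
    using linear_0[OF lin(2)] linear_0[OF linR] by (simp add: \<Phi>_def z0_def)
  ultimately obtain d3 where d3: "d3 > 0" "\<And>x. dist x x0 < d3 \<Longrightarrow> norm (\<Phi> x) < \<delta>"
    unfolding continuous_at_eps_delta using \<delta> by (metis dist_0_norm dist_commute)
  define r where "r = min d1 d3"
  have rU: "ball x0 r \<subseteq> U" using d1(2) by (auto simp: r_def)
  show ?thesis
  proof (rule that[of r \<delta> \<Phi> \<Psi>])
    show "0 < r" using d1 d3 by (simp add: r_def)
    show "smooth_on (ball x0 r) \<Phi>"
    proof -
      have "smooth_on (ball x0 r) (\<lambda>x. \<phi> x + - z0)"
        by (intro smooth_on_add smooth_on_const smooth_on_subset[OF smooth(1) rU] open_ball)
      then show ?thesis
        unfolding \<Phi>_def using smooth_on_bounded_linear[OF open_ball blRb] by auto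
    qed
    show "\<Phi> ` ball x0 r \<subseteq> ball 0 \<delta>" using d3 by (auto simp: r_def dist_commute)
    show "norm (frechet_derivative \<Phi> (at x) v) \<le> (1 + \<eta>) * norm v" if "x \<in> ball x0 r" for x v
    proof -
      have "frechet_derivative \<Phi> (at x) v = R (b (frechet_derivative \<phi> (at x) v))"
        using frechet_derivative_at[OF DPhi] rU that by (metis subsetD)
      also have "\<dots> = R (b (frechet_derivative \<phi> (at x) v - a v)) + R v"
        using linR lin(2) ba by (simp add: linear_diff)
      also have "norm \<dots> \<le> norm (R (b (frechet_derivative \<phi> (at x) v - a v))) + norm (R v)"
        by (rule norm_triangle_ineq)
      also have "norm (R (b (frechet_derivative \<phi> (at x) v - a v))) \<le> \<eta> / CA * norm v * CA"
        using that by (intro order_trans[OF CA(2)] mult_right_mono d1(3)) (use CA in \<open>auto simp: r_def\<close>)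
      finally show ?thesis using CA nR by (simp add: algebra_simps)
    qed
    show "norm (\<Psi> y - \<Psi> y') \<le> (1 + \<eta>) * norm (y - y')" if "y \<in> ball 0 \<delta>" "y' \<in> ball 0 \<delta>" for y y'
    proof (rule differentiable_bound[OF convex_ball])
      show "(\<Psi> has_derivative (\<lambda>v. frechet_derivative \<psi> (at (G y)) (a (Q v)))) (at y within ball 0 \<delta>)"
        if "y \<in> ball 0 \<delta>" for y
        using DPsi[OF that] by (rule has_derivative_at_withinI)
      show "onorm (\<lambda>v. frechet_derivative \<psi> (at (G y)) (a (Q v))) \<le> 1 + \<eta>" if "y \<in> ball 0 \<delta>" for y
      proof (rule onorm_bound)
        fix v
        have "frechet_derivative \<psi> (at (G y)) (a (Q v)) =
            (frechet_derivative \<psi> (at (G y)) (a (Q v)) - b (a (Q v))) + Q v"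
          by (simp add: ba)
        also have "norm \<dots> \<le> norm (frechet_derivative \<psi> (at (G y)) (a (Q v)) - b (a (Q v))) + norm (Q v)"
          by (rule norm_triangle_ineq)
        also have "norm (frechet_derivative \<psi> (at (G y)) (a (Q v)) - b (a (Q v))) \<le> \<eta> / CQ * (norm v * CQ)"
          using \<eta> CQ by (intro order_trans[OF d2(3)[OF Gball[OF that]]] mult_left_mono) auto
        finally show "norm (frechet_derivative \<psi> (at (G y)) (a (Q v))) \<le> (1 + \<eta>) * norm v"
          using CQ nQ by (simp add: algebra_simps)
      qed (use \<eta> in auto)
    qed (use that in auto)
    show "x \<in> S \<longleftrightarrow> (\<forall>j\<in>J. \<Phi> x $ j = 0)" if "x \<in> ball x0 r" for x
    proof -
      have "\<Phi> x \<in> E \<longleftrightarrow> b (\<phi> x - z0) \<in> b ` L"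
        using R(2) QR unfolding \<Phi>_def by (metis image_iff)
      also have "\<dots> \<longleftrightarrow> \<phi> x - z0 \<in> L" using \<open>inj b\<close> by (rule inj_image_mem_iff)
      also have "\<dots> \<longleftrightarrow> \<phi> x \<in> L"
        using z0(3) L(1) subspace_add[of L "\<phi> x - z0" z0] subspace_diff[of L "\<phi> x" z0] by auto
      finally show ?thesis using inS rU that by (auto simp: E_def)
    qed
    show "\<Psi> y \<in> S" if y: "y \<in> ball 0 \<delta>" and "\<forall>j\<in>J. y $ j = 0" for y
    proof -
      have "y \<in> E" using that by (simp add: E_def)
      then obtain l where "l \<in> L" "y = R (b l)" using R(2) by blast
      then have "G y \<in> L" using z0(3) L(1) by (simp add: G_def QR ab subspace_add)
      moreover have "G y \<in> V" using Gball[OF y] d2(2) by blast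
      ultimately show ?thesis using inS[of "\<Psi> y"] inv2 by (simp add: \<Psi>_def)
    qed
  qed (use \<delta> Phi0 PhiPsi PsiPhi rU in auto)
qed

section \<open>Volume of thin neighbourhoods by covering and packing\<close>

lemma L2_set_components_le_norm: "L2_set (\<lambda>j. y $ j) J \<le> norm (y :: real^'n)"
  unfolding norm_vec_def L2_set_def by (auto intro!: real_sqrt_le_mono sum_mono2)

lemma emeasure_ball_power:
  fixes a :: "real^'n"
  assumes "r \<ge> 0"
  shows "emeasure lborel (ball a r) = ennreal (unit_ball_vol CARD('n) * r ^ CARD('n))"
    and "emeasure lborel (cball a r) = ennreal (unit_ball_vol CARD('n) * r ^ CARD('n))"
  using emeasure_ball[OF assms, of a] emeasure_cball[OF assms, of a] assms by simp_all

text \<open>Rounding the tangential coordinates to a grid of mesh \<open>t\<close> cuts the slab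
  into at most \<open>n ^ card (- J)\<close> cells, with \<open>n\<close> of order
  \<open>\<delta> / t\<close>. In a cell every coordinate of \<open>\<Phi>\<close> varies by at most
  \<open>2 * t\<close>, so by the Lipschitz bound the cell lies in a ball of radius
  \<open>4 * N * t\<close>. The product of number and volume is of order \<open>t ^ card J\<close>,
  without any change of variables.\<close>

lemma emeasure_slab_upper:
  fixes \<Phi> :: "real^'n \<Rightarrow> real^'n" and J :: "'n set"
  assumes \<delta>: "0 < \<delta>" and \<Phi>: "\<And>x. x \<in> E \<Longrightarrow> \<Phi> x \<in> ball 0 \<delta>"
    and lip: "\<And>x x'. x \<in> E \<Longrightarrow> x' \<in> E \<Longrightarrow> norm (x - x') \<le> 2 * norm (\<Phi> x - \<Phi> x')"
  obtains C where "0 < C" "\<And>t. 0 < t \<Longrightarrow> t \<le> \<delta> \<Longrightarrow>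
    emeasure lborel {x\<in>E. L2_set (\<lambda>j. \<Phi> x $ j) J \<le> t} \<le> ennreal (C * t ^ card J)"
proof
  let ?N = "CARD('n)"
  let ?m = "card (- J)"
  let ?V = "unit_ball_vol ?N"
  let ?C = "(3 * \<delta>) ^ ?m * (?V * (4 * real ?N) ^ ?N)"
  show "0 < ?C" using \<delta> by (auto intro!: mult_pos_pos)
  fix t :: real assume t: "0 < t" "t \<le> \<delta>"
  define n where "n = nat \<lfloor>2 * \<delta> / t\<rfloor> + 1"
  define index where "index x = (\<lambda>i\<in>-J. nat \<lfloor>(\<Phi> x $ i + \<delta>) / t\<rfloor>)" for x
  define cell where "cell z = {x\<in>E. L2_set (\<lambda>j. \<Phi> x $ j) J \<le> t \<and> index x = z}" for z
  \<comment> \<open>Each nonempty cell is replaced by a ball around one of its points, whose volume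
    is known.\<close>
  define W where "W z = (if cell z = {} then {} else cball (SOME x. x \<in> cell z) (4 * ?N * t))" for z
  let ?P = "PiE (- J) (\<lambda>_. {..<n})"
  have comp: "\<bar>\<Phi> x $ i\<bar> < \<delta>" if "x \<in> E" for x i
    using \<Phi>[OF that] component_le_norm_cart[of "\<Phi> x" i] by simp
  have cellW: "cell z \<subseteq> W z" for z
  proof
    fix x assume x: "x \<in> cell z"
    define x' where "x' = (SOME x. x \<in> cell z)"
    have x': "x' \<in> cell z" unfolding x'_def by (rule someI) (rule x)
    have "\<bar>\<Phi> x $ i - \<Phi> x' $ i\<bar> \<le> 2 * t" for i
    proof (cases "i \<in> J")
      case True
      then have "\<bar>\<Phi> u $ i\<bar> \<le> t" if "u \<in> cell z" for u
        using member_le_L2_set[of J i "\<lambda>j. \<bar>\<Phi> u $ j\<bar>"] that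
        by (simp add: cell_def L2_set_def)
      from this[OF x] this[OF x'] show ?thesis by linarith
    next
      case False
      have pos: "(\<Phi> u $ i + \<delta>) / t \<ge> 0" if "u \<in> cell z" for u
        using comp[of u i] that t by (auto simp: cell_def)
      have "index x i = index x' i" using x x' by (simp add: cell_def)
      then have "\<lfloor>(\<Phi> x $ i + \<delta>) / t\<rfloor> = \<lfloor>(\<Phi> x' $ i + \<delta>) / t\<rfloor>"
        using False pos[OF x] pos[OF x'] by (simp add: index_def eq_nat_nat_iff)
      then have "\<bar>(\<Phi> x $ i + \<delta>) / t - (\<Phi> x' $ i + \<delta>) / t\<bar> \<le> 1" by linarith
      also have "(\<Phi> x $ i + \<delta>) / t - (\<Phi> x' $ i + \<delta>) / t = (\<Phi> x $ i - \<Phi> x' $ i) / t"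
        by (simp add: diff_divide_distrib add_divide_distrib)
      finally show ?thesis using t by (simp add: abs_divide divide_le_eq)
    qed
    then have "(\<Sum>i\<in>UNIV. \<bar>(\<Phi> x - \<Phi> x') $ i\<bar>) \<le> (\<Sum>i\<in>(UNIV :: 'n set). 2 * t)"
      by (intro sum_mono) simp
    then have "norm (\<Phi> x - \<Phi> x') \<le> ?N * (2 * t)"
      using norm_le_l1_cart[of "\<Phi> x - \<Phi> x'"] by simp
    then have "norm (x - x') \<le> 4 * ?N * t"
      using lip[of x x'] x x' by (auto simp: cell_def)
    then show "x \<in> W z" using x by (auto simp: W_def x'_def[symmetric] dist_norm norm_minus_commute)
  qed
  have Wm: "W z \<in> sets lborel" and We: "emeasure lborel (W z) \<le> ennreal (?V * (4 * ?N * t) ^ ?N)" for z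
    using t by (auto simp: W_def emeasure_ball_power)
  have "index x \<in> ?P" if "x \<in> E" for x
  proof -
    have "nat \<lfloor>(\<Phi> x $ i + \<delta>) / t\<rfloor> < n" for i
    proof -
      have "(\<Phi> x $ i + \<delta>) / t \<le> 2 * \<delta> / t" using comp[OF that, of i] t by (intro divide_right_mono) auto
      then have "nat \<lfloor>(\<Phi> x $ i + \<delta>) / t\<rfloor> \<le> nat \<lfloor>2 * \<delta> / t\<rfloor>" by (intro nat_mono floor_mono)
      then show ?thesis by (simp add: n_def)
    qed
    then show ?thesis by (auto simp: index_def)
  qed
  then have "{x\<in>E. L2_set (\<lambda>j. \<Phi> x $ j) J \<le> t} \<subseteq> (\<Union>z\<in>?P. W z)"
    using cellW by (fastforce simp: cell_def)
  then have "emeasure lborel {x\<in>E. L2_set (\<lambda>j. \<Phi> x $ j) J \<le> t} \<le> emeasure lborel (\<Union>z\<in>?P. W z)"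
    using Wm by (intro emeasure_mono sets.finite_UN) (auto intro!: finite_PiE)
  also have "\<dots> \<le> (\<Sum>z\<in>?P. emeasure lborel (W z))"
    using Wm by (intro emeasure_subadditive_finite) (auto intro!: finite_PiE)
  also have "\<dots> \<le> (\<Sum>z\<in>?P. ennreal (?V * (4 * ?N * t) ^ ?N))"
    by (intro sum_mono We)
  also have "\<dots> = of_nat (n ^ ?m) * ennreal (?V * (4 * ?N * t) ^ ?N)"
    by (simp add: card_PiE)
  also have "\<dots> = ennreal (real n ^ ?m * (?V * (4 * ?N * t) ^ ?N))"
    using t by (simp add: ennreal_mult ennreal_of_nat_eq_real_of_nat)
  also have "\<dots> \<le> ennreal ((3 * \<delta> / t) ^ ?m * (?V * (4 * ?N * t) ^ ?N))"
  proof -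
    \<comment> \<open>The rounding term 1 is at most \<open>\<delta> / t\<close> because
      \<open>t \<le> \<delta>\<close>.\<close>
    have "real n \<le> 2 * \<delta> / t + 1" using t by (simp add: n_def)
    also have "\<dots> \<le> 3 * \<delta> / t" using t by (simp add: field_simps)
    finally show ?thesis using t by (intro ennreal_leI mult_right_mono power_mono) auto
  qed
  also have "(3 * \<delta> / t) ^ ?m * (?V * (4 * ?N * t) ^ ?N) = ?C * t ^ card J"
  proof -
    have "?N = ?m + card J"
      using card_Un_disjoint[of "- J" J] by (simp add: Compl_partition2)
    then have "t ^ ?N = t ^ ?m * t ^ card J" by (simp add: power_add)
    then show ?thesis using t by (simp add: power_divide power_mult_distrib field_simps)
  qed
  finally show "emeasure lborel {x\<in>E. L2_set (\<lambda>j. \<Phi> x $ j) J \<le> t} \<le> ennreal (?C * t ^ card J)" .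
qed

text \<open>Grid points of spacing at least \<open>2 * t\<close> in the tangential plane are pulled
  back by \<open>\<Psi>\<close>. Since \<open>\<Phi>\<close> is 2-Lipschitz, their preimages are at
  least \<open>t\<close> apart, and the balls of radius \<open>t / 2\<close> around them are
  disjoint and stay in the slab. There are at least of order \<open>t\<close> to the power
  \<open>- card (- J)\<close> such balls.\<close>

lemma emeasure_slab_lower:
  fixes \<Phi> \<Psi> :: "real^'n \<Rightarrow> real^'n" and J :: "'n set"
  assumes pos: "0 < \<rho>" "0 < s"
    and lip: "\<And>x x'. x \<in> ball x0 s \<Longrightarrow> x' \<in> ball x0 s \<Longrightarrow> norm (\<Phi> x - \<Phi> x') \<le> 2 * norm (x - x')"
    and \<Psi>: "\<And>y. y \<in> ball 0 \<rho> \<Longrightarrow> \<Psi> y \<in> ball x0 (s / 2)"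
    and inv: "\<And>y. y \<in> ball 0 \<rho> \<Longrightarrow> \<Phi> (\<Psi> y) = y"
    and meas: "\<And>t. {x \<in> ball x0 s. L2_set (\<lambda>j. \<Phi> x $ j) J \<le> t} \<in> sets lborel"
  obtains c t0 where "0 < c" "0 < t0" "\<And>t. 0 < t \<Longrightarrow> t \<le> t0 \<Longrightarrow>
    ennreal (c * t ^ card J) \<le> emeasure lborel {x \<in> ball x0 s. L2_set (\<lambda>j. \<Phi> x $ j) J \<le> t}"
proof
  let ?N = "CARD('n)"
  let ?m = "card (- J)"
  let ?V = "unit_ball_vol ?N"
  \<comment> \<open>A vector with all coordinates at most \<open>c\<close> in absolute value has
    norm at most \<open>N * c\<close>, which is below \<rho>.\<close>
  define c where "c = \<rho> / (2 * ?N)"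
  have c: "0 < c" using pos by (simp add: c_def)
  let ?C = "(c / 4) ^ ?m * (?V * (1/2) ^ ?N)"
  show "0 < ?C" "0 < min (c / 2) s" using c pos by (auto intro!: mult_pos_pos)
  fix t assume t: "0 < t" "t \<le> min (c / 2) s"
  \<comment> \<open>At most \<open>c / (2 * t)\<close> points per direction make the spacing
    \<open>c / n\<close> at least \<open>2 * t\<close>; since \<open>t \<le> c / 2\<close>, rounding
    down loses at most a factor 2.\<close>
  define n where "n = nat \<lfloor>c / (2 * t)\<rfloor>"
  have ct: "1 \<le> c / (2 * t)" using t by (simp add: field_simps)
  have n: "real n \<le> c / (2 * t)" "c / (4 * t) \<le> real n" "1 \<le> real n"
  proof -
    show "real n \<le> c / (2 * t)" using ct by (simp add: n_def)
    have "real n > c / (2 * t) - 1" using ct unfolding n_def by linarith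
    moreover have "1 \<le> \<lfloor>c / (2 * t)\<rfloor>" using ct by simp
    then have n1: "1 \<le> real n" unfolding n_def by linarith
    moreover have "c / (2 * t) = 2 * (c / (4 * t))" by simp
    ultimately show "c / (4 * t) \<le> real n" "1 \<le> real n" by linarith+
  qed
  let ?P = "PiE (- J) (\<lambda>_. {..<n})"
  define y where "y z = (\<chi> i. if i \<in> J then 0 else c * real (z i) / n)" for z :: "'n \<Rightarrow> nat"
  have yball: "y z \<in> ball 0 \<rho>" if "z \<in> ?P" for z
  proof -
    have "\<bar>y z $ i\<bar> \<le> c" for i
    proof (cases "i \<in> J")
      case False
      then have "z i < n" using that by (auto simp: PiE_iff)
      then have "real (z i) / n \<le> 1" by simp
      then show ?thesis using False c mult_left_mono[of "real (z i) / n" 1 c]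
        by (simp add: y_def)
    qed (use c in \<open>simp add: y_def\<close>)
    then have "(\<Sum>i\<in>UNIV. \<bar>y z $ i\<bar>) \<le> (\<Sum>i\<in>(UNIV :: 'n set). c)" by (intro sum_mono)
    then have "norm (y z) \<le> ?N * c" using norm_le_l1_cart[of "y z"] by simp
    also have "\<dots> < \<rho>" using pos by (simp add: c_def)
    finally show ?thesis by simp
  qed
  define W where "W z = ball (\<Psi> (y z)) (t / 2)" for z
  have sub: "W z \<subseteq> {x \<in> ball x0 s. L2_set (\<lambda>j. \<Phi> x $ j) J \<le> t}" if "z \<in> ?P" for z
  proof
    fix x assume x: "x \<in> W z"
    have P: "\<Psi> (y z) \<in> ball x0 (s / 2)" by (rule \<Psi>[OF yball[OF that]])
    have "dist x0 x \<le> dist x0 (\<Psi> (y z)) + dist (\<Psi> (y z)) x" by (rule dist_triangle)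
    then have xs: "x \<in> ball x0 s" using P x t by (simp add: W_def)
    have "L2_set (\<lambda>j. \<Phi> x $ j) J = L2_set (\<lambda>j. (\<Phi> x - y z) $ j) J"
      by (intro L2_set_cong) (auto simp: y_def)
    also have "\<dots> \<le> norm (\<Phi> x - y z)" by (rule L2_set_components_le_norm)
    also have "\<dots> = norm (\<Phi> x - \<Phi> (\<Psi> (y z)))" using inv yball[OF that] by simp
    also have "\<dots> \<le> 2 * norm (x - \<Psi> (y z))" using P pos xs by (intro lip) auto
    also have "\<dots> \<le> t" using x by (simp add: W_def dist_norm norm_minus_commute)
    finally show "x \<in> {x \<in> ball x0 s. L2_set (\<lambda>j. \<Phi> x $ j) J \<le> t}" using xs by simp
  qed
  have disj: "disjoint_family_on W ?P"
    unfolding disjoint_family_on_def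
  proof (intro ballI impI)
    fix z z' assume z: "z \<in> ?P" "z' \<in> ?P" "z \<noteq> z'"
    have "\<not> (\<forall>i\<in>- J. z i = z' i)"
      using PiE_ext[OF z(1,2)] z(3) by blast
    then obtain i where i: "i \<notin> J" "z i \<noteq> z' i" by blast
    then have "1 \<le> \<bar>real (z i) - real (z' i)\<bar>" by linarith
    then have "c / n * 1 \<le> c / n * \<bar>real (z i) - real (z' i)\<bar>"
      using c by (intro mult_left_mono) auto
    also have "\<dots> = \<bar>c / n * (real (z i) - real (z' i))\<bar>" using c by (simp add: abs_mult)
    also have "\<dots> = \<bar>(y z - y z') $ i\<bar>"
      using i(1) by (simp add: y_def right_diff_distrib)
    also have "\<dots> \<le> norm (y z - y z')" by (rule component_le_norm_cart)
    also have "\<dots> = norm (\<Phi> (\<Psi> (y z)) - \<Phi> (\<Psi> (y z')))" using inv yball z by simp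
    also have "\<dots> \<le> 2 * norm (\<Psi> (y z) - \<Psi> (y z'))"
      using \<Psi>[OF yball[OF z(1)]] \<Psi>[OF yball[OF z(2)]] pos by (intro lip) auto
    finally have "c / n \<le> 2 * dist (\<Psi> (y z)) (\<Psi> (y z'))" by (simp add: dist_norm)
    moreover have "2 * t \<le> c / n" using n(1,3) t by (simp add: field_simps)
    ultimately show "W z \<inter> W z' = {}" unfolding W_def by (intro disjoint_ballI) simp
  qed
  have "?C * t ^ card J = (c / (4 * t)) ^ ?m * (?V * (t / 2) ^ ?N)"
  proof -
    have "?N = ?m + card J"
      using card_Un_disjoint[of "- J" J] by (simp add: Compl_partition2)
    then have "t ^ ?N = t ^ ?m * t ^ card J" by (simp add: power_add)
    then show ?thesis using t by (simp add: power_divide power_mult_distrib field_simps)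
  qed
  also have "\<dots> \<le> real n ^ ?m * (?V * (t / 2) ^ ?N)"
    using n t c by (intro mult_right_mono power_mono) auto
  finally have "ennreal (?C * t ^ card J) \<le> ennreal (real n ^ ?m * (?V * (t / 2) ^ ?N))"
    by (rule ennreal_leI)
  also have "\<dots> = (\<Sum>z\<in>?P. emeasure lborel (W z))"
    using t by (simp add: W_def emeasure_ball_power card_PiE ennreal_mult ennreal_of_nat_eq_real_of_nat)
  also have "\<dots> = emeasure lborel (\<Union>z\<in>?P. W z)"
  proof (rule sum_emeasure[OF _ disj])
    show "W ` ?P \<subseteq> sets lborel" by (auto simp: W_def)
  qed (simp add: finite_PiE)
  also have "\<dots> \<le> emeasure lborel {x \<in> ball x0 s. L2_set (\<lambda>j. \<Phi> x $ j) J \<le> t}"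
    using sub meas by (intro emeasure_mono) auto
  finally show "ennreal (?C * t ^ card J) \<le> emeasure lborel {x \<in> ball x0 s. L2_set (\<lambda>j. \<Phi> x $ j) J \<le> t}" .
qed

text \<open>From here on only the length \<rho> of the normal part of the chart matters. The upper
  volume bound is on the full ball, which contains the support of the cutoff; the lower one is on
  the half ball, where the cutoff will be bounded below. The radius may be shrunk below
  \<open>R\<close> to stay inside a given open set.\<close>

lemma submanifold_chart_estimates:
  fixes S :: "(real^'n) set" and J :: "'n set"
  assumes S: "smooth_submanifold m S" "x0 \<in> S" and J: "card J + m = CARD('n)"
    and \<eta>: "0 < \<eta>" "\<eta> \<le> 1" and R: "0 < R"
  obtains \<Phi> :: "real^'n \<Rightarrow> real^'n" and r c C t0 where "0 < r" "r \<le> R" "smooth_on (ball x0 r) \<Phi>"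
    "\<And>x v. x \<in> ball x0 r \<Longrightarrow> norm (frechet_derivative \<Phi> (at x) v) \<le> (1 + \<eta>) * norm v"
    "\<And>x. x \<in> ball x0 r \<Longrightarrow> x \<in> S \<longleftrightarrow> L2_set (\<lambda>j. \<Phi> x $ j) J = 0"
    "\<And>x. x \<in> ball x0 r \<Longrightarrow> infdist x S \<le> (1 + \<eta>) * L2_set (\<lambda>j. \<Phi> x $ j) J"
    "0 < c" "0 < C" "0 < t0"
    "\<And>t. 0 < t \<Longrightarrow> t \<le> t0 \<Longrightarrow>
      emeasure lborel {x \<in> ball x0 r. L2_set (\<lambda>j. \<Phi> x $ j) J \<le> t} \<le> ennreal (C * t ^ card J)"
    "\<And>t. 0 < t \<Longrightarrow> t \<le> t0 \<Longrightarrow>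
      ennreal (c * t ^ card J) \<le> emeasure lborel {x \<in> ball x0 (r / 2). L2_set (\<lambda>j. \<Phi> x $ j) J \<le> t}"
proof -
  obtain \<Phi> \<Psi> :: "real^'n \<Rightarrow> real^'n" and r' \<delta> where r': "0 < r'" and \<delta>: "0 < \<delta>" and smooth': "smooth_on (ball x0 r') \<Phi>" and Phi0: "\<Phi> x0 = 0"
    and img': "\<Phi> ` ball x0 r' \<subseteq> ball 0 \<delta>"
    and D': "\<And>x v. x \<in> ball x0 r' \<Longrightarrow> norm (frechet_derivative \<Phi> (at x) v) \<le> (1 + \<eta>) * norm v"
    and lipPsi: "\<And>y y'. y \<in> ball 0 \<delta> \<Longrightarrow> y' \<in> ball 0 \<delta> \<Longrightarrow> norm (\<Psi> y - \<Psi> y') \<le> (1 + \<eta>) * norm (y - y')"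
    and PsiPhi': "\<And>x. x \<in> ball x0 r' \<Longrightarrow> \<Psi> (\<Phi> x) = x"
    and PhiPsi: "\<And>y. y \<in> ball 0 \<delta> \<Longrightarrow> \<Phi> (\<Psi> y) = y"
    and inS': "\<And>x. x \<in> ball x0 r' \<Longrightarrow> x \<in> S \<longleftrightarrow> (\<forall>j\<in>J. \<Phi> x $ j = 0)"
    and PsiS: "\<And>y. y \<in> ball 0 \<delta> \<Longrightarrow> (\<forall>j\<in>J. y $ j = 0) \<Longrightarrow> \<Psi> y \<in> S"
    by (rule submanifold_straightening[OF S J \<eta>(1)]) (rule that)
  define r where "r = min r' R"
  have r: "0 < r" "r \<le> R" using r' R by (auto simp: r_def)
  have rr': "ball x0 r \<subseteq> ball x0 r'" by (auto simp: r_def)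
  note smooth = smooth_on_subset[OF smooth' rr']
  have img: "\<Phi> x \<in> ball 0 \<delta>" if "x \<in> ball x0 r" for x using img' rr' that by blast
  note D = D'[OF subsetD[OF rr']] and PsiPhi = PsiPhi'[OF subsetD[OF rr']] and inS = inS'[OF subsetD[OF rr']]
  let ?\<rho> = "\<lambda>x. L2_set (\<lambda>j. \<Phi> x $ j) J"
  have lipPhi: "norm (\<Phi> x - \<Phi> x') \<le> 2 * norm (x - x')" if "x \<in> ball x0 r" "x' \<in> ball x0 r" for x x'
  proof (rule differentiable_bound[OF convex_ball])
    show "(\<Phi> has_derivative frechet_derivative \<Phi> (at x)) (at x within ball x0 r)" if "x \<in> ball x0 r" for x
      using smooth_on_has_derivative[OF smooth that] by (rule has_derivative_at_withinI)
    show "onorm (frechet_derivative \<Phi> (at x)) \<le> 2" if "x \<in> ball x0 r" for x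
    proof (rule onorm_bound)
      show "norm (frechet_derivative \<Phi> (at x) v) \<le> 2 * norm v" for v
        using D[OF that, of v] mult_right_mono[of "1 + \<eta>" 2 "norm v"] \<eta> by simp
    qed simp
  qed (use that in auto)
  have lipPsi2: "norm (\<Psi> y - \<Psi> y') \<le> 2 * norm (y - y')" if "y \<in> ball 0 \<delta>" "y' \<in> ball 0 \<delta>" for y y'
    using lipPsi[OF that] mult_right_mono[of "1 + \<eta>" 2 "norm (y - y')"] \<eta> by simp
  have infd: "infdist x S \<le> (1 + \<eta>) * ?\<rho> x" if x: "x \<in> ball x0 r" for x
  proof -
    \<comment> \<open>Deleting the normal coordinates gives a point of \<open>S\<close> under
      \<open>\<Psi>\<close>, and the deleted part has length exactly \<rho>.\<close>
    define y where "y = (\<chi> i. if i \<in> J then 0 else \<Phi> x $ i)"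
    have "norm y \<le> norm (\<Phi> x)" by (intro norm_le_componentwise_cart) (auto simp: y_def)
    then have y: "y \<in> ball 0 \<delta>" using img[OF x] by simp
    have "\<Psi> y \<in> S" by (rule PsiS[OF y]) (simp add: y_def)
    then have "infdist x S \<le> dist x (\<Psi> y)" by (rule infdist_le)
    also have "\<dots> = norm (\<Psi> (\<Phi> x) - \<Psi> y)" using PsiPhi[OF x] by (simp add: dist_norm)
    also have "\<dots> \<le> (1 + \<eta>) * norm (\<Phi> x - y)" by (rule lipPsi[OF img[OF x] y])
    also have "norm (\<Phi> x - y) = ?\<rho> x"
      unfolding norm_vec_def L2_set_def
      by (intro arg_cong[where f=sqrt] sum.mono_neutral_cong_right) (auto simp: y_def)
    finally show ?thesis .
  qed
  obtain C where C: "0 < C" "\<And>t. 0 < t \<Longrightarrow> t \<le> \<delta> \<Longrightarrow>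
      emeasure lborel {x\<in>ball x0 r. ?\<rho> x \<le> t} \<le> ennreal (C * t ^ card J)"
  proof (rule emeasure_slab_upper[where J=J and E="ball x0 r" and \<Phi>=\<Phi>, OF \<delta> img])
    show "norm (x - x') \<le> 2 * norm (\<Phi> x - \<Phi> x')" if "x \<in> ball x0 r" "x' \<in> ball x0 r" for x x'
      using lipPsi2[OF img[OF that(1)] img[OF that(2)]] PsiPhi that by simp
  qed auto
  have cont: "continuous_on (ball x0 s) ?\<rho>" if "s \<le> r" for s
    unfolding L2_set_def using smooth_on_imp_continuous_on[OF smooth] that
    by (intro continuous_intros) (auto intro: continuous_on_subset)
  \<comment> \<open>With the factor 2 of \<open>\<Psi>\<close>, the bound \<open>r / 8\<close> keeps
    images within \<open>r / 4\<close> of \<open>x0\<close>, which is half of the radius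
    \<open>r / 2\<close> used below.\<close>
  define \<rho>0 where "\<rho>0 = min \<delta> (r / 8)"
  have \<rho>0: "0 < \<rho>0" using \<delta> r by (simp add: \<rho>0_def)
  obtain c t1 where c: "0 < c" "0 < t1" "\<And>t. 0 < t \<Longrightarrow> t \<le> t1 \<Longrightarrow>
      ennreal (c * t ^ card J) \<le> emeasure lborel {x \<in> ball x0 (r / 2). ?\<rho> x \<le> t}"
  proof (rule emeasure_slab_lower[where s="r / 2" and ?x0.0=x0 and \<Phi>=\<Phi> and \<Psi>=\<Psi> and J=J, OF \<rho>0])
    show "\<Psi> y \<in> ball x0 (r / 2 / 2)" if "y \<in> ball 0 \<rho>0" for y
    proof -
      have y: "y \<in> ball 0 \<delta>" "norm y < r / 8" using that by (auto simp: \<rho>0_def)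
      have "norm (\<Psi> y - \<Psi> 0) \<le> 2 * norm (y - 0)" using y \<delta> by (intro lipPsi2) auto
      moreover have "\<Psi> 0 = x0" using PsiPhi[of x0] Phi0 r by simp
      ultimately show ?thesis using y by (simp add: dist_norm norm_minus_commute)
    qed
    show "\<Phi> (\<Psi> y) = y" if "y \<in> ball 0 \<rho>0" for y using that PhiPsi by (simp add: \<rho>0_def)
    show "{x \<in> ball x0 (r / 2). ?\<rho> x \<le> t} \<in> sets lborel" for t
    proof -
      have "closedin (top_of_set (ball x0 (r / 2))) (ball x0 (r / 2) \<inter> ?\<rho> -` {..t})"
        by (rule continuous_closedin_preimage[OF cont]) (use r in auto)
      then obtain T where "closed T" "ball x0 (r / 2) \<inter> ?\<rho> -` {..t} = T \<inter> ball x0 (r / 2)"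
        by (auto simp: closedin_closed)
      moreover have "{x \<in> ball x0 (r / 2). ?\<rho> x \<le> t} = ball x0 (r / 2) \<inter> ?\<rho> -` {..t}" by auto
      ultimately show ?thesis by simp
    qed
  qed (use r lipPhi in auto)
  show ?thesis
  proof (rule that[OF r smooth D _ infd c(1) C(1), of "min \<delta> t1"])
    show "x \<in> S \<longleftrightarrow> ?\<rho> x = 0" if "x \<in> ball x0 r" for x
      using inS[OF that] by (simp add: L2_set_eq_0_iff)
  qed (use c C \<delta> in auto)
qed

subsection \<open>Logarithmic shells\<close>

lemma sum_inverse_le_ln:
  fixes a b :: nat
  assumes "1 \<le> a" "a \<le> b"
  shows "(\<Sum>j=a..b. 1 / real j) \<le> 1 / real a + ln (real b / real a)"
  using assms(2)
proof (induction b rule: dec_induct)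
  case base
  then show ?case using assms by simp
next
  case (step b)
  have b: "b \<ge> 1" using step assms by simp
  have "ln (real b / real (Suc b)) \<le> real b / real (Suc b) - 1"
    by (rule ln_le_minus_one) (use b in auto)
  then have "1 / real (Suc b) \<le> - ln (real b / real (Suc b))" using b by (simp add: field_simps)
  also have "\<dots> = ln (real (Suc b) / real a) - ln (real b / real a)"
    using b assms by (simp add: ln_div)
  finally show ?case using step by simp
qed

lemma ln_le_sum_inverse:
  "ln ((real b + 1) / (real a + 1)) \<le> (\<Sum>j\<in>{a..<b}. 1 / (real j + 1))"
proof (cases "a \<le> b")
  case True
  then show ?thesis
  proof (induction b rule: dec_induct)
    case (step b)
    have "ln ((real b + 2) / (real b + 1)) \<le> (real b + 2) / (real b + 1) - 1"
      by (rule ln_le_minus_one) (auto intro!: divide_pos_pos)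
    also have "\<dots> = 1 / (real b + 1)" by (simp add: field_simps)
    finally have "ln (2 + real b) - ln (real b + 1) \<le> 1 / (real b + 1)"
      by (simp add: ln_div add.commute)
    then show ?case using step by (simp add: ln_div add.commute[of _ 2])
  qed auto
next
  case False
  then show ?thesis by simp
qed

text \<open>Where \<open>- ln \<rho>\<close> has integer part \<open>j\<close> the integrand is at
  most \<open>exp ((j + 1) * k) / j\<close>, and the sublevel set containing this shell has measure
  at most \<open>C * exp (- j * k)\<close>. Each shell thus contributes at most
  \<open>C * exp k / j\<close>, and the harmonic sum between \<open>exp m\<close> and
  \<open>exp (2 * m)\<close> is of order \<open>m\<close>.\<close>

lemma shell_integral_upper:
  fixes \<rho> :: "'a \<Rightarrow> real"
  assumes pos: "0 < C" "0 < t0"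
    and meas: "\<And>t. {x\<in>B. \<rho> x \<le> t} \<in> sets \<mu>"
    and bound: "\<And>t. 0 < t \<Longrightarrow> t \<le> t0 \<Longrightarrow> emeasure \<mu> {x\<in>B. \<rho> x \<le> t} \<le> ennreal (C * t ^ k)"
  obtains C' m0 where "0 < C'" "\<And>m. m0 \<le> m \<Longrightarrow>
    (\<integral>\<^sup>+x. ennreal (1 / (- ln (\<rho> x) * \<rho> x ^ k)) *
       indicator {x\<in>B. 0 < \<rho> x \<and> exp m \<le> - ln (\<rho> x) \<and> - ln (\<rho> x) \<le> exp (2 * m)} x \<partial>\<mu>) \<le> ennreal (C' * m)"
proof
  show "0 < C * exp (real k) * 3" using pos by simp
  \<comment> \<open>\<open>m \<ge> 1 - ln t0\<close> places all shells where the volume bound holds;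
    \<open>m \<ge> 2\<close> lets \<open>exp m - 1\<close> be replaced by \<open>exp m / 2\<close>
    and the additive constants be absorbed into \<open>3 * m\<close>.\<close>
  fix m :: real assume m: "max 2 (1 - ln t0) \<le> m"
  define j1 where "j1 = nat \<lfloor>exp m\<rfloor>"
  define j2 where "j2 = nat \<lfloor>exp (2 * m)\<rfloor>"
  let ?A = "{x\<in>B. 0 < \<rho> x \<and> exp m \<le> - ln (\<rho> x) \<and> - ln (\<rho> x) \<le> exp (2 * m)}"
  have em: "exp m \<ge> 1 + m" by simp
  have "exp m < exp (2 * m)" using m by simp
  then have j12: "j1 \<le> j2" unfolding j1_def j2_def by (intro nat_mono floor_mono) simp
  have j1: "real j1 \<ge> exp m - 1" "real j1 \<ge> m"
    unfolding j1_def using em m by linarith+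
  then have j1': "1 \<le> j1" using m by linarith
  have ptw: "ennreal (1 / (- ln (\<rho> x) * \<rho> x ^ k)) * indicator ?A x \<le>
      (\<Sum>j=j1..j2. ennreal (exp ((real j + 1) * k) / j) * indicator {x\<in>B. \<rho> x \<le> exp (- real j)} x)" for x
  proof (cases "x \<in> ?A")
    case True
    define s where "s = - ln (\<rho> x)"
    have s: "exp m \<le> s" "s \<le> exp (2 * m)" and \<rho>: "\<rho> x = exp (- s)" using True by (auto simp: s_def)
    define j where "j = nat \<lfloor>s\<rfloor>"
    have j: "j \<in> {j1..j2}" using s by (auto simp: j_def j1_def j2_def intro: nat_mono floor_mono)
    then have j1j: "1 \<le> j" using j1' by simp
    have sj: "real j \<le> s" "s \<le> real j + 1" using s em m unfolding j_def by linarith+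
    have "\<rho> x ^ k = exp (- (s * k))" by (simp add: \<rho> exp_of_nat2_mult[symmetric])
    then have "1 / (- ln (\<rho> x) * \<rho> x ^ k) = exp (s * k) / s"
      unfolding s_def[symmetric] by (simp add: exp_minus divide_inverse mult.commute)
    also have "\<dots> \<le> exp ((real j + 1) * k) / j"
      using sj j1j by (intro frac_le) (auto intro!: mult_right_mono)
    finally have "ennreal (1 / (- ln (\<rho> x) * \<rho> x ^ k)) * indicator ?A x \<le>
        ennreal (exp ((real j + 1) * k) / j) * indicator {x\<in>B. \<rho> x \<le> exp (- real j)} x"
      using True \<rho> sj by (auto intro!: ennreal_leI)
    also have "\<dots> \<le> (\<Sum>j=j1..j2. ennreal (exp ((real j + 1) * k) / j) * indicator {x\<in>B. \<rho> x \<le> exp (- real j)} x)"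
      using j by (intro member_le_sum) auto
    finally show ?thesis .
  qed auto
  have "(\<integral>\<^sup>+x. ennreal (1 / (- ln (\<rho> x) * \<rho> x ^ k)) * indicator ?A x \<partial>\<mu>) \<le>
     (\<integral>\<^sup>+x. (\<Sum>j=j1..j2. ennreal (exp ((real j + 1) * k) / j) * indicator {x\<in>B. \<rho> x \<le> exp (- real j)} x) \<partial>\<mu>)"
    by (intro nn_integral_mono ptw)
  also have "\<dots> = (\<Sum>j=j1..j2. \<integral>\<^sup>+x. ennreal (exp ((real j + 1) * k) / j) * indicator {x\<in>B. \<rho> x \<le> exp (- real j)} x \<partial>\<mu>)"
    by (intro nn_integral_sum borel_measurable_times_ennreal borel_measurable_const borel_measurable_indicator meas)
  also have "\<dots> = (\<Sum>j=j1..j2. ennreal (exp ((real j + 1) * k) / j) * emeasure \<mu> {x\<in>B. \<rho> x \<le> exp (- real j)})"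
    using meas by (simp add: nn_integral_cmult_indicator)
  also have "\<dots> \<le> (\<Sum>j=j1..j2. ennreal (C * exp k * (1 / j)))"
  proof (intro sum_mono)
    fix j assume j: "j \<in> {j1..j2}"
    have "exp (- real j) \<le> exp (ln t0)" using j j1(2) m by simp
    then have "emeasure \<mu> {x\<in>B. \<rho> x \<le> exp (- real j)} \<le> ennreal (C * exp (- real j) ^ k)"
      using pos by (intro bound) auto
    then have "ennreal (exp ((real j + 1) * k) / j) * emeasure \<mu> {x\<in>B. \<rho> x \<le> exp (- real j)} \<le>
      ennreal (exp ((real j + 1) * k) / j) * ennreal (C * exp (- real j) ^ k)"
      by (rule mult_left_mono) simp
    also have "\<dots> = ennreal (exp ((real j + 1) * k) / j * (C * exp (- real j) ^ k))"
      by (intro ennreal_mult[symmetric]) (use pos in auto)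
    also have "exp ((real j + 1) * k) / j * (C * exp (- real j) ^ k) = C * exp k * (1 / j)"
      by (simp add: exp_of_nat2_mult[symmetric] exp_add[symmetric] field_simps)
    finally show "ennreal (exp ((real j + 1) * k) / j) * emeasure \<mu> {x\<in>B. \<rho> x \<le> exp (- real j)} \<le>
        ennreal (C * exp k * (1 / j))" .
  qed
  also have "\<dots> = ennreal (C * exp k * (\<Sum>j=j1..j2. 1 / real j))"
    using pos by (subst sum_ennreal) (auto simp: sum_distrib_left)
  also have "\<dots> \<le> ennreal (C * exp (real k) * 3 * m)"
  proof -
    have "real j1 \<ge> exp m / 2" using j1(1) em m by linarith
    moreover have "real j2 \<le> exp (2 * m)" unfolding j2_def by simp
    ultimately have "real j2 / real j1 \<le> exp (2 * m) / (exp m / 2)"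
      by (intro frac_le) auto
    also have "\<dots> = 2 * exp m" using exp_add[of m m] by (simp add: field_simps)
    finally have "ln (real j2 / real j1) \<le> ln (2 * exp m)"
      using j1' j12 by (subst ln_le_cancel_iff) auto
    also have "\<dots> = ln 2 + m" by (simp add: ln_mult)
    finally have "ln (real j2 / real j1) \<le> m + 1" using ln_le_minus_one[of 2] by simp
    moreover have "1 / real j1 \<le> 1" using j1' by simp
    ultimately have "(\<Sum>j=j1..j2. 1 / real j) \<le> 3 * m"
      using sum_inverse_le_ln[OF j1' j12] m by linarith
    then show ?thesis using pos by (intro ennreal_leI) (simp add: mult.assoc)
  qed
  finally show "(\<integral>\<^sup>+x. ennreal (1 / (- ln (\<rho> x) * \<rho> x ^ k)) * indicator ?A x \<partial>\<mu>)
      \<le> ennreal (C * exp (real k) * 3 * m)" .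
qed

text \<open>A shell is a difference of two sublevel sets, and with unrelated constants
  \<open>c\<close> and \<open>C\<close> a shell of logarithmic width 1 might have no mass. Width
  \<open>a\<close> with \<open>exp a \<ge> 2 * C / c\<close> makes the inner set at most half of the
  lower bound for the outer one, so each shell keeps \<open>c / 2\<close> times the expected volume.
  The band from 5/4 to 7/4 is where the profile \<open>H\<close> is bounded below.\<close>

lemma shell_integral_lower:
  fixes \<rho> :: "'a \<Rightarrow> real"
  assumes pos: "0 < c" "0 < C" "0 < t0" "1 \<le> k"
    and meas: "\<And>t. {x\<in>B. \<rho> x \<le> t} \<in> sets \<mu>"
    and upper: "\<And>t. 0 < t \<Longrightarrow> t \<le> t0 \<Longrightarrow> emeasure \<mu> {x\<in>B. \<rho> x \<le> t} \<le> ennreal (C * t ^ k)"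
    and lower: "\<And>t. 0 < t \<Longrightarrow> t \<le> t0 \<Longrightarrow> ennreal (c * t ^ k) \<le> emeasure \<mu> {x\<in>B. \<rho> x \<le> t}"
  obtains c' m0 where "0 < c'" "\<And>m. m0 \<le> m \<Longrightarrow>
    ennreal (c' * m) \<le> (\<integral>\<^sup>+x. ennreal (1 / (- ln (\<rho> x) * \<rho> x ^ k)) *
       indicator {x\<in>B. 0 < \<rho> x \<and> exp (5/4 * m) \<le> - ln (\<rho> x) \<and> - ln (\<rho> x) \<le> exp (7/4 * m)} x \<partial>\<mu>)"
proof
  define a where "a = max 1 (ln (2 * C / c))"
  have a: "1 \<le> a" "2 * C / c \<le> exp a"
  proof -
    have "2 * C / c = exp (ln (2 * C / c))" using pos by simp
    also have "\<dots> \<le> exp a" by (simp add: a_def)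
    finally show "2 * C / c \<le> exp a" .
  qed (simp add: a_def)
  show "0 < c / (8 * a)" using pos a by simp
  fix m :: real assume m: "max (max 1 (4 * ln (2 * a))) (- ln t0) \<le> m"
  \<comment> \<open>In terms of \<open>X\<close> the ends of the band are the integer powers
    \<open>X ^ 5\<close> and \<open>X ^ 7\<close>.\<close>
  define X where "X = exp (m / 4)"
  have X2: "2 * a \<le> X"
  proof -
    have "2 * a = exp (ln (2 * a))" using a by simp
    also have "\<dots> \<le> X" using m by (simp add: X_def)
    finally show ?thesis .
  qed
  have e5: "exp (5/4 * m) = X ^ 5" and e7: "exp (7/4 * m) = X ^ 7"
    by (simp_all add: X_def exp_of_nat_mult[symmetric])
  \<comment> \<open>Rounding inwards, with \<open>j2\<close> excluded from the index range, keeps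
    every shell entirely inside the band.\<close>
  define j1 where "j1 = nat \<lceil>X ^ 5 / a\<rceil>"
  define j2 where "j2 = nat \<lfloor>X ^ 7 / a\<rfloor>"
  let ?A = "{x\<in>B. 0 < \<rho> x \<and> exp (5/4 * m) \<le> - ln (\<rho> x) \<and> - ln (\<rho> x) \<le> exp (7/4 * m)}"
  define shell where "shell j = {x\<in>B. \<rho> x \<le> exp (- (a * real j))} - {x\<in>B. \<rho> x \<le> exp (- (a * (real j + 1)))}" for j
  have shell_iff: "x \<in> shell j \<longleftrightarrow> x \<in> B \<and> 0 < \<rho> x \<and> \<lfloor>- ln (\<rho> x) / a\<rfloor> = int j" for x j
  proof (cases "0 < \<rho> x")
    case True
    define s where "s = - ln (\<rho> x)"
    have \<rho>: "\<rho> x = exp (- s)" using True by (simp add: s_def)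
    have "x \<in> shell j \<longleftrightarrow> x \<in> B \<and> a * real j \<le> s \<and> s < a * (real j + 1)"
      by (auto simp: shell_def \<rho>)
    also have "\<dots> \<longleftrightarrow> x \<in> B \<and> real j \<le> s / a \<and> s / a < real j + 1"
      using a by (simp add: field_simps)
    also have "\<dots> \<longleftrightarrow> x \<in> B \<and> \<lfloor>s / a\<rfloor> = int j" by (simp add: floor_eq_iff)
    finally show ?thesis using True by (simp add: s_def)
  next
    case False
    \<comment> \<open>Points with \<open>\<rho> x \<le> 0\<close> lie in both sublevel sets and drop
      out of the difference.\<close>
    then have "\<rho> x \<le> exp (- (a * (real j + 1)))" by (smt (verit) exp_gt_zero)
    then show ?thesis using False by (auto simp: shell_def)
  qed
  have ptw: "(\<Sum>j\<in>{j1..<j2}. ennreal (exp (a * j * k) / (a * (real j + 1))) * indicator (shell j) x)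
      \<le> ennreal (1 / (- ln (\<rho> x) * \<rho> x ^ k)) * indicator ?A x" for x
  proof (cases "\<exists>j\<in>{j1..<j2}. x \<in> shell j")
    case True
    then obtain j where j: "j \<in> {j1..<j2}" and xj: "x \<in> shell j" by blast
    define s where "s = - ln (\<rho> x)"
    have "0 < \<rho> x" and xB: "x \<in> B" using xj by (auto simp: shell_iff)
    then have \<rho>: "\<rho> x = exp (- s)" by (simp add: s_def)
    have s: "a * real j \<le> s" "s \<le> a * (real j + 1)" using xj by (auto simp: shell_def \<rho>)
    have "X ^ 5 / a \<le> real j1" unfolding j1_def by linarith
    moreover have "real j2 \<le> X ^ 7 / a" unfolding j2_def using a by (intro of_nat_floor) (simp add: X_def)
    moreover have "real j1 \<le> real j" "real j + 1 \<le> real j2" using j by auto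
    ultimately have "X ^ 5 / a \<le> real j" "real j + 1 \<le> X ^ 7 / a" by linarith+
    then have X5: "X ^ 5 \<le> a * real j" and X7: "a * (real j + 1) \<le> X ^ 7"
      using a by (simp_all add: field_simps)
    have spos: "0 < s" using X5 s by (smt (verit) X_def exp_gt_zero zero_less_power)
    have xA: "x \<in> ?A" unfolding e5 e7 using xB \<open>0 < \<rho> x\<close> s X5 X7 by (simp add: s_def)
    have eq: "(indicator (shell i) x :: ennreal) = (if i = j then 1 else 0)" for i
      using xj by (auto simp: shell_iff indicator_def)
    have "(\<Sum>j\<in>{j1..<j2}. ennreal (exp (a * j * k) / (a * (real j + 1))) * indicator (shell j) x)
       = ennreal (exp (a * j * k) / (a * (real j + 1)))"
      using j by (simp add: eq sum.delta if_distrib cong: if_cong)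
    also have "\<dots> \<le> ennreal (exp (s * k) / s)"
      using s spos a by (intro ennreal_leI frac_le) (auto intro!: mult_right_mono)
    also have "exp (s * k) / s = 1 / (- ln (\<rho> x) * \<rho> x ^ k)"
    proof -
      have "\<rho> x ^ k = exp (- (s * k))" by (simp add: \<rho> exp_of_nat2_mult[symmetric])
      then show ?thesis
        unfolding s_def[symmetric] by (simp add: exp_minus divide_inverse mult.commute)
    qed
    finally show ?thesis using xA by simp
  qed (simp add: indicator_def)
  have shellm: "shell j \<in> sets \<mu>" for j unfolding shell_def using meas by (intro sets.Diff)
  have shelle: "ennreal (c / 2 * exp (- (a * real j)) ^ k) \<le> emeasure \<mu> (shell j)" if "j1 \<le> j" for j
  proof -
    let ?t = "exp (- (a * real j))" and ?t' = "exp (- (a * (real j + 1)))"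
    have "X ^ 5 / a \<le> real j1" unfolding j1_def by linarith
    then have "X ^ 5 \<le> a * real j1" using a by (simp add: field_simps)
    also have "\<dots> \<le> a * real j" using that a by simp
    finally have "m \<le> a * real j" using exp_ge_add_one_self[of "5/4 * m"] m unfolding e5[symmetric] by linarith
    then have "?t \<le> exp (ln t0)" using m by simp
    then have t: "?t \<le> t0" using pos by simp
    have t'le: "?t' \<le> ?t" using a by simp
    then have t': "?t' \<le> t0" using t by linarith
    have "?t' = ?t * exp (- a)" by (simp add: exp_add[symmetric] algebra_simps)
    then have "C * ?t' ^ k = ?t ^ k * (C * exp (- a) ^ k)" by (simp add: power_mult_distrib)
    also have "\<dots> \<le> ?t ^ k * (C * exp (- a))"
      using pos a power_decreasing[of 1 k "exp (- a)"] by (intro mult_left_mono) auto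
    also have "\<dots> \<le> ?t ^ k * (c / 2)"
      using a(2) pos by (intro mult_left_mono) (auto simp: exp_minus field_simps)
    finally have Ct': "C * ?t' ^ k \<le> c / 2 * ?t ^ k" by (simp add: mult.commute)
    have fin: "emeasure \<mu> {x\<in>B. \<rho> x \<le> ?t'} \<noteq> \<infinity>"
      using upper[of ?t'] t' by (auto simp: top_unique)
    have "ennreal (c / 2 * ?t ^ k) \<le> ennreal (c * ?t ^ k - C * ?t' ^ k)"
      using Ct' by (intro ennreal_leI) simp
    also have "\<dots> = ennreal (c * ?t ^ k) - ennreal (C * ?t' ^ k)"
      using pos by (intro ennreal_minus[symmetric]) auto
    also have "\<dots> \<le> emeasure \<mu> {x\<in>B. \<rho> x \<le> ?t} - emeasure \<mu> {x\<in>B. \<rho> x \<le> ?t'}"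
      using t t' by (intro ennreal_minus_mono lower upper) auto
    also have "\<dots> = emeasure \<mu> (shell j)"
      unfolding shell_def using meas fin t'le by (intro emeasure_Diff[symmetric]) (auto intro: order_trans)
    finally show ?thesis .
  qed
  have "c / (8 * a) * m \<le> c / (2 * a) * (\<Sum>j\<in>{j1..<j2}. 1 / (real j + 1))"
  proof -
    have "X > 0" by (simp add: X_def)
    \<comment> \<open>The true quotient of the ends is \<open>X ^ 2\<close>; one factor
      \<open>X \<ge> 2 * a\<close> is spent on the rounding, and \<open>ln X = m / 4\<close> remains
      for the harmonic sum.\<close>
    have "X \<le> (real j2 + 1) / (real j1 + 1)"
    proof -
      have 1: "X ^ 7 / a \<le> real j2 + 1" unfolding j2_def by linarith
      have "0 \<le> X ^ 5 / a" using \<open>X > 0\<close> a by simp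
      then have 2: "real j1 + 1 \<le> X ^ 5 / a + 2" unfolding j1_def by linarith
      have "X * (2 * a) \<le> X * X" using X2 \<open>X > 0\<close> by (intro mult_left_mono) auto
      also have "X * X \<le> X ^ 6" using X2 a power_increasing[of 2 6 X] by (simp add: power2_eq_square)
      finally have "X * (X ^ 5 + 2 * a) \<le> 2 * X ^ 6" by (simp add: algebra_simps numeral_eq_Suc)
      also have "\<dots> \<le> X * X ^ 6" using X2 a \<open>X > 0\<close> by (intro mult_right_mono) auto
      also have "\<dots> = X ^ 7" by (simp add: numeral_eq_Suc)
      finally have "X * (X ^ 5 + 2 * a) / a \<le> X ^ 7 / a" using a by (intro divide_right_mono) auto
      moreover have "X * (X ^ 5 + 2 * a) / a = X * (X ^ 5 / a + 2)" using a by (simp add: field_simps)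
      ultimately have "X * (X ^ 5 / a + 2) \<le> X ^ 7 / a" by simp
      then have "X * (real j1 + 1) \<le> real j2 + 1"
        using 1 2 mult_left_mono[OF 2, of X] \<open>X > 0\<close> by linarith
      then show ?thesis by (simp add: field_simps)
    qed
    then have "ln X \<le> ln ((real j2 + 1) / (real j1 + 1))" using \<open>X > 0\<close> by (intro ln_mono) auto
    then have "m / 4 \<le> (\<Sum>j\<in>{j1..<j2}. 1 / (real j + 1))"
      using ln_le_sum_inverse[of j2 j1] by (simp add: X_def)
    then have "c / (2 * a) * (m / 4) \<le> c / (2 * a) * (\<Sum>j\<in>{j1..<j2}. 1 / (real j + 1))"
      using pos a by (intro mult_left_mono) auto
    then show ?thesis by simp
  qed
  then have "ennreal (c / (8 * a) * m) \<le> ennreal (c / (2 * a) * (\<Sum>j\<in>{j1..<j2}. 1 / (real j + 1)))"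
    by (rule ennreal_leI)
  also have "\<dots> = (\<Sum>j\<in>{j1..<j2}. ennreal (c / (2 * a) * (1 / (real j + 1))))"
    using pos a by (subst sum_ennreal) (auto simp: sum_distrib_left)
  also have "\<dots> \<le> (\<Sum>j\<in>{j1..<j2}. ennreal (exp (a * j * k) / (a * (real j + 1))) * emeasure \<mu> (shell j))"
  proof (rule sum_mono)
    fix j assume j: "j \<in> {j1..<j2}"
    have "c / (2 * a) * (1 / (real j + 1)) = exp (a * j * k) / (a * (real j + 1)) * (c / 2 * exp (- (a * real j)) ^ k)"
      by (simp add: exp_of_nat2_mult[symmetric] exp_minus field_simps)
    then have "ennreal (c / (2 * a) * (1 / (real j + 1))) =
        ennreal (exp (a * j * k) / (a * (real j + 1))) * ennreal (c / 2 * exp (- (a * real j)) ^ k)"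
      by (simp only:) (intro ennreal_mult, use a pos in auto)
    also have "\<dots> \<le> ennreal (exp (a * j * k) / (a * (real j + 1))) * emeasure \<mu> (shell j)"
      using j by (intro mult_left_mono shelle) auto
    finally show "ennreal (c / (2 * a) * (1 / (real j + 1))) \<le>
       ennreal (exp (a * j * k) / (a * (real j + 1))) * emeasure \<mu> (shell j)" .
  qed
  also have "\<dots> = (\<Sum>j\<in>{j1..<j2}. \<integral>\<^sup>+x. ennreal (exp (a * j * k) / (a * (real j + 1))) * indicator (shell j) x \<partial>\<mu>)"
    using shellm by (simp add: nn_integral_cmult_indicator)
  also have "\<dots> = (\<integral>\<^sup>+x. (\<Sum>j\<in>{j1..<j2}. ennreal (exp (a * j * k) / (a * (real j + 1))) * indicator (shell j) x) \<partial>\<mu>)"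
    by (intro nn_integral_sum[symmetric] borel_measurable_times_ennreal borel_measurable_const borel_measurable_indicator shellm)
  also have "\<dots> \<le> (\<integral>\<^sup>+x. ennreal (1 / (- ln (\<rho> x) * \<rho> x ^ k)) * indicator ?A x \<partial>\<mu>)"
    by (intro nn_integral_mono ptw)
  finally show "ennreal (c / (8 * a) * m) \<le> (\<integral>\<^sup>+x. ennreal (1 / (- ln (\<rho> x) * \<rho> x ^ k)) * indicator ?A x \<partial>\<mu>)" .
qed

subsection \<open>Test functions\<close>

text \<open>The derivative is the inner product with the gradient, so it suffices to take the
  gradient itself as the direction \<open>v\<close>.\<close>

lemma norm_gradient_le:
  assumes "linear (frechet_derivative u (at x))"
    and "\<And>v. \<bar>frechet_derivative u (at x) v\<bar> \<le> c * norm v"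
  shows "norm (gradient u x) \<le> c"
proof -
  let ?g = "gradient u x"
  have "frechet_derivative u (at x) v = ?g \<bullet> v" for v
  proof -
    have "frechet_derivative u (at x) v = frechet_derivative u (at x) (\<Sum>b\<in>Basis. (v \<bullet> b) *\<^sub>R b)"
      by (simp add: euclidean_representation)
    also have "\<dots> = (\<Sum>b\<in>Basis. (v \<bullet> b) * frechet_derivative u (at x) b)"
      by (simp add: linear_sum[OF assms(1)] linear_scale[OF assms(1)])
    also have "\<dots> = ?g \<bullet> v"
      by (simp only: gradient_def inner_sum_left inner_scaleR_left) (simp add: inner_commute mult.commute)
    finally show ?thesis .
  qed
  then have "norm ?g * norm ?g \<le> c * norm ?g"
    using assms(2)[of ?g] by (simp add: power2_norm_eq_inner[symmetric] power2_eq_square)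
  moreover have "0 \<le> c"
    using assms(2)[of "SOME b. b \<in> Basis"] order_trans[OF abs_ge_zero assms(2)]
    by (metis nonempty_Basis norm_Basis ex_in_conv mult.right_neutral)
  ultimately show ?thesis by (cases "?g = 0") auto
qed

text \<open>Either \<open>b \<le> \<eta> * a\<close> or \<open>a < b / \<eta>\<close>, and each case
  gives one summand. The main term keeps a factor close to 1, and the large constant falls on the
  term that will be of order \<open>1 / M\<close>.\<close>

lemma power_add_le_weighted:
  fixes a b \<eta> :: real
  assumes "0 \<le> a" "0 \<le> b" "0 < \<eta>"
  shows "(a + b) ^ k \<le> (1 + \<eta>) ^ k * a ^ k + (1 + 1 / \<eta>) ^ k * b ^ k"
proof (cases "b \<le> \<eta> * a")
  case True
  then have "(a + b) ^ k \<le> ((1 + \<eta>) * a) ^ k"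
    using assms by (intro power_mono) (auto simp: algebra_simps)
  then show ?thesis using assms by (simp add: power_mult_distrib add_increasing2)
next
  case False
  then have "a \<le> b / \<eta>" using assms by (simp add: field_simps)
  then have "(a + b) ^ k \<le> ((1 + 1 / \<eta>) * b) ^ k"
    using assms by (intro power_mono) (auto simp: algebra_simps)
  then show ?thesis using assms by (simp add: power_mult_distrib add_increasing)
qed

text \<open>Chart, profile and cutoff are fixed here together with their bounds, while the scale
  \<open>M\<close> stays a parameter; hence all constants below are independent of \<open>M\<close>.
  The set \<open>J\<close> consists of the normal coordinates, and its cardinality is the
  codimension \<open>k\<close>.\<close>

locale test_function_family =
  fixes \<Phi> :: "real^'n \<Rightarrow> real^'n" and J :: "'n set" and x0 :: "real^'n" and r \<eta> :: real
    and H :: "real \<Rightarrow> real" and cH CH :: real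
    and \<zeta> :: "real^'n \<Rightarrow> real" and c\<zeta> C\<zeta> :: real
  assumes r: "0 < r" and smooth_\<Phi>: "smooth_on (ball x0 r) \<Phi>" and J: "J \<noteq> {}" and \<eta>: "0 < \<eta>" "\<eta> \<le> 1"
    and D\<Phi>: "\<And>x v. x \<in> ball x0 r \<Longrightarrow> norm (frechet_derivative \<Phi> (at x) v) \<le> (1 + \<eta>) * norm v"
    and smooth_H: "smooth_on UNIV H" and cH: "0 < cH" and CH: "0 < CH"
    and H_nonneg: "\<And>t. 0 \<le> H t" and H_le_1: "\<And>t. H t \<le> 1"
    and H_zero: "\<And>t. t \<notin> {1<..<2} \<Longrightarrow> H t = 0" and H_ge: "\<And>t. t \<in> {5/4..7/4} \<Longrightarrow> cH \<le> H t"
    and H_deriv: "\<And>t. (H has_real_derivative deriv H t) (at t)"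
    and DH: "\<And>t. \<bar>deriv H t\<bar> \<le> CH" and DH_zero: "\<And>t. t \<notin> {1..2} \<Longrightarrow> deriv H t = 0"
    and smooth_\<zeta>: "smooth_on UNIV \<zeta>" and c\<zeta>: "0 < c\<zeta>" and C\<zeta>: "0 < C\<zeta>"
    and \<zeta>_nonneg: "\<And>x. 0 \<le> \<zeta> x" and \<zeta>_le_1: "\<And>x. \<zeta> x \<le> 1"
    and \<zeta>_zero: "\<And>x. x \<notin> cball x0 (3/4 * r) \<Longrightarrow> \<zeta> x = 0"
    and \<zeta>_ge: "\<And>x. x \<in> ball x0 (r/2) \<Longrightarrow> c\<zeta> \<le> \<zeta> x"
    and D\<zeta>: "\<And>x v. \<bar>frechet_derivative \<zeta> (at x) v\<bar> \<le> C\<zeta> * norm v"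
begin

definition \<rho> :: "real^'n \<Rightarrow> real" where "\<rho> x = L2_set (\<lambda>j. \<Phi> x $ j) J"

definition s :: "real^'n \<Rightarrow> real" where "s x = - ln (\<rho> x)"

text \<open>\<open>\<rho> x < 1\<close> makes \<open>s\<close> positive, so that
  \<open>ln (s x)\<close> and real powers of \<open>s\<close> are smooth here.\<close>

definition W :: "(real^'n) set" where "W = {x \<in> ball x0 r. 0 < \<rho> x \<and> \<rho> x < 1}"

definition \<theta> :: real where "\<theta> = (real (card J) - 1) / real (card J)"

definition window :: "real \<Rightarrow> (real^'n) set" where
  "window M = {x \<in> ball x0 r. 0 < \<rho> x \<and> exp M \<le> s x \<and> s x \<le> exp (2 * M)}"

text \<open>
  Up to the cutoffs this is the formal extremal \<open>(- ln d) powr ((k - 1) / k)\<close>, with the chart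
  quantity \<open>\<rho>\<close> in the role of the distance \<open>d\<close>: unlike \<open>d\<close> it is smooth off the surface.
\<close>

definition u :: "real \<Rightarrow> real^'n \<Rightarrow> real" where
  "u M x = (if x \<in> W then \<zeta> x * (s x powr \<theta> * H (ln (s x) / M)) else 0)"

text \<open>The density common to both sides of the inequality; it is the power
  \<open>card J\<close> of \<open>s powr (\<theta> - 1) / \<rho>\<close>.\<close>

definition w :: "real^'n \<Rightarrow> real" where "w x = 1 / (s x * \<rho> x ^ card J)"

lemma card_J: "1 \<le> card J"
proof -
  have "card J \<noteq> 0" using J by (metis card_eq_0_iff finite)
  then show ?thesis by linarith
qed

lemma \<theta>: "0 \<le> \<theta>" "\<theta> * card J = real (card J) - 1"
  using card_J J by (simp_all add: \<theta>_def)

lemma \<rho>_sq: "(\<rho> x)\<^sup>2 = (\<Sum>j\<in>J. \<Phi> x $ j * \<Phi> x $ j)"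
  by (simp add: \<rho>_def L2_set_def sum_nonneg power2_eq_square)

lemma \<rho>_nonneg: "0 \<le> \<rho> x"
  by (simp add: \<rho>_def L2_set_nonneg)

lemma s_pos: "x \<in> W \<Longrightarrow> 0 < s x"
  by (simp add: W_def s_def)

lemma \<rho>_eq: "x \<in> W \<Longrightarrow> \<rho> x = exp (- s x)"
  by (simp add: W_def s_def)

text \<open>The square of \<rho> is a sum of products of smooth functions, so this form of
  \<open>s\<close> can be differentiated without a square root.\<close>

lemma s_eq: "x \<in> W \<Longrightarrow> s x = - (1/2) * ln ((\<rho> x)\<^sup>2)"
  by (simp add: W_def s_def ln_realpow)

lemma continuous_on_\<rho>: "continuous_on (ball x0 r) \<rho>"
  unfolding \<rho>_def L2_set_def
  by (intro continuous_intros smooth_on_imp_continuous_on[OF smooth_\<Phi>])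

lemma open_W: "open W"
proof -
  have "open (ball x0 r \<inter> \<rho> -` {0<..<1})"
    by (intro continuous_open_preimage continuous_on_\<rho>) auto
  moreover have "W = ball x0 r \<inter> \<rho> -` {0<..<1}" by (auto simp: W_def)
  ultimately show ?thesis by simp
qed

lemma smooth_on_s: "smooth_on W s"
proof -
  have W: "W \<subseteq> ball x0 r" by (auto simp: W_def)
  have comp: "smooth_on W (\<lambda>x. \<Phi> x $ j)" for j
    by (rule smooth_on_bounded_linear[OF open_W bounded_linear_vec_nth smooth_on_subset[OF smooth_\<Phi> W]])
  have "smooth_on W (\<lambda>x. ln (\<Sum>j\<in>J. \<Phi> x $ j * \<Phi> x $ j))"
  proof (rule smooth_on_compose[OF open_W smooth_on_ln])
    show "smooth_on W (\<lambda>x. \<Sum>j\<in>J. \<Phi> x $ j * \<Phi> x $ j)"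
      by (intro smooth_on_sum smooth_on_mult comp open_W)
  qed (auto simp: \<rho>_sq[symmetric] W_def)
  then have "smooth_on W (\<lambda>x. - (1/2) * ln (\<Sum>j\<in>J. \<Phi> x $ j * \<Phi> x $ j))"
    by (intro smooth_on_mult smooth_on_const open_W)
  then show ?thesis
    by (rule smooth_on_cong[OF open_W, rotated]) (simp add: s_eq \<rho>_sq)
qed

text \<open>The derivative in direction \<open>v\<close> is, up to sign, the inner product of the
  normal parts of \<open>\<Phi> x\<close> and of its derivative along \<open>v\<close>, divided by
  the square of \<rho>. Cauchy-Schwarz cancels one factor \<rho>.\<close>

lemma derivative_s_bound:
  assumes x: "x \<in> W"
  shows "\<bar>frechet_derivative s (at x) v\<bar> \<le> (1 + \<eta>) / \<rho> x * norm v"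
proof -
  have xb: "x \<in> ball x0 r" and \<rho>: "0 < \<rho> x" using x by (auto simp: W_def)
  define q where "q y = (\<Sum>j\<in>J. \<Phi> y $ j * \<Phi> y $ j)" for y
  have q: "q x = (\<rho> x)\<^sup>2" by (simp add: q_def \<rho>_sq)
  let ?D = "frechet_derivative \<Phi> (at x)"
  let ?q' = "\<lambda>v. \<Sum>j\<in>J. \<Phi> x $ j * ?D v $ j + ?D v $ j * \<Phi> x $ j"
  have "((\<lambda>y. \<Phi> y $ j) has_derivative (\<lambda>v. ?D v $ j)) (at x)" for j
    by (rule bounded_linear.has_derivative[OF bounded_linear_vec_nth smooth_on_has_derivative[OF smooth_\<Phi> xb]])
  then have dq: "(q has_derivative ?q') (at x)"
    unfolding q_def by (intro has_derivative_sum has_derivative_mult)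
  have "((\<lambda>y. - (1/2) * ln (q y)) has_derivative (\<lambda>v. - (1/2) * (?q' v * inverse (q x)))) (at x)"
    using \<rho> q by (intro has_derivative_mult_right has_derivative_ln dq) auto
  then have "(s has_derivative (\<lambda>v. - (1/2) * (?q' v * inverse (q x)))) (at x)"
    by (rule has_derivative_transform_within_open[OF _ open_W x]) (simp add: s_eq \<rho>_sq q_def)
  from fun_cong[OF frechet_derivative_at[OF this], of v]
  have "frechet_derivative s (at x) v = - (1/2) * (?q' v * inverse (q x))" by (rule sym)
  also have "?q' v = 2 * (\<Sum>j\<in>J. \<Phi> x $ j * ?D v $ j)"
    by (simp add: sum_distrib_left mult.commute)
  also have "- (1/2) * (2 * T * inverse (q x)) = - (T / (\<rho> x)\<^sup>2)" for T
    by (simp only: q divide_inverse mult_minus_left mult_1_left mult.assoc)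
      (simp only: mult.assoc[symmetric], simp)
  finally have "\<bar>frechet_derivative s (at x) v\<bar> = \<bar>\<Sum>j\<in>J. \<Phi> x $ j * ?D v $ j\<bar> / (\<rho> x)\<^sup>2"
    by (simp only: abs_minus_cancel abs_divide abs_power2)
  also have "\<bar>\<Sum>j\<in>J. \<Phi> x $ j * ?D v $ j\<bar> \<le> (\<Sum>j\<in>J. \<bar>\<Phi> x $ j\<bar> * \<bar>?D v $ j\<bar>)"
    by (simp add: abs_mult[symmetric] sum_abs)
  also have "\<dots> \<le> \<rho> x * L2_set (\<lambda>j. ?D v $ j) J"
    unfolding \<rho>_def by (rule L2_set_mult_ineq)
  also have "\<dots> \<le> \<rho> x * ((1 + \<eta>) * norm v)"
    using L2_set_components_le_norm[of "?D v" J] D\<Phi>[OF xb, of v] \<rho> by (intro mult_left_mono) auto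
  finally show ?thesis
    using \<rho> by (simp add: divide_right_mono power2_eq_square)
qed

section \<open>Support and smoothness of the test functions\<close>

lemma window_subset: "window M \<subseteq> W"
proof
  fix x assume x: "x \<in> window M"
  then have "0 < s x" by (auto simp: window_def intro: less_le_trans[OF exp_gt_zero])
  then show "x \<in> W" using x by (auto simp: window_def W_def s_def)
qed

lemma H_eq_0:
  assumes "x \<in> W" "x \<notin> window M" "0 < M"
  shows "H (ln (s x) / M) = 0" "deriv H (ln (s x) / M) = 0"
proof -
  have "s x < exp M \<or> exp (2 * M) < s x"
    using assms(1,2) by (auto simp: window_def W_def)
  then have "ln (s x) < ln (exp M) \<or> ln (exp (2 * M)) < ln (s x)"
    using s_pos[OF assms(1)] by (subst (1 2) ln_less_cancel_iff) auto
  then have "ln (s x) < M \<or> 2 * M < ln (s x)" by simp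
  then have "ln (s x) / M \<notin> {1..2}" using assms(3) by (auto simp: field_simps)
  then show "H (ln (s x) / M) = 0" "deriv H (ln (s x) / M) = 0"
    using H_zero[of "ln (s x) / M"] DH_zero by auto
qed

text \<open>A compact subset of the open set \<open>W\<close> outside which \<open>u M\<close>
  vanishes: the closed ball of the cutoff, intersected with the closed range of \<open>s\<close> in
  the window, written in terms of \<rho>.\<close>

definition core :: "real \<Rightarrow> (real^'n) set" where
  "core M = {x \<in> cball x0 (3/4 * r). exp (- exp (2 * M)) \<le> \<rho> x \<and> \<rho> x \<le> exp (- exp M)}"

lemma compact_core: "compact (core M)"
proof -
  have "cball x0 (3/4 * r) \<subseteq> ball x0 r" using r by auto
  then have "continuous_on (cball x0 (3/4 * r)) \<rho>" by (rule continuous_on_subset[OF continuous_on_\<rho>])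
  then have "closed (cball x0 (3/4 * r) \<inter> \<rho> -` {exp (- exp (2 * M))..exp (- exp M)})"
    by (intro continuous_closed_preimage) auto
  moreover have "core M = cball x0 (3/4 * r) \<inter> \<rho> -` {exp (- exp (2 * M))..exp (- exp M)}"
    by (auto simp: core_def)
  ultimately show ?thesis
    by (metis bounded_Int bounded_cball compact_eq_bounded_closed)
qed

lemma core_subset: "core M \<subseteq> W"
proof
  fix x assume x: "x \<in> core M"
  have "0 < \<rho> x" "\<rho> x < 1" using x
    by (auto simp: core_def intro: less_le_trans[OF exp_gt_zero] le_less_trans[of _ "exp (- exp M)"])
  then show "x \<in> W" using x r by (auto simp: W_def core_def)
qed

lemma u_eq_0: "x \<notin> core M \<Longrightarrow> 0 < M \<Longrightarrow> u M x = 0"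
proof -
  assume x: "x \<notin> core M" and M: "0 < M"
  show ?thesis
  proof (cases "x \<in> W \<and> \<zeta> x \<noteq> 0")
    case True
    then have "x \<in> cball x0 (3/4 * r)" using \<zeta>_zero by blast
    then have "x \<notin> window M" using x True \<rho>_eq[of x] by (auto simp: window_def core_def)
    then show ?thesis using H_eq_0(1)[of x M] True M by (simp add: u_def)
  qed (auto simp: u_def)
qed

text \<open>The open sets \<open>W\<close> and \<open>- core M\<close> cover the space; on the first
  \<open>u M\<close> is a composition of smooth functions, on the second it is zero.\<close>

lemma smooth_on_u:
  assumes M: "0 < M"
  shows "smooth_on UNIV (u M)"
proof -
  have ln_s: "smooth_on W (\<lambda>x. ln (s x))"
    by (rule smooth_on_compose[OF open_W smooth_on_ln smooth_on_s]) (auto simp: s_pos)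
  have "smooth_on W (\<lambda>x. \<zeta> x * (exp (\<theta> * ln (s x)) * H (1 / M * ln (s x))))"
    by (intro smooth_on_mult open_W smooth_on_compose[OF open_W smooth_on_exp]
        smooth_on_compose[OF open_W smooth_H] smooth_on_const ln_s smooth_on_subset[OF smooth_\<zeta>]) auto
  then have "smooth_on W (u M)"
  proof (rule smooth_on_cong[OF open_W, rotated])
    show "\<zeta> x * (exp (\<theta> * ln (s x)) * H (1 / M * ln (s x))) = u M x" if "x \<in> W" for x
      using s_pos[OF that] that by (simp add: u_def powr_def)
  qed
  moreover have "smooth_on (- core M) (u M)"
  proof (rule smooth_on_cong[OF _ _ smooth_on_const[of _ 0]])
    show "open (- core M)" "open (- core M)" using compact_imp_closed[OF compact_core] by auto
  qed (use u_eq_0 M in auto)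
  ultimately have "smooth_on (W \<union> - core M) (u M)"
    using compact_imp_closed[OF compact_core] by (intro smooth_on_Un open_W) auto
  moreover have "W \<union> - core M = UNIV" using core_subset by auto
  ultimately show ?thesis by simp
qed

lemma u_test_function:
  assumes "0 < M" "ball x0 r \<subseteq> \<Omega>" "\<And>x. x \<in> ball x0 r \<Longrightarrow> x \<in> K \<Longrightarrow> \<rho> x = 0"
  shows "u M \<in> test_functions (\<Omega> - K)"
proof -
  have sub: "closure {x. u M x \<noteq> 0} \<subseteq> core M"
    using u_eq_0 assms(1) by (intro closure_minimal compact_imp_closed[OF compact_core]) blast
  moreover have "core M \<subseteq> \<Omega> - K"
    using core_subset[of M] assms(2,3) by (force simp: W_def)
  moreover have "compact (closure {x. u M x \<noteq> 0})"
    using compact_Int_closed[OF compact_core closed_closure, of M "{x. u M x \<noteq> 0}"] sub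
    by (simp add: Int_absorb1)
  ultimately show ?thesis
    unfolding test_functions_def using smooth_on_u[OF assms(1)] by blast
qed

lemma gradient_u_eq_0:
  assumes "x \<notin> W" "0 < M"
  shows "gradient (u M) x = 0"
proof -
  have "((\<lambda>_. 0) has_derivative frechet_derivative (u M) (at x)) (at x)"
    by (rule has_derivative_transform_within_open[OF smooth_on_has_derivative[OF smooth_on_u[OF assms(2)]], of _ "- core M"])
      (use assms core_subset u_eq_0 compact_imp_closed[OF compact_core] in auto)
  from has_derivative_unique[OF this has_derivative_const]
  have "frechet_derivative (u M) (at x) = (\<lambda>_. 0)" .
  then show ?thesis by (simp add: gradient_def)
qed

section \<open>Pointwise bounds for the gradient\<close>

lemma w_eq:
  assumes "x \<in> W"
  shows "(s x powr (\<theta> - 1) / \<rho> x) ^ card J = w x"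
proof -
  have "(s x powr (\<theta> - 1)) ^ card J = s x powr ((\<theta> - 1) * card J)"
    using s_pos[OF assms] by (simp add: powr_powr powr_realpow[symmetric])
  also have "(\<theta> - 1) * card J = - 1" using \<theta>(2) by (simp add: algebra_simps)
  finally have "(s x powr (\<theta> - 1)) ^ card J = 1 / s x" using s_pos[OF assms] by (simp add: powr_minus_divide)
  then show ?thesis by (simp add: w_def power_divide)
qed

lemma w_nonneg: "x \<in> W \<Longrightarrow> 0 \<le> w x"
  using s_pos \<rho>_nonneg by (simp add: w_def less_imp_le)

text \<open>The product rule gives three terms. With \<open>s powr (\<theta> - 1) / \<rho>\<close>
  factored out, differentiating the power gives the main term. Differentiating \<open>H\<close>
  costs \<open>CH / M\<close>, multiplied by \<open>(1 + \<eta>) * \<zeta> x \<le> 2\<close>.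
  Differentiating \<zeta> leaves the factor \<open>s * \<rho> = s * exp (- s)\<close>, which is at
  most \<open>4 / M\<close>.\<close>

lemma norm_gradient_u_le:
  assumes x: "x \<in> W" and M: "1 \<le> M"
  shows "norm (gradient (u M) x) \<le> (s x powr (\<theta> - 1) / \<rho> x) *
    ((1 + \<eta>) * \<theta> * (\<zeta> x * H (ln (s x) / M)) + (2 * CH + 4 * C\<zeta>) / M) * indicator (window M) x"
proof (rule norm_gradient_le)
  let ?P = "s x powr (\<theta> - 1)"
  define h where "h = H (ln (s x) / M)"
  define h' where "h' = deriv H (ln (s x) / M)"
  have sp: "0 < s x" and \<rho>p: "0 < \<rho> x" using s_pos[OF x] x by (auto simp: W_def)
  have Psx: "s x powr \<theta> = ?P * s x"
    using sp powr_add[of "s x" "\<theta> - 1" 1] by simp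
  show "linear (frechet_derivative (u M) (at x))"
    by (rule has_derivative_linear[OF smooth_on_has_derivative[OF smooth_on_u]]) (use M in auto)
  have ds: "(s has_derivative frechet_derivative s (at x)) (at x)"
    by (rule smooth_on_has_derivative[OF smooth_on_s x])
  have "((\<lambda>t. t powr \<theta> * H (ln t / M)) has_field_derivative
      s x powr \<theta> * (h' * (1 / s x / M)) + \<theta> * ?P * h) (at (s x))"
    unfolding h_def h'_def
    by (rule derivative_eq_intros DERIV_chain2[OF H_deriv] refl | use sp M in simp)+
  from has_derivative_compose[OF ds this[unfolded has_field_derivative_def]]
  have "((\<lambda>y. s y powr \<theta> * H (ln (s y) / M)) has_derivative
      (\<lambda>v. (s x powr \<theta> * (h' * (1 / s x / M)) + \<theta> * ?P * h) * frechet_derivative s (at x) v)) (at x)"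
    .
  then have "((\<lambda>y. \<zeta> y * (s y powr \<theta> * H (ln (s y) / M))) has_derivative
      (\<lambda>v. \<zeta> x * ((s x powr \<theta> * (h' * (1 / s x / M)) + \<theta> * ?P * h) * frechet_derivative s (at x) v)
         + frechet_derivative \<zeta> (at x) v * (s x powr \<theta> * h))) (at x)"
    unfolding h_def by (intro has_derivative_mult smooth_on_has_derivative[OF smooth_\<zeta>]) auto
  then have "(u M has_derivative
      (\<lambda>v. \<zeta> x * ((s x powr \<theta> * (h' * (1 / s x / M)) + \<theta> * ?P * h) * frechet_derivative s (at x) v)
         + frechet_derivative \<zeta> (at x) v * (s x powr \<theta> * h))) (at x)"
    by (rule has_derivative_transform_within_open[OF _ open_W x]) (simp add: u_def)
  from fun_cong[OF frechet_derivative_at[OF this]]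
  have "frechet_derivative (u M) (at x) v = \<zeta> x * ((s x powr \<theta> * (h' * (1 / s x / M)) + \<theta> * ?P * h) * frechet_derivative s (at x) v)
         + frechet_derivative \<zeta> (at x) v * (s x powr \<theta> * h)" for v
    by (rule sym)
  then have du: "frechet_derivative (u M) (at x) v = ?P * (\<zeta> x * (\<theta> * h + h' / M) * frechet_derivative s (at x) v
         + frechet_derivative \<zeta> (at x) v * (s x * h))" for v
    using sp by (simp add: Psx algebra_simps)
  show "\<bar>frechet_derivative (u M) (at x) v\<bar> \<le> (s x powr (\<theta> - 1) / \<rho> x) *
    ((1 + \<eta>) * \<theta> * (\<zeta> x * H (ln (s x) / M)) + (2 * CH + 4 * C\<zeta>) / M) * indicator (window M) x * norm v" for v
  proof (cases "x \<in> window M")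
    case False
    then have "h = 0" "h' = 0" using H_eq_0[OF x] M by (auto simp: h_def h'_def)
    then show ?thesis using False by (simp add: du)
  next
    case True
    have sM: "M \<le> s x"
    proof -
      have "exp M \<le> s x" using True by (simp add: window_def)
      then show ?thesis using exp_ge_add_one_self[of M] by linarith
    qed
    \<comment> \<open>The constant 4 comes from squaring \<open>s / 2 \<le> exp (s / 2)\<close>,
      which gives \<open>s ^ 2 * exp (- s) \<le> 4\<close>; then \<open>s \<ge> M\<close> is used
      once.\<close>
    have srho: "s x * \<rho> x \<le> 4 / M"
    proof -
      have "(s x)\<^sup>2 / 4 \<le> (1 + s x / 2)\<^sup>2" using sp by (simp add: power2_eq_square field_simps)
      also have "\<dots> \<le> (exp (s x / 2))\<^sup>2"
        using sp by (intro power_mono) auto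
      also have "\<dots> = exp (s x)" by (simp add: power2_eq_square exp_add[symmetric])
      finally have "s x * s x * \<rho> x \<le> 4 * exp (s x) * \<rho> x"
        using \<rho>p by (intro mult_right_mono) (auto simp: power2_eq_square)
      also have "\<dots> = 4" by (simp add: \<rho>_eq[OF x] exp_minus)
      finally have "s x * s x * \<rho> x \<le> 4" .
      then have "s x * \<rho> x \<le> 4 / s x" using sp by (simp add: field_simps)
      also have "\<dots> \<le> 4 / M" using sM M by (intro divide_left_mono) auto
      finally show ?thesis .
    qed
    have h: "0 \<le> h" "h \<le> 1" "\<bar>h'\<bar> \<le> CH" by (simp_all add: h_def h'_def H_nonneg H_le_1 DH)
    have 1: "\<bar>\<zeta> x * (\<theta> * h + h' / M) * frechet_derivative s (at x) v\<bar> \<le>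
        ((1 + \<eta>) * \<theta> * (\<zeta> x * h) + 2 * CH / M) / \<rho> x * norm v"
    proof -
      have "\<bar>\<zeta> x * (\<theta> * h + h' / M) * frechet_derivative s (at x) v\<bar>
         \<le> (\<zeta> x * (\<theta> * h + CH / M)) * ((1 + \<eta>) / \<rho> x * norm v)"
        unfolding abs_mult
      proof (intro mult_mono derivative_s_bound[OF x])
        have "\<bar>\<theta> * h + h' / M\<bar> \<le> \<bar>\<theta> * h\<bar> + \<bar>h' / M\<bar>" by (rule abs_triangle_ineq)
        also have "\<dots> \<le> \<theta> * h + CH / M"
          using h \<theta> M by (simp add: abs_divide divide_right_mono)
        finally show "\<bar>\<theta> * h + h' / M\<bar> \<le> \<theta> * h + CH / M" .
      qed (use h \<theta> M CH \<zeta>_nonneg[of x] in auto)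
      also have "\<dots> = ((1 + \<eta>) * \<theta> * (\<zeta> x * h) + (1 + \<eta>) * \<zeta> x * (CH / M)) / \<rho> x * norm v"
        by (simp add: field_simps)
      also have "\<dots> \<le> ((1 + \<eta>) * \<theta> * (\<zeta> x * h) + 2 * CH / M) / \<rho> x * norm v"
      proof -
        have "(1 + \<eta>) * \<zeta> x \<le> 2 * 1" using \<eta> \<zeta>_nonneg[of x] \<zeta>_le_1[of x] by (intro mult_mono) auto
        then have "(1 + \<eta>) * \<zeta> x * (CH / M) \<le> 2 * (CH / M)"
          using CH M by (intro mult_right_mono) auto
        then show ?thesis using \<rho>p by (intro mult_right_mono divide_right_mono) auto
      qed
      finally show ?thesis .
    qed
    have 2: "\<bar>frechet_derivative \<zeta> (at x) v * (s x * h)\<bar> \<le> (4 * C\<zeta> / M) / \<rho> x * norm v"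
    proof -
      have "s x * h \<le> s x * 1" using sp h by (intro mult_left_mono) auto
      also have "\<dots> \<le> 4 / M / \<rho> x"
        using srho \<rho>p by (simp only: pos_le_divide_eq mult_1_right)
      finally have "\<bar>frechet_derivative \<zeta> (at x) v\<bar> * (s x * h) \<le> (C\<zeta> * norm v) * (4 / M / \<rho> x)"
        using D\<zeta>[of x v] sp h C\<zeta> by (intro mult_mono) auto
      then show ?thesis using sp h by (simp add: abs_mult field_simps)
    qed
    have "\<bar>frechet_derivative (u M) (at x) v\<bar> = ?P * \<bar>\<zeta> x * (\<theta> * h + h' / M) * frechet_derivative s (at x) v
         + frechet_derivative \<zeta> (at x) v * (s x * h)\<bar>"
      by (simp add: du abs_mult)
    also have "\<dots> \<le> ?P * (((1 + \<eta>) * \<theta> * (\<zeta> x * h) + 2 * CH / M) / \<rho> x * norm v + (4 * C\<zeta> / M) / \<rho> x * norm v)"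
      by (intro mult_left_mono order_trans[OF abs_triangle_ineq] add_mono 1 2) simp
    also have "\<dots> = (?P / \<rho> x) * ((1 + \<eta>) * \<theta> * (\<zeta> x * h) + (2 * CH + 4 * C\<zeta>) / M) * norm v"
      by (simp add: algebra_simps add_divide_distrib)
    finally show ?thesis using True by (simp add: h_def)
  qed
qed

text \<open>The exponent \<open>2 * card J\<close> combines the chart distortion with the weighted
  splitting of the power. The error, being of order \<open>1 / M\<close> before taking the power,
  becomes of order \<open>1 / M ^ card J\<close>.\<close>

lemma gradient_u_power_le:
  assumes M: "1 \<le> M"
  shows "norm (gradient (u M) x) ^ card J \<le>
    ((1 + \<eta>) ^ (2 * card J) * \<theta> ^ card J * ((\<zeta> x * H (ln (s x) / M)) ^ card J * w x) +
     ((1 + 1 / \<eta>) * (2 * CH + 4 * C\<zeta>)) ^ card J / M ^ card J * w x) * indicator (window M) x"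
proof (cases "x \<in> window M")
  case True
  then have x: "x \<in> W" using window_subset by blast
  let ?k = "card J" and ?h = "\<zeta> x * H (ln (s x) / M)" and ?C = "(2 * CH + 4 * C\<zeta>) / M"
  have h: "0 \<le> ?h" using \<zeta>_nonneg H_nonneg by simp
  have C: "0 \<le> ?C" using CH C\<zeta> M by simp
  have "norm (gradient (u M) x) ^ ?k \<le> ((s x powr (\<theta> - 1) / \<rho> x) * ((1 + \<eta>) * \<theta> * ?h + ?C)) ^ ?k"
    using norm_gradient_u_le[OF x M] True by (intro power_mono) auto
  also have "\<dots> = w x * ((1 + \<eta>) * \<theta> * ?h + ?C) ^ ?k"
    by (simp only: power_mult_distrib w_eq[OF x])
  also have "\<dots> \<le> w x * ((1 + \<eta>) ^ ?k * ((1 + \<eta>) * \<theta> * ?h) ^ ?k + (1 + 1 / \<eta>) ^ ?k * ?C ^ ?k)"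
    using \<eta> \<theta> h C w_nonneg[OF x] by (intro mult_left_mono power_add_le_weighted) auto
  also have "\<dots> = (1 + \<eta>) ^ (2 * ?k) * \<theta> ^ ?k * (?h ^ ?k * w x) + ((1 + 1 / \<eta>) * (2 * CH + 4 * C\<zeta>)) ^ ?k / M ^ ?k * w x"
  proof -
    have "(1 + 1 / \<eta>) ^ ?k * ?C ^ ?k = ((1 + 1 / \<eta>) * (2 * CH + 4 * C\<zeta>)) ^ ?k / M ^ ?k"
      by (simp only: power_mult_distrib power_divide times_divide_eq_right)
    moreover have "w x * ((1 + \<eta>) ^ ?k * ((1 + \<eta>) * \<theta> * h) ^ ?k + D) =
        (1 + \<eta>) ^ (2 * ?k) * \<theta> ^ ?k * (h ^ ?k * w x) + D * w x" for h D
      by (simp only: power_mult_distrib mult_2 power_add distrib_left) (simp only: mult_ac)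
    ultimately show ?thesis by simp
  qed
  finally show ?thesis using True by simp
next
  case False
  have zero: "gradient (u M) x = 0"
  proof (cases "x \<in> W")
    case True
    then show ?thesis using norm_gradient_u_le[OF True M] False by simp
  qed (use gradient_u_eq_0 M in simp)
  \<comment> \<open>Positivity matters because \<open>0 ^ 0 = 1\<close>.\<close>
  have "0 < card J" using card_J by linarith
  then have "norm (gradient (u M) x) ^ card J = 0" by (simp only: zero norm_zero zero_power)
  then show ?thesis unfolding indicator_simps(2)[OF False] by (simp only: mult_zero_right order_refl)
qed

lemma u_power:
  assumes "x \<in> W"
  shows "\<bar>u M x\<bar> ^ card J = (\<zeta> x * H (ln (s x) / M)) ^ card J * s x ^ (card J - 1)"
proof -
  have "(s x powr \<theta>) ^ card J = s x powr (\<theta> * card J)"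
    using s_pos[OF assms] by (simp add: powr_powr powr_realpow[symmetric])
  also have "\<theta> * card J = real (card J - 1)" using \<theta>(2) card_J by (simp add: of_nat_diff)
  finally have "(s x powr \<theta>) ^ card J = s x ^ (card J - 1)" using s_pos[OF assms] by (simp add: powr_realpow)
  then show ?thesis
    using assms \<zeta>_nonneg H_nonneg by (simp add: u_def abs_mult power_mult_distrib mult_ac)
qed

end

text \<open>As long as \<open>ln (D / d) \<ge> 1\<close> and \<open>\<gamma> \<le> k\<close>, the
  product \<open>d ^ k * ln (D / d) powr \<gamma>\<close> increases with \<open>d\<close>, so
  \<open>d\<close> may be replaced by \<open>(1 + \<eta>) * \<rho>\<close>. The logarithm is then at
  most \<open>(1 + \<eta>) * s\<close>, and \<open>ln s \<ge> M\<close> turns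
  \<open>s powr \<gamma>\<close> into \<open>s ^ k\<close> at the gain
  \<open>exp (- (M * (k - \<gamma>)))\<close>. Both replacements cost a factor
  \<open>(1 + \<eta>) ^ k\<close>.\<close>

lemma log_weight_lower:
  fixes d D \<rho> \<eta> \<gamma> M :: real
  assumes d: "0 < d" "d \<le> (1 + \<eta>) * \<rho>" and \<rho>: "0 < \<rho>" and \<eta>: "0 < \<eta>" "\<eta> \<le> 1" and D: "0 < D"
    and \<gamma>: "0 < \<gamma>" "\<gamma> \<le> real k" and k: "1 \<le> k"
    and M: "exp M \<le> - ln \<rho>" "(\<bar>ln D\<bar> + 2) / \<eta> \<le> M"
  shows "(1 / (1 + \<eta>)) ^ (2 * k) * exp (M * (real k - \<gamma>)) * (1 / (- ln \<rho> * \<rho> ^ k)) \<le>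
    (- ln \<rho>) ^ (k - 1) / d ^ k * log_weight (d / D) powr \<gamma>"
proof -
  define s where "s = - ln \<rho>"
  define d1 where "d1 = (1 + \<eta>) * \<rho>"
  define z where "z = ln D - ln d"
  define z0 where "z0 = ln D - ln d1"
  have d1: "0 < d1" "d \<le> d1" using \<rho> \<eta> d by (auto simp: d1_def)
  have sM: "exp M \<le> s" "M + 1 \<le> s" using M(1) exp_ge_add_one_self[of M] unfolding s_def by linarith+
  have z0_eq: "z0 = s + ln D - ln (1 + \<eta>)" using \<rho> \<eta> by (simp add: z0_def d1_def s_def ln_mult)
  have eta_ln: "0 \<le> ln (1 + \<eta>)" "ln (1 + \<eta>) \<le> 1" using \<eta> ln_le_minus_one[of "1 + \<eta>"] by auto
  \<comment> \<open>The threshold for \<open>M\<close> is chosen so that \<open>s * \<eta>\<close>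
    absorbs \<open>ln D\<close>; this gives
    \<open>1 \<le> z0 \<le> (1 + \<eta>) * s\<close>.\<close>
  have "\<bar>ln D\<bar> + 2 \<le> M * \<eta>" using M(2) \<eta> by (simp add: divide_le_eq)
  also have "\<dots> \<le> s * \<eta>" using sM \<eta> by (intro mult_right_mono) auto
  finally have Ls: "\<bar>ln D\<bar> + 2 \<le> s * \<eta>" .
  have "(\<bar>ln D\<bar> + 2) / 1 \<le> (\<bar>ln D\<bar> + 2) / \<eta>" using \<eta> by (intro divide_left_mono) auto
  then have "\<bar>ln D\<bar> + 2 \<le> M" using M(2) by simp
  then have z0: "1 \<le> z0" using sM eta_ln unfolding z0_eq by linarith
  have z0': "z0 \<le> (1 + \<eta>) * s" using Ls eta_ln unfolding z0_eq distrib_right by (simp add: mult.commute)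
  have zz0: "z0 \<le> z" using d d1 by (simp add: z_def z0_def)
  have spos: "0 < s" using sM(1) by (rule less_le_trans[OF exp_gt_zero])
  have "d = exp (ln d1 - (z - z0))" using d by (simp add: z_def z0_def)
  also have "\<dots> = d1 * exp (- (z - z0))" 
    using exp_add[of "ln d1" "- (z - z0)"] d1(1) by (simp only: exp_ln add_uminus_conv_diff)
  finally have "d ^ k = d1 ^ k * exp (- (k * (z - z0)))"
    by (simp add: power_mult_distrib exp_of_nat_mult[symmetric] algebra_simps)
  \<comment> \<open>This is the monotonicity of \<open>z powr \<gamma> * exp (- (k * z))\<close>
    beyond 1, obtained from \<open>ln (z / z0) \<le> (z - z0) / z0\<close>.\<close>
  moreover have "z powr \<gamma> \<le> z0 powr \<gamma> * exp (k * (z - z0))"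
  proof -
    have "z powr \<gamma> = (z0 * (z / z0)) powr \<gamma>" using z0 by simp
    also have "\<dots> = z0 powr \<gamma> * (z / z0) powr \<gamma>" using z0 zz0 by (subst powr_mult) auto
    also have "(z / z0) powr \<gamma> = exp (\<gamma> * ln (z / z0))" using z0 zz0 by (simp add: powr_def)
    also have "\<dots> \<le> exp (k * (z - z0))"
    proof -
      have "ln (z / z0) \<le> z / z0 - 1" using z0 zz0 by (intro ln_le_minus_one) auto
      also have "\<dots> = (z - z0) / z0" using z0 by (simp add: field_simps)
      also have "\<dots> \<le> (z - z0) / 1" using z0 zz0 by (intro divide_left_mono) auto
      finally have "\<gamma> * ln (z / z0) \<le> \<gamma> * (z - z0)" using \<gamma> by (intro mult_left_mono) auto
      also have "\<dots> \<le> k * (z - z0)" using \<gamma> zz0 by (intro mult_right_mono) auto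
      finally show ?thesis by simp
    qed
    finally show ?thesis by (simp add: mult_left_mono)
  qed
  ultimately have "d ^ k * z powr \<gamma> \<le> d1 ^ k * exp (- (k * (z - z0))) * (z0 powr \<gamma> * exp (k * (z - z0)))"
    using d1 by (simp add: mult_left_mono)
  also have "\<dots> = d1 ^ k * z0 powr \<gamma>" by (simp add: exp_minus)
  also have "\<dots> \<le> d1 ^ k * ((1 + \<eta>) ^ k * (s ^ k * exp (- (M * (k - \<gamma>)))))"
  proof (intro mult_left_mono)
    have "z0 powr \<gamma> \<le> ((1 + \<eta>) * s) powr \<gamma>" using z0 z0' \<gamma> by (intro powr_mono2) auto
    also have "\<dots> = (1 + \<eta>) powr \<gamma> * s powr \<gamma>" using \<eta> spos by (subst powr_mult) auto
    also have "\<dots> \<le> (1 + \<eta>) ^ k * (s ^ k * exp (- (M * (k - \<gamma>))))"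
    proof (intro mult_mono)
      have "(1 + \<eta>) powr \<gamma> \<le> (1 + \<eta>) powr k" using \<eta> \<gamma> by (intro powr_mono) auto
      then show "(1 + \<eta>) powr \<gamma> \<le> (1 + \<eta>) ^ k" using \<eta> by (simp add: powr_realpow)
      have "M \<le> ln s" using sM spos by (simp add: ln_ge_iff)
      then have "M * (k - \<gamma>) \<le> ln s * (k - \<gamma>)" using \<gamma> by (intro mult_right_mono) auto
      then have "exp (ln s * \<gamma>) \<le> exp (k * ln s + - (M * (k - \<gamma>)))"
        by (simp add: algebra_simps)
      then show "s powr \<gamma> \<le> s ^ k * exp (- (M * (k - \<gamma>)))"
        using spos by (simp only: exp_add exp_of_nat_mult exp_ln) (simp add: powr_def mult.commute)
    qed (use \<eta> in auto)
    finally show "z0 powr \<gamma> \<le> (1 + \<eta>) ^ k * (s ^ k * exp (- (M * (k - \<gamma>))))" .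
  qed (use d1 in auto)
  finally have le: "d ^ k * z powr \<gamma> \<le> d1 ^ k * ((1 + \<eta>) ^ k * (s ^ k * exp (- (M * (k - \<gamma>)))))" (is "_ \<le> ?X") .
  have zpos: "0 < z" using z0 zz0 by linarith
  have "s ^ k = s * s ^ (k - 1)" using k by (simp add: power_eq_if)
  then have "(1 / (1 + \<eta>)) ^ (2 * k) * exp (M * (real k - \<gamma>)) * (1 / (s * \<rho> ^ k)) = s ^ (k - 1) / ?X"
  proof -
    have aux: "(1 / e) ^ (2 * k) * q * (1 / (s * a)) = t / (e ^ k * a * (e ^ k * (s * t * inverse q)))"
      if "0 < e" "0 < q" "0 < t" for e q a t :: real
      using that spos by (simp add: power_divide mult_2_right power_add field_simps)
    show ?thesis
      using aux[of "1 + \<eta>" "exp (M * (real k - \<gamma>))" "s ^ (k - 1)" "\<rho> ^ k"] \<eta> spos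
      by (simp only: \<open>s ^ k = s * s ^ (k - 1)\<close> d1_def power_mult_distrib exp_minus) simp
  qed
  also have "\<dots> \<le> s ^ (k - 1) / (d ^ k * z powr \<gamma>)"
    using le d zpos spos by (intro divide_left_mono) (auto intro!: mult_pos_pos simp: \<eta> d1 add_pos_pos)
  also have "\<dots> = s ^ (k - 1) / d ^ k * log_weight (d / D) powr \<gamma>"
  proof -
    have "log_weight (d / D) = 1 / z" using d D by (simp add: log_weight_def ln_div z_def) (simp add: divide_simps)
    then show ?thesis using zpos by (simp add: powr_divide)
  qed
  finally show ?thesis by (simp add: s_def)
qed

section \<open>The two masses of the window\<close>

context test_function_family
begin

text \<open>\<open>s\<close> is known to be continuous only on \<open>W\<close>, so it is extended
  by zero. As \<open>0 < \<alpha>\<close>, neither this value nor the nonpositive values of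
  \<open>s\<close> where \<open>\<rho> \<ge> 1\<close> meet the band.\<close>

lemma band_measurable:
  assumes "a \<le> r" "0 < \<alpha>"
  shows "{x \<in> ball x0 a. 0 < \<rho> x \<and> \<alpha> \<le> s x \<and> s x \<le> \<beta>} \<in> sets borel"
proof -
  let ?A = "{x \<in> ball x0 a. 0 < \<rho> x \<and> \<alpha> \<le> s x \<and> s x \<le> \<beta>}"
  have "(\<lambda>x. indicator W x *\<^sub>R s x) \<in> borel_measurable borel"
    by (intro borel_measurable_continuous_on_indicator smooth_on_imp_continuous_on[OF smooth_on_s]) (simp add: open_W)
  then have "(\<lambda>x. indicator W x *\<^sub>R s x) -` {\<alpha>..\<beta>} \<in> sets borel"
    by (rule measurable_sets_borel) simp
  moreover have "?A = ball x0 a \<inter> (\<lambda>x. indicator W x *\<^sub>R s x) -` {\<alpha>..\<beta>}"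
  proof (rule set_eqI)
    show "x \<in> ?A \<longleftrightarrow> x \<in> ball x0 a \<inter> (\<lambda>x. indicator W x *\<^sub>R s x) -` {\<alpha>..\<beta>}" for x
    proof (cases "x \<in> W")
      case True
      then have "0 < \<rho> x" by (simp add: W_def)
      then show ?thesis using True by simp
    next
      case False
      then have "x \<notin> ?A" using assms by (auto simp: W_def s_def not_less dest: ln_ge_zero)
      then show ?thesis using False assms by (simp add: not_le)
    qed
  qed
  ultimately show ?thesis by simp
qed

lemma window_measurable: "window M \<in> sets borel"
  unfolding window_def by (rule band_measurable) auto

lemma restricted_measurable:
  assumes "continuous_on W f" "A \<in> sets borel" "A \<subseteq> W"
  shows "(\<lambda>x. ennreal (f x) * indicator A x) \<in> borel_measurable lborel"
proof -
  have "(\<lambda>x. indicator W x *\<^sub>R f x) \<in> borel_measurable borel"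
    by (intro borel_measurable_continuous_on_indicator assms) (simp add: open_W)
  then have "(\<lambda>x. ennreal (indicator W x *\<^sub>R f x) * indicator A x) \<in> borel_measurable lborel"
    using assms(2) by measurable
  moreover have "(\<lambda>x. ennreal (indicator W x *\<^sub>R f x) * indicator A x) = (\<lambda>x. ennreal (f x) * indicator A x)"
    using assms(3) by (auto simp: fun_eq_iff indicator_def)
  ultimately show ?thesis by simp
qed

lemmas window_integrand_measurable = restricted_measurable[OF _ window_measurable window_subset]

lemma continuous_on_w: "continuous_on W w"
proof -
  have "continuous_on W \<rho>" by (rule continuous_on_subset[OF continuous_on_\<rho>]) (auto simp: W_def)
  then show ?thesis
    unfolding w_def using s_pos smooth_on_imp_continuous_on[OF smooth_on_s]
    by (intro continuous_intros) (auto simp: W_def less_le)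
qed

lemma continuous_on_profile: "continuous_on W (\<lambda>x. \<zeta> x * H (ln (s x) / M))"
proof -
  have "continuous_on W (\<lambda>x. ln (s x) / M)" if "M \<noteq> 0"
    using s_pos smooth_on_imp_continuous_on[OF smooth_on_s] that by (intro continuous_intros) (auto simp: less_le)
  then have "continuous_on W (\<lambda>x. ln (s x) / M)" by (cases "M = 0") auto
  then have "continuous_on W (\<lambda>x. H (ln (s x) / M))"
    using continuous_on_compose2[OF smooth_on_imp_continuous_on[OF smooth_H]] by blast
  moreover have "continuous_on W \<zeta>"
    using smooth_on_imp_continuous_on[OF smooth_\<zeta>] continuous_on_subset by blast
  ultimately show ?thesis by (rule continuous_on_mult[rotated])
qed

definition mass :: "real \<Rightarrow> ennreal" where
  "mass M = (\<integral>\<^sup>+x. ennreal ((\<zeta> x * H (ln (s x) / M)) ^ card J * w x) * indicator (window M) x \<partial>lborel)"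

text \<open>The cutoffs are dropped because the error terms carry their derivatives, which need not
  be small where the cutoffs themselves are.\<close>

definition outer_mass :: "real \<Rightarrow> ennreal" where
  "outer_mass M = (\<integral>\<^sup>+x. ennreal (w x) * indicator (window M) x \<partial>lborel)"

lemma energy_le:
  assumes M: "1 \<le> M"
  shows "(\<integral>\<^sup>+x\<in>\<Omega>. ennreal (norm (gradient (u M) x) ^ card J) \<partial>lborel) \<le>
    ennreal ((1 + \<eta>) ^ (2 * card J) * \<theta> ^ card J) * mass M +
    ennreal (((1 + 1 / \<eta>) * (2 * CH + 4 * C\<zeta>)) ^ card J / M ^ card J) * outer_mass M"
    (is "_ \<le> ennreal ?a * _ + ennreal ?b * _")
proof -
  let ?f = "\<lambda>x. (\<zeta> x * H (ln (s x) / M)) ^ card J * w x"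
  have a: "0 \<le> ?a" using \<eta> \<theta> by simp
  have b: "0 \<le> ?b" using \<eta> CH C\<zeta> M by simp
  have "(\<integral>\<^sup>+x\<in>\<Omega>. ennreal (norm (gradient (u M) x) ^ card J) \<partial>lborel) \<le>
    (\<integral>\<^sup>+x. ennreal ?a * (ennreal (?f x) * indicator (window M) x) + ennreal ?b * (ennreal (w x) * indicator (window M) x) \<partial>lborel)"
  proof (rule nn_integral_mono)
    fix x
    show "ennreal (norm (gradient (u M) x) ^ card J) * indicator \<Omega> x \<le>
       ennreal ?a * (ennreal (?f x) * indicator (window M) x) + ennreal ?b * (ennreal (w x) * indicator (window M) x)"
    proof -
      have "ennreal (norm (gradient (u M) x) ^ card J) * indicator \<Omega> x \<le> ennreal (norm (gradient (u M) x) ^ card J)"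
        by (auto simp: indicator_def)
      also have "\<dots> \<le> ennreal ((?a * ?f x + ?b * w x) * indicator (window M) x)"
        by (intro ennreal_leI gradient_u_power_le M)
      also have "\<dots> = ennreal ?a * (ennreal (?f x) * indicator (window M) x) + ennreal ?b * (ennreal (w x) * indicator (window M) x)"
      proof (cases "x \<in> window M")
        case True
        then have w: "0 \<le> w x" using window_subset w_nonneg by blast
        then have f: "0 \<le> ?f x" using \<zeta>_nonneg H_nonneg by simp
        show ?thesis
          using True by (simp only: indicator_simps mult_1_right ennreal_plus[OF mult_nonneg_nonneg[OF a f] mult_nonneg_nonneg[OF b w]]
            ennreal_mult[OF a f] ennreal_mult[OF b w])
      qed simp
      finally show ?thesis .
    qed
  qed
  also have "\<dots> = ennreal ?a * mass M + ennreal ?b * outer_mass M"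
  proof -
    have m1: "(\<lambda>x. ennreal (?f x) * indicator (window M) x) \<in> borel_measurable lborel"
      by (intro window_integrand_measurable continuous_intros continuous_on_profile continuous_on_w)
    have m2: "(\<lambda>x. ennreal (w x) * indicator (window M) x) \<in> borel_measurable lborel"
      by (rule window_integrand_measurable[OF continuous_on_w])
    show ?thesis
      unfolding mass_def outer_mass_def
      by (simp only: nn_integral_add[OF borel_measurable_times_ennreal[OF borel_measurable_const m1]
            borel_measurable_times_ennreal[OF borel_measurable_const m2]]
          nn_integral_cmult[OF m1] nn_integral_cmult[OF m2])
  qed
  finally show ?thesis .
qed

lemma mass_le_outer_mass: "mass M \<le> outer_mass M"
  unfolding mass_def outer_mass_def
proof (rule nn_integral_mono)
  fix x
  show "ennreal ((\<zeta> x * H (ln (s x) / M)) ^ card J * w x) * indicator (window M) x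
      \<le> ennreal (w x) * indicator (window M) x"
  proof (cases "x \<in> window M")
    case True
    then have w: "0 \<le> w x" using window_subset w_nonneg by blast
    have "(\<zeta> x * H (ln (s x) / M)) ^ card J \<le> 1"
      using \<zeta>_nonneg \<zeta>_le_1 H_nonneg H_le_1 by (intro power_le_one mult_le_one) auto
    then have "(\<zeta> x * H (ln (s x) / M)) ^ card J * w x \<le> 1 * w x" using w by (rule mult_right_mono)
    then show ?thesis using True by (simp add: ennreal_leI)
  qed simp
qed

lemma sublevel_measurable:
  assumes "a \<le> r"
  shows "{x \<in> ball x0 a. \<rho> x \<le> t} \<in> sets borel"
proof -
  have "closedin (top_of_set (ball x0 a)) (ball x0 a \<inter> \<rho> -` {..t})"
    by (intro continuous_closedin_preimage continuous_on_subset[OF continuous_on_\<rho>]) (use assms in auto)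
  then obtain T where "closed T" "ball x0 a \<inter> \<rho> -` {..t} = T \<inter> ball x0 a"
    by (auto simp: closedin_closed)
  moreover have "{x \<in> ball x0 a. \<rho> x \<le> t} = ball x0 a \<inter> \<rho> -` {..t}" by auto
  ultimately show ?thesis by simp
qed

lemma outer_mass_bound:
  assumes "0 < C" "0 < t0"
    and "\<And>t. 0 < t \<Longrightarrow> t \<le> t0 \<Longrightarrow> emeasure lborel {x \<in> ball x0 r. \<rho> x \<le> t} \<le> ennreal (C * t ^ card J)"
  obtains C' m0 where "0 < C'" "\<And>M. m0 \<le> M \<Longrightarrow> outer_mass M \<le> ennreal (C' * M)"
proof -
  obtain C' m0 where C': "0 < C'" "\<And>m. m0 \<le> m \<Longrightarrow>
    (\<integral>\<^sup>+x. ennreal (1 / (- ln (\<rho> x) * \<rho> x ^ card J)) *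
       indicator {x\<in>ball x0 r. 0 < \<rho> x \<and> exp m \<le> - ln (\<rho> x) \<and> - ln (\<rho> x) \<le> exp (2 * m)} x \<partial>lborel) \<le> ennreal (C' * m)"
  proof (rule shell_integral_upper[OF assms(1,2) _ assms(3)])
    show "{x \<in> ball x0 r. \<rho> x \<le> t} \<in> sets lborel" for t
      using sublevel_measurable[of r t] r by simp
  qed auto
  show ?thesis
    using C' by (intro that[of C' m0]) (auto simp: outer_mass_def w_def window_def s_def)
qed

text \<open>On the half ball, with \<open>ln s / M\<close> between 5/4 and 7/4, both cutoffs are
  bounded below, so the lower shell estimate carries over with the factor
  \<open>(c\<zeta> * cH) ^ card J\<close>.\<close>

lemma mass_bound:
  assumes "0 < c" "0 < C" "0 < t0"
    and upper: "\<And>t. 0 < t \<Longrightarrow> t \<le> t0 \<Longrightarrow> emeasure lborel {x \<in> ball x0 r. \<rho> x \<le> t} \<le> ennreal (C * t ^ card J)"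
    and lower: "\<And>t. 0 < t \<Longrightarrow> t \<le> t0 \<Longrightarrow> ennreal (c * t ^ card J) \<le> emeasure lborel {x \<in> ball x0 (r/2). \<rho> x \<le> t}"
  obtains c' m0 where "0 < c'" "\<And>M. m0 \<le> M \<Longrightarrow> ennreal (c' * M) \<le> mass M"
proof -
  let ?A = "\<lambda>M. {x \<in> ball x0 (r/2). 0 < \<rho> x \<and> exp (5/4 * M) \<le> - ln (\<rho> x) \<and> - ln (\<rho> x) \<le> exp (7/4 * M)}"
  obtain c' m0 where c': "0 < c'" "\<And>M. m0 \<le> M \<Longrightarrow> ennreal (c' * M) \<le>
      (\<integral>\<^sup>+x. ennreal (1 / (- ln (\<rho> x) * \<rho> x ^ card J)) * indicator (?A M) x \<partial>lborel)"
  proof (rule shell_integral_lower[OF assms(1-3) card_J _ _ lower])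
    show "{x \<in> ball x0 (r/2). \<rho> x \<le> t} \<in> sets lborel" for t
      using sublevel_measurable[of "r/2" t] r by simp
    show "emeasure lborel {x \<in> ball x0 (r/2). \<rho> x \<le> t} \<le> ennreal (C * t ^ card J)" if "0 < t" "t \<le> t0" for t
    proof -
      have "emeasure lborel {x \<in> ball x0 (r/2). \<rho> x \<le> t} \<le> emeasure lborel {x \<in> ball x0 r. \<rho> x \<le> t}"
        using sublevel_measurable[of r t] r by (intro emeasure_mono) auto
      then show ?thesis using upper[OF that] by (rule order_trans)
    qed
  qed blast+
  let ?c = "(c\<zeta> * cH) ^ card J"
  have "ennreal (?c * c' * M) \<le> mass M" if M: "max m0 1 \<le> M" for M
  proof -
    have A: "?A M = {x \<in> ball x0 (r/2). 0 < \<rho> x \<and> exp (5/4 * M) \<le> s x \<and> s x \<le> exp (7/4 * M)}"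
      by (simp add: s_def)
    have AW: "?A M \<subseteq> window M"
    proof
      fix x assume x: "x \<in> ?A M"
      have "exp M \<le> exp (5/4 * M)" "exp (7/4 * M) \<le> exp (2 * M)" using M by simp_all
      with x show "x \<in> window M" using r unfolding A window_def by (auto simp del: exp_le_cancel_iff)
    qed
    have "ennreal (?c * c' * M) = ennreal ?c * ennreal (c' * M)"
      using c\<zeta> cH c' M by (subst ennreal_mult[symmetric]) (auto simp: mult_ac)
    also have "\<dots> \<le> ennreal ?c * (\<integral>\<^sup>+x. ennreal (w x) * indicator (?A M) x \<partial>lborel)"
      using c'(2)[of M] M by (intro mult_left_mono) (auto simp: w_def s_def)
    also have "\<dots> = (\<integral>\<^sup>+x. ennreal ?c * (ennreal (w x) * indicator (?A M) x) \<partial>lborel)"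
    proof (intro nn_integral_cmult[symmetric] restricted_measurable continuous_on_w)
      show "?A M \<in> sets borel" unfolding A using r by (intro band_measurable) auto
      show "?A M \<subseteq> W" using AW window_subset by blast
    qed
    also have "\<dots> \<le> mass M"
      unfolding mass_def
    proof (rule nn_integral_mono)
      fix x
      show "ennreal ?c * (ennreal (w x) * indicator (?A M) x) \<le>
        ennreal ((\<zeta> x * H (ln (s x) / M)) ^ card J * w x) * indicator (window M) x"
      proof (cases "x \<in> ?A M")
        case True
        then have xW: "x \<in> window M" "x \<in> W" using AW window_subset by blast+
        have "x \<in> ball x0 (r/2)" "exp (5/4 * M) \<le> s x" "s x \<le> exp (7/4 * M)" using True unfolding A by auto
        then have "ln (exp (5/4 * M)) \<le> ln (s x)" "ln (s x) \<le> ln (exp (7/4 * M))"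
          using s_pos[OF xW(2)] by (simp_all only: ln_le_cancel_iff exp_gt_zero)
        then have "5/4 * M \<le> ln (s x)" "ln (s x) \<le> 7/4 * M" by simp_all
        then have "ln (s x) / M \<in> {5/4..7/4}" using M by (auto simp: field_simps)
        then have "c\<zeta> * cH \<le> \<zeta> x * H (ln (s x) / M)"
          using H_ge \<zeta>_ge \<open>x \<in> ball x0 (r/2)\<close> c\<zeta> cH \<zeta>_nonneg by (intro mult_mono) auto
        then have "?c \<le> (\<zeta> x * H (ln (s x) / M)) ^ card J" using c\<zeta> cH by (intro power_mono) auto
        then have "?c * w x \<le> (\<zeta> x * H (ln (s x) / M)) ^ card J * w x"
          using w_nonneg[OF xW(2)] by (rule mult_right_mono)
        then have "ennreal (?c * w x) \<le> ennreal ((\<zeta> x * H (ln (s x) / M)) ^ card J * w x)" by (rule ennreal_leI)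
        moreover have "ennreal (?c * w x) = ennreal ?c * ennreal (w x)"
          using c\<zeta> cH w_nonneg[OF xW(2)] by (intro ennreal_mult) auto
        ultimately show ?thesis using True xW by simp
      next
        case False
        then have "indicator (?A M) x = (0::ennreal)" by (rule indicator_simps(2))
        then show ?thesis by simp
      qed
    qed
    finally show ?thesis .
  qed
  moreover have "0 < ?c * c'" using c\<zeta> cH c' by simp
  ultimately show ?thesis using that by blast
qed

text \<open>With \<open>u M\<close> inserted, \<open>mass M\<close> appears on both sides as a
  positive finite number and is divided out. The error is \<open>E / M ^ card J\<close> times the
  quotient of \<open>outer_mass M\<close> by \<open>mass M\<close>, and this quotient is at most
  \<open>Co / ci\<close> because both masses are of order \<open>M\<close>. Of the exponent
  \<open>4 * card J\<close>, one half stems from the energy and the other from the weight, moved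
  across.\<close>

lemma hardy_constant_bound:
  fixes \<Omega> K :: "(real^'n) set" and D B \<gamma> :: real
  assumes vol: "0 < c" "0 < C" "0 < t0"
    "\<And>t. 0 < t \<Longrightarrow> t \<le> t0 \<Longrightarrow> emeasure lborel {x \<in> ball x0 r. \<rho> x \<le> t} \<le> ennreal (C * t ^ card J)"
    "\<And>t. 0 < t \<Longrightarrow> t \<le> t0 \<Longrightarrow> ennreal (c * t ^ card J) \<le> emeasure lborel {x \<in> ball x0 (r/2). \<rho> x \<le> t}"
    and \<Omega>: "ball x0 r \<subseteq> \<Omega>" and K: "closed K" "K \<noteq> {}"
    and K\<rho>: "\<And>x. x \<in> ball x0 r \<Longrightarrow> x \<in> K \<longleftrightarrow> \<rho> x = 0"
    and dist: "\<And>x. x \<in> ball x0 r \<Longrightarrow> infdist x K \<le> (1 + \<eta>) * \<rho> x"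
    and D: "\<And>x. x \<in> \<Omega> \<Longrightarrow> infdist x K \<le> D" and B: "0 \<le> B" and \<gamma>: "0 < \<gamma>" "\<gamma> \<le> real (card J)"
    and Hardy: "\<And>v. v \<in> test_functions (\<Omega> - K) \<Longrightarrow>
        (\<integral>\<^sup>+x\<in>\<Omega>. ennreal (norm (gradient v x) powr real (card J)) \<partial>lborel) \<ge>
        ennreal B * (\<integral>\<^sup>+x\<in>\<Omega>. ennreal (\<bar>v x\<bar> powr real (card J) / infdist x K powr real (card J) *
                                       log_weight (infdist x K / D) powr \<gamma>) \<partial>lborel)"
  obtains C' M0 where "\<And>M. M0 \<le> M \<Longrightarrow>
    B * exp (M * (real (card J) - \<gamma>)) \<le> (1 + \<eta>) ^ (4 * card J) * \<theta> ^ card J + C' / M ^ card J"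
proof -
  let ?k = "card J"
  \<comment> \<open>The exponent is positive, so real and natural powers agree also at base 0, which
    occurs wherever the gradient vanishes.\<close>
  have powr_k: "a powr real ?k = a ^ ?k" if "0 \<le> a" for a :: real
    using that card_J by (intro powr_realpow') auto
  obtain Co mo where Co: "0 < Co" "\<And>M. mo \<le> M \<Longrightarrow> outer_mass M \<le> ennreal (Co * M)"
    using outer_mass_bound[OF vol(2,3,4)] by blast
  obtain ci mi where ci: "0 < ci" "\<And>M. mi \<le> M \<Longrightarrow> ennreal (ci * M) \<le> mass M"
    using mass_bound[OF vol] by blast
  define E where "E = ((1 + 1 / \<eta>) * (2 * CH + 4 * C\<zeta>)) ^ ?k"
  have E: "0 \<le> E" using \<eta> CH C\<zeta> by (simp add: E_def)
  define M0 where "M0 = max (max 1 ((\<bar>ln D\<bar> + 2) / \<eta>)) (max mo mi)"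
  have "B * exp (M * (real ?k - \<gamma>)) \<le> (1 + \<eta>) ^ (4 * ?k) * \<theta> ^ ?k + ((1 + \<eta>) ^ (2 * ?k) * E * (Co / ci)) / M ^ ?k"
    if M: "M0 \<le> M" for M
  proof -
    have M1: "1 \<le> M" "(\<bar>ln D\<bar> + 2) / \<eta> \<le> M" "mo \<le> M" "mi \<le> M" using M by (auto simp: M0_def)
    have "mass M \<le> ennreal (Co * M)" using mass_le_outer_mass Co(2)[OF M1(3)] by (rule order_trans)
    then have "mass M \<noteq> top" by (auto simp: top_unique)
    then obtain i where i: "0 \<le> i" "mass M = ennreal i" by (cases "mass M") auto
    have iM: "ci * M \<le> i" using ci(2)[OF M1(4)] i by (simp add: ennreal_le_iff)
    have ipos: "0 < i" using iM ci(1) M1(1) by (smt (verit) mult_pos_pos)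
    have dpos: "0 < infdist x K" if "x \<in> W" for x
    proof -
      have "x \<notin> K" using K\<rho>[of x] that by (auto simp: W_def)
      then have "infdist x K \<noteq> 0" using in_closed_iff_infdist_zero[OF K] by blast
      then show ?thesis using infdist_nonneg[of x K] by linarith
    qed
    \<comment> \<open>Positive mass yields a point of the window; it lies in \<Omega> and off
      \<open>K\<close>, so its distance is positive and at most \<open>D\<close>.\<close>
    have D0: "0 < D"
    proof -
      have "window M \<noteq> {}"
      proof
        assume "window M = {}"
        then have "mass M = 0" by (simp add: mass_def)
        then show False using i ipos by simp
      qed
      then obtain x where "x \<in> W" using window_subset by blast
      then have "0 < infdist x K" "infdist x K \<le> D" using dpos D \<Omega> by (auto simp: W_def)
      then show ?thesis by linarith
    qed
    let ?a = "(1 / (1 + \<eta>)) ^ (2 * ?k) * exp (M * (real ?k - \<gamma>))"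
    have a: "0 \<le> ?a" using \<eta> by simp
    have lower: "ennreal ?a * mass M \<le> (\<integral>\<^sup>+x\<in>\<Omega>. ennreal (\<bar>u M x\<bar> powr real ?k / infdist x K powr real ?k *
                                       log_weight (infdist x K / D) powr \<gamma>) \<partial>lborel)"
    proof -
      have m: "(\<lambda>x. ennreal ((\<zeta> x * H (ln (s x) / M)) ^ ?k * w x) * indicator (window M) x) \<in> borel_measurable lborel"
        by (intro window_integrand_measurable continuous_intros continuous_on_profile continuous_on_w)
      show ?thesis
        unfolding mass_def nn_integral_cmult[OF m, symmetric]
      proof (rule nn_integral_mono)
        fix x
        show "ennreal ?a * (ennreal ((\<zeta> x * H (ln (s x) / M)) ^ ?k * w x) * indicator (window M) x) \<le>
          ennreal (\<bar>u M x\<bar> powr real ?k / infdist x K powr real ?k * log_weight (infdist x K / D) powr \<gamma>) * indicator \<Omega> x"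
        proof (cases "x \<in> window M")
          case True
          then have xW: "x \<in> W" using window_subset by blast
          then have xb: "x \<in> ball x0 r" "0 < \<rho> x" by (auto simp: W_def)
          have h: "0 \<le> (\<zeta> x * H (ln (s x) / M)) ^ ?k" using \<zeta>_nonneg H_nonneg by simp
          have sM: "exp M \<le> - ln (\<rho> x)" using True by (simp add: window_def s_def)
          have "?a * ((\<zeta> x * H (ln (s x) / M)) ^ ?k * w x) = (\<zeta> x * H (ln (s x) / M)) ^ ?k * (?a * w x)"
            by (simp only: mult_ac)
          also have "\<dots> \<le> (\<zeta> x * H (ln (s x) / M)) ^ ?k *
              (s x ^ (?k - 1) / infdist x K ^ ?k * log_weight (infdist x K / D) powr \<gamma>)"
            using log_weight_lower[OF dpos[OF xW] dist[OF xb(1)] xb(2) \<eta> D0 \<gamma> card_J sM M1(2)]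
            by (intro mult_left_mono h) (simp add: w_def s_def)
          also have "\<dots> = \<bar>u M x\<bar> powr real ?k / infdist x K powr real ?k * log_weight (infdist x K / D) powr \<gamma>"
            using powr_k[of "\<bar>u M x\<bar>"] powr_k[OF infdist_nonneg[of x K]] u_power[OF xW] by simp
          finally have "ennreal (?a * ((\<zeta> x * H (ln (s x) / M)) ^ ?k * w x)) \<le>
             ennreal (\<bar>u M x\<bar> powr real ?k / infdist x K powr real ?k * log_weight (infdist x K / D) powr \<gamma>)"
            by (rule ennreal_leI)
          moreover have "ennreal (?a * ((\<zeta> x * H (ln (s x) / M)) ^ ?k * w x)) =
              ennreal ?a * ennreal ((\<zeta> x * H (ln (s x) / M)) ^ ?k * w x)"
            using a h w_nonneg[OF xW] by (intro ennreal_mult) auto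
          ultimately show ?thesis using True xb \<Omega> by (auto simp del: ennreal_mult')
        qed simp
      qed
    qed
    have uT: "u M \<in> test_functions (\<Omega> - K)"
      using M1(1) \<Omega> K\<rho> by (intro u_test_function) auto
    have "ennreal (B * (?a * i)) = ennreal B * (ennreal ?a * mass M)"
      using B a i by (simp add: ennreal_mult)
    also have "\<dots> \<le> ennreal B * (\<integral>\<^sup>+x\<in>\<Omega>. ennreal (\<bar>u M x\<bar> powr real ?k / infdist x K powr real ?k *
                                       log_weight (infdist x K / D) powr \<gamma>) \<partial>lborel)"
      by (intro mult_left_mono lower) simp
    also have "\<dots> \<le> (\<integral>\<^sup>+x\<in>\<Omega>. ennreal (norm (gradient (u M) x) powr real ?k) \<partial>lborel)"
      by (rule Hardy[OF uT])
    also have "\<dots> = (\<integral>\<^sup>+x\<in>\<Omega>. ennreal (norm (gradient (u M) x) ^ ?k) \<partial>lborel)"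
      by (simp only: powr_k[OF norm_ge_zero])
    also have "\<dots> \<le> ennreal ((1 + \<eta>) ^ (2 * ?k) * \<theta> ^ ?k) * mass M + ennreal (E / M ^ ?k) * outer_mass M"
      using energy_le[OF M1(1), of \<Omega>] by (simp only: E_def)
    also have "\<dots> \<le> ennreal ((1 + \<eta>) ^ (2 * ?k) * \<theta> ^ ?k) * ennreal i + ennreal (E / M ^ ?k) * ennreal (Co * M)"
      using Co(2)[OF M1(3)] i by (intro add_mono mult_left_mono) auto
    also have "\<dots> = ennreal ((1 + \<eta>) ^ (2 * ?k) * \<theta> ^ ?k * i + E / M ^ ?k * (Co * M))"
    proof -
      have nn: "0 \<le> (1 + \<eta>) ^ (2 * ?k) * \<theta> ^ ?k" "0 \<le> E / M ^ ?k" "0 \<le> Co * M" using \<eta> \<theta> E M1 Co by auto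
      show ?thesis
        by (simp only: ennreal_mult[OF nn(1) i(1)] ennreal_mult[OF nn(2,3)]
            ennreal_plus[OF mult_nonneg_nonneg[OF nn(1) i(1)] mult_nonneg_nonneg[OF nn(2,3)]])
    qed
    finally have "B * (?a * i) \<le> (1 + \<eta>) ^ (2 * ?k) * \<theta> ^ ?k * i + E / M ^ ?k * (Co * M)"
      using \<eta> \<theta> E M1 Co i by (subst (asm) ennreal_le_iff) (auto intro!: add_nonneg_nonneg)
    also have "E / M ^ ?k * (Co * M) \<le> E / M ^ ?k * (Co / ci * i)"
    proof (intro mult_left_mono)
      have "Co * M = Co / ci * (ci * M)" using ci by simp
      also have "\<dots> \<le> Co / ci * i" using iM Co ci by (intro mult_left_mono) auto
      finally show "Co * M \<le> Co / ci * i" .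
    qed (use E M1 in auto)
    finally have "(B * ?a) * i \<le> ((1 + \<eta>) ^ (2 * ?k) * \<theta> ^ ?k + E / M ^ ?k * (Co / ci)) * i"
      by (simp only: distrib_right mult.assoc)
    then have "B * ?a \<le> (1 + \<eta>) ^ (2 * ?k) * \<theta> ^ ?k + E / M ^ ?k * (Co / ci)"
      using ipos by (rule mult_right_le_imp_le)
    then have "(1 + \<eta>) ^ (2 * ?k) * (B * ?a) \<le> (1 + \<eta>) ^ (2 * ?k) * ((1 + \<eta>) ^ (2 * ?k) * \<theta> ^ ?k + E / M ^ ?k * (Co / ci))"
      using \<eta> by (intro mult_left_mono) auto
    moreover have "(1 + \<eta>) ^ (2 * ?k) * (B * ?a) = B * exp (M * (real ?k - \<gamma>))"
      using \<eta> by (simp add: power_divide)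
    moreover have "(1 + \<eta>) ^ (2 * ?k) * ((1 + \<eta>) ^ (2 * ?k) * \<theta> ^ ?k + E / M ^ ?k * (Co / ci)) =
        (1 + \<eta>) ^ (4 * ?k) * \<theta> ^ ?k + ((1 + \<eta>) ^ (2 * ?k) * E * (Co / ci)) / M ^ ?k"
    proof -
      have "(1 + \<eta>) ^ (4 * ?k) = (1 + \<eta>) ^ (2 * ?k) * (1 + \<eta>) ^ (2 * ?k)"
        by (simp add: power_add[symmetric])
      then show ?thesis by (simp only: distrib_left mult.assoc times_divide_eq_right times_divide_eq_left
            divide_divide_eq_left mult.commute[of "M ^ ?k" ci])
    qed
    ultimately show ?thesis by (simp only:)
  qed
  then show ?thesis by (rule that)
qed

end

subsection \<open>Sharpness\<close>

text \<open>This lets the case \<open>k = N\<close> be handled as a stratum of dimension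
  zero.\<close>

lemma smooth_submanifold_origin: "smooth_submanifold 0 {0 :: 'a::euclidean_space}"
  unfolding smooth_submanifold_def
proof
  fix x :: 'a assume "x \<in> {0}"
  have "homeomorphism (UNIV :: 'a set) UNIV (\<lambda>x. x) (\<lambda>x. x)" by (rule homeomorphism_ident)
  moreover have "smooth_on (UNIV :: 'a set) (\<lambda>x. x)" by (rule smooth_on_ident) simp
  ultimately show "\<exists>U V \<phi> \<psi> (L :: 'a set). open U \<and> x \<in> U \<and> open V \<and> homeomorphism U V \<phi> \<psi> \<and>
      smooth_on U \<phi> \<and> smooth_on V \<psi> \<and> subspace L \<and> dim L = 0 \<and> \<phi> ` (U \<inter> {0}) = V \<inter> L"
    by (intro exI[of _ UNIV] exI[of _ "\<lambda>x. x"] exI[of _ "{0}"]) (auto simp: subspace_single_0)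
qed

text \<open>A stratum that is open in \<open>K\<close> coincides with \<open>K\<close> near
  \<open>x0\<close>, so the zero set of \<rho> in a small ball is the trace of all of
  \<open>K\<close>. Passing from \<open>S\<close> to the larger set \<open>K\<close> can only
  decrease the distance, which is the direction that the weight estimate asks for.\<close>

lemma hardy_local_bound:
  fixes \<Omega> K S :: "(real^'n) set" and D B \<gamma> \<eta> :: real
  assumes "open \<Omega>" "closed K" and S: "smooth_submanifold m S" "openin (top_of_set K) S" "x0 \<in> S" "x0 \<in> \<Omega>"
    and k: "k + m = CARD('n)" "1 \<le> k" and \<eta>: "0 < \<eta>" "\<eta> \<le> 1"
    and D: "\<And>x. x \<in> \<Omega> \<Longrightarrow> infdist x K \<le> D" and B: "0 \<le> B" and \<gamma>: "0 < \<gamma>" "\<gamma> \<le> real k"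
    and Hardy: "\<And>v. v \<in> test_functions (\<Omega> - K) \<Longrightarrow>
        (\<integral>\<^sup>+x\<in>\<Omega>. ennreal (norm (gradient v x) powr real k) \<partial>lborel) \<ge>
        ennreal B * (\<integral>\<^sup>+x\<in>\<Omega>. ennreal (\<bar>v x\<bar> powr real k / infdist x K powr real k *
                                       log_weight (infdist x K / D) powr \<gamma>) \<partial>lborel)"
  obtains C M0 where "\<And>M. M0 \<le> M \<Longrightarrow>
    B * exp (M * (real k - \<gamma>)) \<le> (1 + \<eta>) ^ (4 * k) * ((real k - 1) / real k) ^ k + C / M ^ k"
proof -
  obtain J :: "'n set" where cardJ: "card J = k"
    using obtain_subset_with_card_n[of k "UNIV :: 'n set"] k(1) by (metis le_add1)
  obtain T where T: "open T" "S = K \<inter> T" using S(2) by (auto simp: openin_open)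
  have "open (\<Omega> \<inter> T)" "x0 \<in> \<Omega> \<inter> T" using assms(1) T S by auto
  then obtain R where R: "0 < R" "ball x0 R \<subseteq> \<Omega> \<inter> T" using open_contains_ball by blast
  have Jm: "card J + m = CARD('n)" using cardJ k by simp
  obtain \<Phi> :: "real^'n \<Rightarrow> real^'n" and r c C t0 where r: "0 < r" "r \<le> R" and smooth: "smooth_on (ball x0 r) \<Phi>"
    and D\<Phi>: "\<And>x v. x \<in> ball x0 r \<Longrightarrow> norm (frechet_derivative \<Phi> (at x) v) \<le> (1 + \<eta>) * norm v"
    and inS: "\<And>x. x \<in> ball x0 r \<Longrightarrow> x \<in> S \<longleftrightarrow> L2_set (\<lambda>j. \<Phi> x $ j) J = 0"
    and inf: "\<And>x. x \<in> ball x0 r \<Longrightarrow> infdist x S \<le> (1 + \<eta>) * L2_set (\<lambda>j. \<Phi> x $ j) J"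
    and vol: "0 < c" "0 < C" "0 < t0"
    "\<And>t. 0 < t \<Longrightarrow> t \<le> t0 \<Longrightarrow>
      emeasure lborel {x \<in> ball x0 r. L2_set (\<lambda>j. \<Phi> x $ j) J \<le> t} \<le> ennreal (C * t ^ card J)"
    "\<And>t. 0 < t \<Longrightarrow> t \<le> t0 \<Longrightarrow>
      ennreal (c * t ^ card J) \<le> emeasure lborel {x \<in> ball x0 (r / 2). L2_set (\<lambda>j. \<Phi> x $ j) J \<le> t}"
    by (rule submanifold_chart_estimates[OF S(1,3) Jm \<eta> R(1)]) (rule that)
  obtain H :: "real \<Rightarrow> real" and cH CH where H: "smooth_on UNIV H" "0 < cH" "0 < CH"
    "\<And>t. 0 \<le> H t" "\<And>t. H t \<le> 1" "\<And>t. t \<notin> {1<..<2} \<Longrightarrow> H t = 0"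
    "\<And>t. t \<in> {5/4..7/4} \<Longrightarrow> cH \<le> H t" "\<And>t. (H has_real_derivative deriv H t) (at t)"
    "\<And>t. \<bar>deriv H t\<bar> \<le> CH" "\<And>t. t \<notin> {1..2} \<Longrightarrow> deriv H t = 0"
    by (rule bump_profile_exists) (rule that)
  have r34: "0 < r/2" "r/2 < 3/4 * r" using r by auto
  obtain \<zeta> :: "real^'n \<Rightarrow> real" and c\<zeta> C\<zeta> where \<zeta>: "smooth_on UNIV \<zeta>" "0 < c\<zeta>" "0 < C\<zeta>"
    "\<And>x. 0 \<le> \<zeta> x" "\<And>x. \<zeta> x \<le> 1" "\<And>x. x \<notin> cball x0 (3/4 * r) \<Longrightarrow> \<zeta> x = 0"
    "\<And>x. x \<in> ball x0 (r/2) \<Longrightarrow> c\<zeta> \<le> \<zeta> x" "\<And>x v. \<bar>frechet_derivative \<zeta> (at x) v\<bar> \<le> C\<zeta> * norm v"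
    by (rule bump_cutoff_exists[OF r34, of x0]) (rule that)
  have Jne: "J \<noteq> {}" using cardJ k(2) by auto
  have ball: "ball x0 r \<subseteq> \<Omega> \<inter> T" using R(2) r(2) by (meson order_trans subset_ball)
  interpret test_function_family \<Phi> J x0 r \<eta> H cH CH \<zeta> c\<zeta> C\<zeta>
    by unfold_locales (fact r(1) smooth Jne \<eta> D\<Phi> H \<zeta>)+
  obtain C' M0 where "\<And>M. M0 \<le> M \<Longrightarrow>
    B * exp (M * (real (card J) - \<gamma>)) \<le> (1 + \<eta>) ^ (4 * card J) * \<theta> ^ card J + C' / M ^ card J"
  proof (rule hardy_constant_bound[OF vol(1,2,3)[folded \<rho>_def] vol(4,5)[folded \<rho>_def] _ assms(2) _ _ _ D B \<gamma>(1) _ Hardy[folded cardJ]])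
    show "x \<in> K \<longleftrightarrow> \<rho> x = 0" if "x \<in> ball x0 r" for x
      using inS[OF that] T(2) ball that by (auto simp: \<rho>_def)
    show "infdist x K \<le> (1 + \<eta>) * \<rho> x" if "x \<in> ball x0 r" for x
    proof -
      have "infdist x K \<le> infdist x S" using T(2) S(3) by (intro infdist_mono) auto
      then show ?thesis using inf[OF that] by (simp add: \<rho>_def)
    qed
  qed (use ball T S cardJ \<gamma> in auto)
  then show ?thesis
    using that[of M0 C'] by (simp add: cardJ \<theta>_def)
qed

theorem theorem5p4:
  fixes \<Omega> K :: "(real ^ 'n) set"
    and k :: nat
    and p D B \<gamma> :: real
  assumes domain: "open \<Omega>" "connected \<Omega>" "\<Omega> \<noteq> {}"
    and K: "(2 \<le> k \<and> k < CARD('n) \<and> piecewise_smooth_surface (CARD('n) - k) K \<and>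
               closed K \<and> connected K \<and> K \<inter> \<Omega> \<noteq> {}) \<or>
            (k = CARD('n) \<and> K = {0} \<and> K \<subseteq> \<Omega>)"
    and bdd: "bdd_above ((\<lambda>x. infdist x K) ` \<Omega>)"
    and D: "D \<ge> (SUP x\<in>\<Omega>. infdist x K)"
    and p: "p = real k"
    and B: "B \<ge> 0"
    and \<gamma>: "\<gamma> > 0"
    and Hardy: "\<forall>u \<in> test_functions (\<Omega> - K).
        (\<integral>\<^sup>+x\<in>\<Omega>. ennreal (norm (gradient u x) powr p) \<partial>lborel) \<ge>
        ennreal B * (\<integral>\<^sup>+x\<in>\<Omega>. ennreal (\<bar>u x\<bar> powr p / infdist x K powr p *
                                       log_weight (infdist x K / D) powr \<gamma>) \<partial>lborel)"
  shows "(B > 0 \<longrightarrow> \<gamma> \<ge> p) \<and> (\<gamma> = p \<longrightarrow> B \<le> ((p - 1) / p) powr p)"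
proof -
  \<comment> \<open>Both cases are reduced to a smooth stratum of codimension \<open>k\<close> that
    is open in \<open>K\<close> and meets \<Omega>. For a surface it exists because the top strata
    are dense in \<open>K\<close> and \<Omega> is open; for \<open>k = N\<close> it is
    \<open>K\<close> itself.\<close>
  obtain S x0 where k: "1 \<le> k" "k \<le> CARD('n)" and "closed K"
    and S: "smooth_submanifold (CARD('n) - k) S" "openin (top_of_set K) S" "x0 \<in> S" "x0 \<in> \<Omega>"
  proof (cases "k = CARD('n) \<and> K = {0} \<and> K \<subseteq> \<Omega>")
    case True
    then show ?thesis
      using that[of "{0}" 0] smooth_submanifold_origin by (auto simp: Suc_le_eq)
  next
    case False
    then have K': "2 \<le> k" "k < CARD('n)" "piecewise_smooth_surface (CARD('n) - k) K" "closed K" "K \<inter> \<Omega> \<noteq> {}"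
      using K by auto
    obtain \<S> where \<S>: "\<forall>S\<in>\<S>. smooth_submanifold (CARD('n) - k) S \<longrightarrow> openin (top_of_set K) S"
        "K \<subseteq> closure (\<Union>{S \<in> \<S>. smooth_submanifold (CARD('n) - k) S})"
      using K'(3) unfolding piecewise_smooth_surface_def by auto
    have "\<Omega> \<inter> closure (\<Union>{S \<in> \<S>. smooth_submanifold (CARD('n) - k) S}) \<noteq> {}"
      using K'(5) \<S>(2) by blast
    then have "\<Omega> \<inter> \<Union>{S \<in> \<S>. smooth_submanifold (CARD('n) - k) S} \<noteq> {}"
      using open_Int_closure_eq_empty[OF domain(1)] by blast
    then obtain S x0 where "S \<in> \<S>" "smooth_submanifold (CARD('n) - k) S" "x0 \<in> S" "x0 \<in> \<Omega>" by blast
    then show ?thesis using that[of S x0] \<S>(1) K' by auto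
  qed
  have dD: "infdist x K \<le> D" if "x \<in> \<Omega>" for x
    using cSUP_upper[OF that bdd] D by linarith
  have km: "k + (CARD('n) - k) = CARD('n)" using k by simp
  let ?\<theta> = "(real k - 1) / real k"
  \<comment> \<open>Claim (i) is refuted with \<open>\<gamma> < k\<close> and claim (ii) has
    \<open>\<gamma> = k\<close>, so a bound for \<open>\<gamma> \<le> k\<close> covers both.\<close>
  have bound: "\<exists>C M0. \<forall>M\<ge>M0. B * exp (M * (real k - \<gamma>)) \<le> (1 + \<eta>) ^ (4 * k) * ?\<theta> ^ k + C / M ^ k"
    if "0 < \<eta>" "\<eta> \<le> 1" "\<gamma> \<le> real k" for \<eta>
    by (rule hardy_local_bound[OF domain(1) \<open>closed K\<close> S km k(1) that(1,2) dD B \<gamma> that(3)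
          Hardy[rule_format, unfolded p]]) blast+
  have lim: "((\<lambda>M. c + C / M ^ k) \<longlongrightarrow> c) at_top" for c C :: real
  proof -
    have "((\<lambda>M. C / M ^ k) \<longlongrightarrow> 0) at_top"
      using k by (intro real_tendsto_divide_at_top[OF tendsto_const] filterlim_pow_at_top filterlim_ident) auto
    then show ?thesis using tendsto_add[OF tendsto_const, of "\<lambda>M. C / M ^ k" 0 at_top c] by simp
  qed
  have "p \<le> \<gamma>" if "0 < B"
  proof (rule ccontr)
    assume "\<not> p \<le> \<gamma>"
    then have \<gamma>k: "0 < real k - \<gamma>" using p by simp
    \<comment> \<open>The crude choice \<open>\<eta> = 1\<close> is enough, as the left side grows
      exponentially in \<open>M\<close> while the right side converges.\<close>
    then obtain C M0 where CM: "\<And>M. M0 \<le> M \<Longrightarrow>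
        B * exp (M * (real k - \<gamma>)) \<le> (1 + 1) ^ (4 * k) * ?\<theta> ^ k + C / M ^ k"
      using bound[of 1] by force
    have "filterlim (\<lambda>M. B * exp (M * (real k - \<gamma>))) at_top at_top"
      using that \<gamma>k
      by (intro filterlim_tendsto_pos_mult_at_top[OF tendsto_const] filterlim_compose[OF exp_at_top]
          filterlim_at_top_mult_tendsto_pos[OF tendsto_const] filterlim_ident) auto
    then have "filterlim (\<lambda>M. (1 + 1) ^ (4 * k) * ?\<theta> ^ k + C / M ^ k) at_top at_top"
      by (rule filterlim_at_top_mono) (use CM in \<open>auto simp: eventually_at_top_linorder\<close>)
    then show False
      using lim not_tendsto_and_filterlim_at_infinity[OF trivial_limit_at_top_linorder]
        filterlim_at_top_imp_at_infinity by blast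
  qed
  moreover have "B \<le> ((p - 1) / p) powr p" if "\<gamma> = p"
  proof -
    \<comment> \<open>At \<open>\<gamma> = k\<close> the exponential is 1, so \<open>M\<close>
      tending to infinity removes the error; only the distortion \<open>1 + \<eta>\<close> remains
      for the second limit.\<close>
    have le: "B \<le> (1 + \<eta>) ^ (4 * k) * ?\<theta> ^ k" if \<eta>: "0 < \<eta>" "\<eta> \<le> 1" for \<eta> :: real
    proof -
      obtain C M0 where "\<And>M. M0 \<le> M \<Longrightarrow> B \<le> (1 + \<eta>) ^ (4 * k) * ?\<theta> ^ k + C / M ^ k"
        using bound[OF \<eta>] \<open>\<gamma> = p\<close> p by auto
      then have "\<forall>\<^sub>F M in at_top. B \<le> (1 + \<eta>) ^ (4 * k) * ?\<theta> ^ k + C / M ^ k"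
        by (auto simp: eventually_at_top_linorder)
      then show ?thesis by (rule tendsto_lowerbound[OF lim _ trivial_limit_at_top_linorder])
    qed
    have "((\<lambda>\<eta>. (1 + \<eta>) ^ (4 * k) * ?\<theta> ^ k) \<longlongrightarrow> (1 + 0) ^ (4 * k) * ?\<theta> ^ k) (at_right (0::real))"
      by (intro tendsto_intros)
    moreover have "\<forall>\<^sub>F \<eta> in at_right (0::real). B \<le> (1 + \<eta>) ^ (4 * k) * ?\<theta> ^ k"
      unfolding eventually_at_right_field using le by (intro exI[of _ 1]) auto
    ultimately have "B \<le> (1 + 0) ^ (4 * k) * ?\<theta> ^ k"
      by (rule tendsto_lowerbound) simp
    \<comment> \<open>For \<open>k = 1\<close> the base is 0, and both powers are 0 because the
      exponent is positive.\<close>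
    moreover have "((p - 1) / p) powr p = ?\<theta> ^ k"
      unfolding p using k by (intro powr_realpow') auto
    ultimately show ?thesis by simp
  qed
  ultimately show ?thesis by blast
qed

end
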